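(* Let $P\subset\mathbb{R}^4$ be a $4$-polytope and $G(P)$ a polytopal digraph of $P$ that is an $X$-type graph whose unique sink $v$ is a simple vertex of $P$. Let $v_1,v_2,v_3,v_4$ be the neighbours of $v$, labelled so that there is no directed path from $v_4$ to $v_3$ in $G(P)$; let $u_1,u_2$ be points in the relative interiors of the edges $[v,v_1],[v,v_2]$; let $H$ be the hyperplane through $u_1,u_2,v_3,v_4$, $H^+$ the open half-space bounded by $H$ containing all vertices of $P$ other than $v$, and $tr(P,v)=P\cap(H\cup H^+)$. Let $tr(G(P))$ be the orientation of the skeleton of $tr(P,v)$ in which every edge that is already an edge of $G(P)$ keeps its orientation, and the new edges are oriented as $(v_3,v_4)$ (if this is not an edge of $G(P)$), $(v_1,u_1),(v_3,u_1),(v_4,u_1),(v_2,u_2),(v_3,u_2),(v_4,u_2),(u_1,u_2)$, where $(a,b)$ means the edge directed from $a$ to $b$. Then $tr(G(P))$ is also an $X$-type graph.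
   Context: A polytopal digraph $G(P)$ is an orientation of the edges of the skeleton of $P$; for a face $H$, $G(P,H)$ is the induced subdigraph on the vertices of $H$. Acyclic: no directed cycle. USO: for every non-empty face $H$, $G(P,H)$ has a unique source and a unique sink. Holt–Klee property: USO and for every $k$-face $H$ there are $k$ vertex-disjoint (apart from endpoints) directed paths in $G(P,H)$ from its source to its sink. A simple vertex of a $4$-polytope is one with exactly four neighbours. A topological sort is a vertex ordering in which $u$ precedes $w$ whenever $(u,w)$ is an edge. $P^*$ is a combinatorial polar of $P$ (face lattice turned upside down), $F(w)$ the facet of $P^*$ corresponding to vertex $w$. A shelling of a polytope $Q$ is a linear ordering $F_1,\dots,F_s$ of its facets such that either the facets are points, or (i) $F_1$ has a linear ordering of its own facets that is a shelling of $F_1$, and (ii) for $1<j\le s$, $F_j\cap\bigcup_{i<j}F_i$ is non-empty and equals $G_1\cup\cdots\cup G_r$ for some shelling $G_1,\dots,G_r,\dots,G_t$ of $F_j$, $1\le r\le t$. Shelling property: some topological sort $w_1,\dots,w_n$ of $G(P)$ makes $F(w_1),\dots,F(w_n)$ a shelling of $P^*$. $X$-type graph: an acyclic USO with the Holt–Klee property but without the shelling property.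
   Formalization: Since v_3 and v_4 lie on H, no open half-space bounded by H contains all vertices of P other than v; H^+ is taken to be the open half-space bounded by H containing all vertices of P other than v, v_3 and v_4, which always exists and is unique. *)

theory Defs
  imports "HOL-Analysis.Analysis"
begin

definition vertices :: "'a::euclidean_space set \<Rightarrow> 'a set" where
  "vertices P = {w. w extreme_point_of P}"

definition neighbours :: "'a::euclidean_space set \<Rightarrow> 'a \<Rightarrow> 'a set" where
  "neighbours P v = {w. closed_segment v w edge_of P}"

text \<open>Only meant for 4-polytopes, where simple means having exactly four neighbours.\<close>

definition simple_vertex :: "'a::euclidean_space set \<Rightarrow> 'a \<Rightarrow> bool" where
  "simple_vertex P v \<longleftrightarrow> v \<in> vertices P \<and> card (neighbours P v) = 4"

text \<open>
  A digraph on the vertices of a polytope is given by its set of arcs, \<open>(a, b)\<close> being the edge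
  directed from \<open>a\<close> to \<open>b\<close>. Since \<open>closed_segment a b = closed_segment b a\<close>, the last clause says
  that every edge of the skeleton receives exactly one of its two orientations.
\<close>

definition polytopal_digraph :: "'a::euclidean_space set \<Rightarrow> ('a \<times> 'a) set \<Rightarrow> bool" where
  "polytopal_digraph P E \<longleftrightarrow>
     polytope P \<and>
     (\<forall>a b. (a, b) \<in> E \<longrightarrow> closed_segment a b edge_of P) \<and>
     (\<forall>a b. closed_segment a b edge_of P \<longrightarrow> ((a, b) \<in> E \<longleftrightarrow> (b, a) \<notin> E))"

text \<open>The arcs of the subdigraph induced on the vertices of a face \<open>H\<close>.\<close>

definition face_arcs :: "('a::euclidean_space \<times> 'a) set \<Rightarrow> 'a set \<Rightarrow> ('a \<times> 'a) set" where
  "face_arcs E H = E \<inter> vertices H \<times> vertices H"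

definition source_in :: "('a::euclidean_space \<times> 'a) set \<Rightarrow> 'a set \<Rightarrow> 'a \<Rightarrow> bool" where
  "source_in E H s \<longleftrightarrow> s \<in> vertices H \<and> (\<forall>w. (w, s) \<notin> face_arcs E H)"

definition sink_in :: "('a::euclidean_space \<times> 'a) set \<Rightarrow> 'a set \<Rightarrow> 'a \<Rightarrow> bool" where
  "sink_in E H t \<longleftrightarrow> t \<in> vertices H \<and> (\<forall>w. (t, w) \<notin> face_arcs E H)"

definition USO :: "'a::euclidean_space set \<Rightarrow> ('a \<times> 'a) set \<Rightarrow> bool" where
  "USO P E \<longleftrightarrow>
     (\<forall>H. H face_of P \<and> H \<noteq> {} \<longrightarrow> (\<exists>!s. source_in E H s) \<and> (\<exists>!t. sink_in E H t))"

definition directed_path :: "('a \<times> 'a) set \<Rightarrow> 'a \<Rightarrow> 'a \<Rightarrow> 'a list \<Rightarrow> bool" where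
  "directed_path A s t p \<longleftrightarrow>
     p \<noteq> [] \<and> hd p = s \<and> last p = t \<and> distinct p \<and> successively (\<lambda>x y. (x, y) \<in> A) p"

text \<open>
  The paths are collected in a set, so that the \<open>k\<close> paths are pairwise distinct; in particular
  a single arc from source to sink counts only once.
\<close>

definition holt_klee :: "'a::euclidean_space set \<Rightarrow> ('a \<times> 'a) set \<Rightarrow> bool" where
  "holt_klee P E \<longleftrightarrow>
     USO P E \<and>
     (\<forall>H s t. H face_of P \<and> source_in E H s \<and> sink_in E H t \<longrightarrow>
        (\<exists>ps. finite ps \<and> int (card ps) = aff_dim H \<and>
              (\<forall>p\<in>ps. directed_path (face_arcs E H) s t p) \<and>
              pairwise (\<lambda>p q. set p \<inter> set q = {s, t}) ps))"

definition topological_sort :: "'a::euclidean_space set \<Rightarrow> ('a \<times> 'a) set \<Rightarrow> 'a list \<Rightarrow> bool" where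
  "topological_sort P E ws \<longleftrightarrow>
     distinct ws \<and> set ws = vertices P \<and>
     (\<forall>i<length ws. \<forall>j<length ws. (ws ! i, ws ! j) \<in> E \<longrightarrow> i < j)"

text \<open>
  In the base case \<open>aff_dim Q = 1\<close> expresses that the facets of \<open>Q\<close> are points. List positions
  start at \<open>0\<close>, so the facets preceding \<open>Fs ! j\<close> are the members of \<open>take j Fs\<close>.
\<close>

inductive shelling :: "'a::euclidean_space set \<Rightarrow> 'a set list \<Rightarrow> bool" where
  points: "shelling Q Fs"
    if "polytope Q" and "aff_dim Q = 1" and "distinct Fs" and "set Fs = {F. F facet_of Q}"
| step: "shelling Q Fs"
    if "polytope Q" and "aff_dim Q > 1" and "distinct Fs" and "set Fs = {F. F facet_of Q}"
      and "\<exists>Gs. shelling (hd Fs) Gs"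
      and "\<forall>j. 0 < j \<and> j < length Fs \<longrightarrow>
             Fs ! j \<inter> \<Union> (set (take j Fs)) \<noteq> {} \<and>
             (\<exists>Gs r. shelling (Fs ! j) Gs \<and> 1 \<le> r \<and> r \<le> length Gs \<and>
                     Fs ! j \<inter> \<Union> (set (take j Fs)) = \<Union> (set (take r Gs)))"

text \<open>
  \<open>Q\<close> is a combinatorial polar of \<open>P\<close> via the anti-isomorphism \<open>\<phi>\<close> of face lattices. The facet of
  \<open>Q\<close> corresponding to the vertex \<open>w\<close> of \<open>P\<close> is \<open>\<phi> {w}\<close>. The predicate \<open>face_of\<close> admits both the
  empty face and the polytope itself, so these are the full face lattices.
\<close>

definition combinatorial_polar ::
    "'a::euclidean_space set \<Rightarrow> 'a set \<Rightarrow> ('a set \<Rightarrow> 'a set) \<Rightarrow> bool" where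
  "combinatorial_polar P Q \<phi> \<longleftrightarrow>
     polytope Q \<and>
     bij_betw \<phi> {F. F face_of P} {G. G face_of Q} \<and>
     (\<forall>F F'. F face_of P \<and> F' face_of P \<longrightarrow> (F \<subseteq> F' \<longleftrightarrow> \<phi> F' \<subseteq> \<phi> F))"

text \<open>
  A polytope has a combinatorial polar in its own ambient space, and whether an ordering of the
  facets is a shelling depends only on the face lattice. So it does not matter which polar is taken.
\<close>

definition shelling_property :: "'a::euclidean_space set \<Rightarrow> ('a \<times> 'a) set \<Rightarrow> bool" where
  "shelling_property P E \<longleftrightarrow>
     (\<exists>Q \<phi> ws. combinatorial_polar P Q \<phi> \<and> topological_sort P E ws \<and>
               shelling Q (map (\<lambda>w. \<phi> {w}) ws))"

definition X_type :: "'a::euclidean_space set \<Rightarrow> ('a \<times> 'a) set \<Rightarrow> bool" where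
  "X_type P E \<longleftrightarrow>
     polytopal_digraph P E \<and> acyclic E \<and> USO P E \<and> holt_klee P E \<and> \<not> shelling_property P E"

text \<open>
  The arcs of the truncated digraph, where \<open>T\<close> is the truncated polytope. If \<open>(v3, v4)\<close> already
  belongs to \<open>E\<close>, inserting it changes nothing.
\<close>

definition tr_arcs ::
    "('a::euclidean_space \<times> 'a) set \<Rightarrow> 'a set \<Rightarrow> 'a \<Rightarrow> 'a \<Rightarrow> 'a \<Rightarrow> 'a \<Rightarrow> 'a \<Rightarrow> 'a \<Rightarrow> ('a \<times> 'a) set" where
  "tr_arcs E T v1 v2 v3 v4 u1 u2 =
     {(a, b) \<in> E. closed_segment a b edge_of T} \<union>
     {(v3, v4), (v1, u1), (v3, u1), (v4, u1), (v2, u2), (v3, u2), (v4, u2), (u1, u2)}"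

end

theory Submission
  imports Defs
begin

text \<open>
  The shelling property is local. In an acyclic USO, a topological sort \<open>ws\<close> induces a shelling of the
  polar iff at every vertex \<open>w\<close> the set of edges of in-arcs is an initial segment of a shelling of
  the facet of the polar corresponding to \<open>w\<close>, i.e. of an ordering of the edges at \<open>w\<close>. The
  truncation changes the facets of the polar only at \<open>v3\<close> and \<open>v4\<close>, where a triangle is subdivided
  from an interior point (or partly subdivided and partly merged with a neighbour), and a shelling
  of the subdivided 2-sphere yields one of the original 2-sphere by letting the triangle take the
  place of the second of its three parts. Hence a shelling for \<open>tr(G(P))\<close> gives one for \<open>G(P)\<close>.
  The remaining properties follow by extending each path that ends with an arc from \<open>v_i\<close>
  to \<open>v\<close> to the new sink.
\<close>

section \<open>Combinatorial polars\<close>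

text \<open>Shellings of the two polars are never compared directly. A shelling of a polar is
  rewritten as a statement on the faces of the polytope through one vertex, with inclusions
  reversed, so the polars of \<open>P\<close> and \<open>T\<close> need no geometric relation. Nor
  is a topological sort of \<open>T\<close> converted: once the local condition holds at each
  vertex, any topological sort of \<open>P\<close> serves. The second place of the triangle is
  forced from both sides. When its first part arrives, the triangle may touch an earlier facet in
  the opposite corner only, and its intersection would not be pure; when the second part arrives,
  purity at that corner has been checked in \<open>T\<close>. Waiting for the third part would be
  too late, since an old neighbour may by then have been attached to the second part. The absence of
  a path from \<open>v4\<close> to \<open>v3\<close> gives more than acyclicity: it agrees with an
  edge already present between them, keeps \<open>v4\<close> from being the source, and lets a path
  that ends at \<open>v3\<close> be prolonged by \<open>v4\<close>.\<close>

lemma aff_dim_face_less: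
  fixes S :: "'a::euclidean_space set"
  assumes "polytope S" "F face_of S" "G face_of S" "F \<subset> G"
  shows "aff_dim F < aff_dim G"
  by (metis assms face_of_aff_dim_lt face_of_face face_of_imp_convex psubset_imp_subset psubset_eq)

text \<open>A nonempty proper face of a polytope lies in a facet, and maximality turns it into that
  facet. The empty face is treated apart because \<open>facet_of\<close> demands nonemptiness: if it
  is maximal, an extreme point already exhausts \<open>S\<close>.\<close>

lemma aff_dim_maximal_proper_face:
  fixes S :: "'a::euclidean_space set"
  assumes S: "polytope S" and F: "F face_of S" "F \<noteq> S"
    and max: "\<And>G. G face_of S \<Longrightarrow> F \<subseteq> G \<Longrightarrow> G = F \<or> G = S"
  shows "aff_dim F = aff_dim S - 1"
proof (cases "F = {}")
  case True
  then obtain x where "x extreme_point_of S"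
    using F S extreme_point_exists_convex polytope_imp_compact polytope_imp_convex by metis
  then have "{x} face_of S" by (simp add: face_of_singleton)
  then have "S = {x}" using max True by force
  then show ?thesis using True by simp
next
  case False
  obtain C where "C facet_of S" "F \<subseteq> C"
    using face_of_polyhedron_subset_facet[OF polytope_imp_polyhedron[OF S] F(1) False F(2)] by blast
  then show ?thesis using max[of C] by (metis facet_of_def facet_of_irrefl)
qed

lemma exists_covering_face:
  fixes S :: "'a::euclidean_space set"
  assumes S: "polytope S" and F: "F face_of S" "F \<noteq> S"
  shows "\<exists>G. G face_of S \<and> F \<subset> G \<and> aff_dim G = aff_dim F + 1"
proof -
  have "\<exists>G. G face_of S \<and> F \<subset> G"
  proof (intro exI conjI)
    show "S face_of S" using S by (simp add: face_of_refl polytope_imp_convex)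
    show "F \<subset> S" using F face_of_imp_subset by auto
  qed
  then obtain G0 where "G0 face_of S \<and> F \<subset> G0" by blast
  \<comment> \<open>A face of least dimension strictly above \<open>F\<close> covers it. The shift
    by 1 makes \<open>nat\<close> harmless, since \<open>aff_dim\<close> starts at -1.\<close>
  then obtain G where G: "G face_of S" "F \<subset> G"
    and min: "\<And>G'. G' face_of S \<Longrightarrow> F \<subset> G' \<Longrightarrow> nat (aff_dim G + 1) \<le> nat (aff_dim G' + 1)"
    using ex_has_least_nat[of "\<lambda>G. G face_of S \<and> F \<subset> G" G0 "\<lambda>G. nat (aff_dim G + 1)"] by auto
  have GP: "polytope G" using G S face_of_polytope_polytope by blast
  have "aff_dim F = aff_dim G - 1"
  proof (rule aff_dim_maximal_proper_face[OF GP])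
    show "F face_of G" using F G face_of_face by blast
    show "F \<noteq> G" using G by blast
    fix K assume K: "K face_of G" "F \<subseteq> K"
    show "K = F \<or> K = G"
    proof (rule ccontr)
      assume "\<not> ?thesis"
      moreover have KS: "K face_of S" using K G face_of_trans by blast
      ultimately have "F \<subset> K" "K \<subset> G" using K face_of_imp_subset by blast+
      then have "aff_dim K < aff_dim G" using aff_dim_face_less S KS G by blast
      moreover have "aff_dim K \<ge> -1" by (rule aff_dim_geq)
      ultimately show False using min[OF KS \<open>F \<subset> K\<close>] by linarith
    qed
  qed
  then show ?thesis using G by (intro exI[of _ G]) auto
qed

lemma polar_inj:
  assumes "combinatorial_polar P Q \<phi>" "F face_of P" "F' face_of P"
  shows "\<phi> F = \<phi> F' \<longleftrightarrow> F = F'" "\<phi> F \<subseteq> \<phi> F' \<longleftrightarrow> F' \<subseteq> F" "\<phi> F face_of Q"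
  using assms unfolding combinatorial_polar_def bij_betw_def by blast+

lemma polar_surj:
  assumes "combinatorial_polar P Q \<phi>" "K face_of Q"
  obtains F where "F face_of P" "K = \<phi> F"
proof -
  have "K \<in> \<phi> ` {F. F face_of P}"
    using assms unfolding combinatorial_polar_def bij_betw_def by simp
  then show thesis using that by blast
qed

lemma polar_top_bot:
  fixes P :: "'a::euclidean_space set"
  assumes c: "combinatorial_polar P Q \<phi>" and P: "polytope P"
  shows "\<phi> P = {}" "\<phi> {} = Q"
proof -
  have Pf: "P face_of P" using P face_of_refl polytope_imp_convex by blast
  have Q: "polytope Q" using c combinatorial_polar_def by blast
  have Qf: "Q face_of Q" using Q face_of_refl polytope_imp_convex by blast
  obtain F where "F face_of P" "{} = \<phi> F" using polar_surj[OF c, of "{}"] by auto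
  then show "\<phi> P = {}" using polar_inj(2)[OF c Pf, of F] face_of_imp_subset[of F P] by auto
  obtain F where "F face_of P" "Q = \<phi> F" using polar_surj[OF c Qf] by auto
  then show "\<phi> {} = Q" using polar_inj(2)[OF c, of F "{}"] polar_inj(3)[OF c, of "{}" "{}"]
    face_of_imp_subset[of "\<phi> {}" Q] by auto
qed

text \<open>An anti-isomorphism carries no metric information, so dimensions have to be read off
  from coverings. Going down from \<open>P\<close>, a face that covers \<open>F\<close> becomes a
  maximal proper face of \<open>\<phi> F\<close> and so has one dimension less.\<close>

lemma polar_aff_dim:
  fixes P :: "'a::euclidean_space set"
  assumes c: "combinatorial_polar P Q \<phi>" and P: "polytope P" and "F face_of P"
  shows "aff_dim (\<phi> F) = aff_dim P - 1 - aff_dim F"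
  using assms(3)
proof (induction "nat (aff_dim P - aff_dim F)" arbitrary: F rule: less_induct)
  case less
  have Q: "polytope Q" using c combinatorial_polar_def by blast
  show ?case
  proof (cases "F = P")
    case True then show ?thesis using polar_top_bot[OF c P] by simp
  next
    case False
    then obtain G where G: "G face_of P" "F \<subset> G" "aff_dim G = aff_dim F + 1"
      using exists_covering_face[OF P less.prems] by blast
    have "aff_dim G \<le> aff_dim P" using G(1) by (simp add: aff_dim_subset face_of_imp_subset)
    then have IH: "aff_dim (\<phi> G) = aff_dim P - 1 - aff_dim G"
      using less.hyps[OF _ G(1)] G(3) by auto
    have Ff: "\<phi> F face_of Q" and Gf: "\<phi> G face_of Q" using polar_inj[OF c] less.prems G by blast+
    have "aff_dim (\<phi> G) = aff_dim (\<phi> F) - 1"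
    proof (rule aff_dim_maximal_proper_face)
      show "polytope (\<phi> F)" using Q Ff face_of_polytope_polytope by blast
      have "\<phi> G \<subseteq> \<phi> F" using polar_inj(2)[OF c G(1) less.prems] G by blast
      then show "\<phi> G face_of \<phi> F" using Ff Gf face_of_face by blast
      show "\<phi> G \<noteq> \<phi> F" using polar_inj(1)[OF c G(1) less.prems] G by blast
      fix K assume K: "K face_of \<phi> F" "\<phi> G \<subseteq> K"
      then have "K face_of Q" using Ff face_of_trans by blast
      then obtain K' where K': "K' face_of P" "K = \<phi> K'" using polar_surj[OF c] by blast
      have "F \<subseteq> K'" "K' \<subseteq> G"
        using polar_inj(2)[OF c] K K' G less.prems face_of_imp_subset by metis+
      moreover have "K' = F \<or> K' = G"
      proof (rule ccontr)
        assume "\<not> ?thesis"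
        then have "F \<subset> K'" "K' \<subset> G" using calculation by auto
        then show False using aff_dim_face_less[OF P] K'(1) G less.prems by (smt (verit))
      qed
      ultimately show "K = \<phi> G \<or> K = \<phi> F" using K' by blast
    qed
    then show ?thesis using IH G by simp
  qed
qed

text \<open>The polar of \<open>S\<close> is taken inside \<open>span S\<close>, so that it also applies to the proper faces of
  a polytope.\<close>

definition polar_body :: "'a::euclidean_space set \<Rightarrow> 'a set" where
  "polar_body S = {y \<in> span S. \<forall>x\<in>S. x \<bullet> y \<le> 1}"

definition polar_face :: "'a::euclidean_space set \<Rightarrow> 'a set \<Rightarrow> 'a set" where
  "polar_face S F = {y \<in> polar_body S. \<forall>x\<in>F. x \<bullet> y = 1}"

lemma rel_interior_zero_ball:
  fixes S :: "'a::euclidean_space set"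
  assumes "0 \<in> rel_interior S"
  obtains e where "e > 0" "\<And>x. x \<in> span S \<Longrightarrow> norm x \<le> e \<Longrightarrow> x \<in> S"
proof -
  have "0 \<in> S" using assms rel_interior_subset by blast
  then have "affine hull S = span S" by (simp add: affine_hull_span_0 hull_inc)
  moreover obtain e where "e > 0" "cball 0 e \<inter> affine hull S \<subseteq> S"
    using assms by (auto simp: mem_rel_interior_cball)
  ultimately show ?thesis using that[of e] by (auto simp: subset_iff)
qed

text \<open>Finitely many half-spaces suffice, one for each generator of \<open>S\<close>;
  boundedness comes from a ball of \<open>span S\<close> contained in \<open>S\<close>.\<close>

lemma polar_body_polytope:
  fixes S :: "'a::euclidean_space set"
  assumes S: "polytope S" and 0: "0 \<in> rel_interior S"
  shows "polytope (polar_body S)"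
proof -
  obtain V where V: "finite V" "S = convex hull V" using S polytope_def by blast
  have eq: "polar_body S = span S \<inter> (\<Inter>x\<in>V. {y. x \<bullet> y \<le> 1})"
  proof -
    have "(\<forall>x\<in>S. x \<bullet> y \<le> 1) \<longleftrightarrow> (\<forall>x\<in>V. x \<bullet> y \<le> 1)" for y
    proof
      assume "\<forall>x\<in>V. x \<bullet> y \<le> 1"
      then have "V \<subseteq> {x. y \<bullet> x \<le> 1}" by (auto simp: inner_commute)
      then have "S \<subseteq> {x. y \<bullet> x \<le> 1}" unfolding V by (simp add: convex_halfspace_le hull_minimal)
      then show "\<forall>x\<in>S. x \<bullet> y \<le> 1" by (auto simp: inner_commute)
    qed (use V(2) hull_subset[of V convex] in auto)
    then show ?thesis by (auto simp: polar_body_def)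
  qed
  have "polyhedron (polar_body S)" unfolding eq
    using V by (intro polyhedron_Int polyhedron_Inter)
      (auto simp: polyhedron_halfspace_le affine_imp_polyhedron subspace_imp_affine)
  moreover have "bounded (polar_body S)"
  proof -
    obtain e where e: "e > 0" "\<And>x. x \<in> span S \<Longrightarrow> norm x \<le> e \<Longrightarrow> x \<in> S"
      using rel_interior_zero_ball[OF 0] by blast
    have "norm y \<le> 1 / e" if y: "y \<in> polar_body S" for y
    proof (cases "y = 0")
      case False
      \<comment> \<open>Testing \<open>y\<close> against the point of the ball in its own direction
        bounds its norm by \<open>1 / e\<close>.\<close>
      have "(e / norm y) *\<^sub>R y \<in> S" using e y by (auto simp: polar_body_def span_scale)
      then have "(e / norm y) *\<^sub>R y \<bullet> y \<le> 1" using y by (auto simp: polar_body_def)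
      then have "e * norm y \<le> 1" using False
        by (simp add: dot_square_norm power2_eq_square)
      then show ?thesis using e by (simp add: field_simps)
    qed (use e in auto)
    then show ?thesis by (auto simp: bounded_iff)
  qed
  ultimately show ?thesis by (simp add: polytope_eq_bounded_polyhedron)
qed

lemma polar_body_zero:
  fixes S :: "'a::euclidean_space set"
  assumes S: "polytope S" and 0: "0 \<in> rel_interior S"
  shows "0 \<in> rel_interior (polar_body S)" "span (polar_body S) = span S"
proof -
  obtain B where B: "B > 0" "\<And>x. x \<in> S \<Longrightarrow> norm x \<le> B"
    using polytope_imp_bounded[OF S] bounded_pos by blast
  have ball: "y \<in> polar_body S" if "y \<in> span S" "norm y \<le> 1 / B" for y
    unfolding polar_body_def
  proof (intro CollectI conjI ballI)
    fix x assume "x \<in> S"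
    have "x \<bullet> y \<le> norm x * norm y" by (rule norm_cauchy_schwarz)
    also have "\<dots> \<le> B * (1 / B)" using B \<open>x \<in> S\<close> that by (intro mult_mono) auto
    finally show "x \<bullet> y \<le> 1" using B by simp
  qed (use that in auto)
  show sp: "span (polar_body S) = span S"
  proof
    show "span (polar_body S) \<subseteq> span S" by (rule span_minimal) (auto simp: polar_body_def)
    show "span S \<subseteq> span (polar_body S)"
    proof
      fix y assume y: "y \<in> span S"
      show "y \<in> span (polar_body S)"
      proof (cases "y = 0")
        case False
        have "(1 / B / norm y) *\<^sub>R y \<in> polar_body S"
          using y B by (intro ball) (auto simp: span_scale)
        then have "(norm y * B) *\<^sub>R ((1 / B / norm y) *\<^sub>R y) \<in> span (polar_body S)"
          by (intro span_scale span_base)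
        then show ?thesis using False B by simp
      qed (simp add: span_zero)
    qed
  qed
  have "0 \<in> polar_body S" using ball[of 0] B by (simp add: span_zero)
  then have "affine hull (polar_body S) = span S"
    using affine_hull_span_0 hull_inc sp by metis
  then show "0 \<in> rel_interior (polar_body S)"
    unfolding mem_rel_interior_cball
    using \<open>0 \<in> polar_body S\<close> B ball by (auto intro!: exI[of _ "1/B"])
qed

text \<open>A point outside \<open>S\<close> is cut off by a hyperplane. Projected to
  \<open>span S\<close> and rescaled, its normal vector becomes a member of the polar body whose
  inequality the point violates.\<close>

lemma bipolar:
  fixes S :: "'a::euclidean_space set"
  assumes S: "polytope S" and 0: "0 \<in> rel_interior S"
  shows "polar_body (polar_body S) = S"
proof
  have sp: "span (polar_body S) = span S" using polar_body_zero[OF assms] by blast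
  show "S \<subseteq> polar_body (polar_body S)"
  proof
    fix x assume x: "x \<in> S"
    then have "x \<in> span (polar_body S)" using sp span_base by metis
    moreover have "y \<bullet> x \<le> 1" if "y \<in> polar_body S" for y
      using that x unfolding polar_body_def by (simp add: inner_commute)
    ultimately show "x \<in> polar_body (polar_body S)"
      unfolding polar_body_def[of "polar_body S"] by simp
  qed
  show "polar_body (polar_body S) \<subseteq> S"
  proof
    fix x assume x: "x \<in> polar_body (polar_body S)"
    show "x \<in> S"
    proof (rule ccontr)
      assume "x \<notin> S"
      moreover have "closed S" "convex S" using S polytope_imp_closed polytope_imp_convex by blast+
      ultimately obtain a b where ab: "a \<bullet> x < b" "\<And>s. s \<in> S \<Longrightarrow> a \<bullet> s > b"
        using separating_hyperplane_closed_point[of S x] by blast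
      \<comment> \<open>As \<open>0\<close> belongs to \<open>S\<close>, the separating level is
        negative; dividing by it reverses the inequalities into the form used in
        \<open>polar_body\<close>.\<close>
      have b: "b < 0" using ab(2)[of 0] 0 rel_interior_subset by force
      obtain y z where yz: "y \<in> span S" "\<And>w. w \<in> span S \<Longrightarrow> orthogonal z w" "a = y + z"
        using orthogonal_subspace_decomp_exists by metis
      have eq: "a \<bullet> s = y \<bullet> s" if "s \<in> span S" for s
        using yz that by (simp add: inner_add_left orthogonal_def)
      have "(1 / b) *\<^sub>R y \<in> polar_body S"
        unfolding polar_body_def
      proof (intro CollectI conjI ballI)
        fix s assume s: "s \<in> S"
        then have "y \<bullet> s > b" using ab(2) eq span_base by metis
        then show "s \<bullet> (1 / b) *\<^sub>R y \<le> 1" using b by (simp add: inner_commute field_simps)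
      qed (use yz in \<open>auto intro: span_scale\<close>)
      then have "((1 / b) *\<^sub>R y) \<bullet> x \<le> 1" using x polar_body_def by blast
      moreover have "y \<bullet> x < b" using ab(1) eq[of x] x sp unfolding polar_body_def by simp
      ultimately show False using b by (simp add: field_simps)
    qed
  qed
qed

lemma polar_face_face:
  assumes "F \<subseteq> S"
  shows "polar_face S F face_of polar_body S"
  unfolding face_of_def
proof (intro conjI ballI impI)
  show "polar_face S F \<subseteq> polar_body S" by (auto simp: polar_face_def)
  show "convex (polar_face S F)"
    unfolding convex_alt
    by (auto simp: polar_face_def polar_body_def inner_add_right span_add span_scale
          intro!: convex_bound_le)
next
  fix y z w assume *: "y \<in> polar_body S" "z \<in> polar_body S" "w \<in> polar_face S F"
    "w \<in> open_segment y z"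
  then obtain u where u: "0 < u" "u < 1" "w = (1 - u) *\<^sub>R y + u *\<^sub>R z"
    by (auto simp: in_segment)
  have "x \<bullet> y = 1 \<and> x \<bullet> z = 1" if "x \<in> F" for x
  proof -
    have le: "x \<bullet> y \<le> 1" "x \<bullet> z \<le> 1" using * that assms by (auto simp: polar_body_def)
    have e: "(1 - u) * (x \<bullet> y) + u * (x \<bullet> z) = 1"
      using *(3) u that by (auto simp: polar_face_def inner_add_right)
    have "(1 - u) * (1 - x \<bullet> y) + u * (1 - x \<bullet> z) = 0" using e by (simp add: algebra_simps)
    then have "(1 - u) * (1 - x \<bullet> y) = 0" "u * (1 - x \<bullet> z) = 0"
      using le u by (smt (verit) mult_nonneg_nonneg)+
    then show ?thesis using u by simp
  qed
  then show "y \<in> polar_face S F" "z \<in> polar_face S F" using * by (auto simp: polar_face_def)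
qed

text \<open>If \<open>x\<close> lies in \<open>S\<close> but not in \<open>F\<close>, a functional
  exposing \<open>F\<close>, normalised to the value 1 on \<open>F\<close>, is a point of
  \<open>polar_face S F\<close> that does not take the value 1 at \<open>x\<close>.\<close>

lemma polar_face_polar_face:
  fixes S :: "'a::euclidean_space set"
  assumes S: "polytope S" and 0: "0 \<in> rel_interior S" and F: "F face_of S"
  shows "polar_face (polar_body S) (polar_face S F) = F"
proof -
  have 0: "0 \<in> S" using assms rel_interior_subset by blast
  have sub: "F \<subseteq> S" using F face_of_imp_subset by blast
  have *: "polar_face (polar_body S) (polar_face S F) = {x \<in> S. \<forall>y\<in>polar_face S F. y \<bullet> x = 1}"
    by (simp add: polar_face_def[of "polar_body S"] bipolar assms)
  have 1: "F \<subseteq> polar_face (polar_body S) (polar_face S F)"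
    unfolding * using sub by (auto simp: polar_face_def inner_commute)
  have "x \<in> F" if x: "x \<in> S" "\<forall>y\<in>polar_face S F. y \<bullet> x = 1" for x
  proof (rule ccontr)
    assume nx: "x \<notin> F"
    have "F exposed_face_of S"
      using F S exposed_face_of_polyhedron polytope_imp_polyhedron by blast
    then obtain a b where ab: "S \<subseteq> {x. a \<bullet> x \<le> b}" "F = S \<inter> {x. a \<bullet> x = b}"
      unfolding exposed_face_of_def by blast
    \<comment> \<open>Level 0 would put the relative interior point \<open>0\<close> into
      \<open>F\<close> and force \<open>F = S\<close>.\<close>
    have b0: "b > 0"
    proof (rule ccontr)
      assume "\<not> b > 0"
      then have "b = 0" using ab(1) 0 by force
      then have "0 \<in> F" using ab 0 by simp
      then have "F \<inter> rel_interior S \<noteq> {}" using assms(2) by blast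
      then have "S \<subseteq> F" using subset_of_face_of[OF F] by blast
      then show False using x nx by blast
    qed
    obtain y z where yz: "y \<in> span S" "\<And>w. w \<in> span S \<Longrightarrow> orthogonal z w" "a = y + z"
      using orthogonal_subspace_decomp_exists by metis
    have eq: "a \<bullet> s = y \<bullet> s" if "s \<in> S" for s
      using yz that by (simp add: inner_add_left orthogonal_def span_base)
    have "(1 / b) *\<^sub>R y \<in> polar_face S F"
      unfolding polar_face_def polar_body_def using yz(1) ab eq b0
      by (auto simp: inner_commute span_scale)
    then have "(1 / b) *\<^sub>R y \<bullet> x = 1" using x by blast
    then have "a \<bullet> x = b" using eq[OF x(1)] b0 by simp
    then show False using nx x ab by blast
  qed
  then show ?thesis using 1 unfolding * by blast
qed

lemma exists_polar_origin:
  fixes S :: "'a::euclidean_space set"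
  assumes S: "polytope S" and 0: "0 \<in> rel_interior S"
  shows "combinatorial_polar S (polar_body S) (polar_face S)"
proof -
  let ?Q = "polar_body S"
  note Q = polar_body_polytope[OF assms] polar_body_zero(1)[OF assms]
  have anti: "F \<subseteq> F' \<Longrightarrow> polar_face R F' \<subseteq> polar_face R F" for R F F' :: "'a set"
    by (auto simp: polar_face_def)
  show ?thesis
    unfolding combinatorial_polar_def
  proof (intro conjI allI impI)
    show "polytope ?Q" by (fact Q)
    show "bij_betw (polar_face S) {F. F face_of S} {G. G face_of ?Q}"
    proof (rule bij_betwI[where g = "polar_face ?Q"])
      show "polar_face S \<in> {F. F face_of S} \<rightarrow> {G. G face_of ?Q}"
        using polar_face_face face_of_imp_subset by blast
      show "polar_face ?Q \<in> {G. G face_of ?Q} \<rightarrow> {F. F face_of S}"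
        using polar_face_face[of _ ?Q] face_of_imp_subset bipolar[OF assms] by auto
      show "polar_face ?Q (polar_face S F) = F" if "F \<in> {F. F face_of S}" for F
        using that polar_face_polar_face[OF assms] by blast
      show "polar_face S (polar_face ?Q G) = G" if "G \<in> {G. G face_of ?Q}" for G
        using that polar_face_polar_face[OF Q] bipolar[OF assms] by simp
    qed
  next
    fix F F' assume *: "F face_of S \<and> F' face_of S"
    show "F \<subseteq> F' \<longleftrightarrow> polar_face S F' \<subseteq> polar_face S F"
      using anti[of F F' S] anti[of "polar_face S F'" "polar_face S F" ?Q]
        polar_face_polar_face[OF assms] * by auto
  qed
qed

text \<open>The shelling property asks for some polar, so one has to be produced. Moving a relative
  interior point to the origin makes the concrete polar body available, and translation commutes
  with taking faces.\<close>

lemma exists_combinatorial_polar: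
  fixes P :: "'a::euclidean_space set"
  assumes P: "polytope P" "P \<noteq> {}"
  shows "\<exists>Q \<phi>. combinatorial_polar P Q \<phi>"
proof -
  obtain c where c: "c \<in> rel_interior P"
    using P polytope_imp_convex rel_interior_eq_empty by blast
  let ?t = "\<lambda>F. (+) (- c) ` F"
  have "polytope (?t P)" using P polytope_translation_eq by blast
  moreover have "0 \<in> rel_interior (?t P)"
    unfolding rel_interior_translation using c by (metis add.left_inverse imageI)
  ultimately have *: "combinatorial_polar (?t P) (polar_body (?t P)) (polar_face (?t P))"
    by (rule exists_polar_origin)
  have "bij_betw ?t {F. F face_of P} {F. F face_of ?t P}"
    unfolding faces_of_translation
    by (intro inj_on_imp_bij_betw) (auto simp: inj_on_def inj_image_eq_iff)
  then have "bij_betw (polar_face (?t P) \<circ> ?t) {F. F face_of P} {G. G face_of polar_body (?t P)}"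
    using * unfolding combinatorial_polar_def by (meson bij_betw_trans)
  moreover have "F \<subseteq> F' \<longleftrightarrow> polar_face (?t P) (?t F') \<subseteq> polar_face (?t P) (?t F)"
    if "F face_of P" "F' face_of P" for F F'
  proof -
    have "F \<subseteq> F' \<longleftrightarrow> ?t F \<subseteq> ?t F'" by (simp add: inj_image_subset_iff)
    also have "?t F \<subseteq> ?t F' \<longleftrightarrow> polar_face (?t P) (?t F') \<subseteq> polar_face (?t P) (?t F)"
      using polar_inj(2)[OF *, of "?t F'" "?t F"] that face_of_translation_eq[of "- c"] by metis
    finally show ?thesis .
  qed
  ultimately have "combinatorial_polar P (polar_body (?t P)) (polar_face (?t P) \<circ> ?t)"
    using * unfolding combinatorial_polar_def comp_apply by blast
  then show ?thesis by blast
qed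

text \<open>Under polarity the facets containing a ridge become the two end points of a segment.\<close>

lemma ridge_two_facets:
  fixes S :: "'a::euclidean_space set"
  assumes S: "polytope S" and C: "C face_of S" "aff_dim C = aff_dim S - 2"
  shows "\<exists>F G. F \<noteq> G \<and> {K. K face_of S \<and> C \<subseteq> K \<and> aff_dim K = aff_dim S - 1} = {F, G}"
proof -
  have "S \<noteq> {}" using C aff_dim_geq[of C] by auto
  then obtain Q \<phi> where c: "combinatorial_polar S Q \<phi>" using exists_combinatorial_polar S by blast
  have Q: "polytope Q" using c combinatorial_polar_def by blast
  have Cf: "\<phi> C face_of Q" using polar_inj(3)[OF c C(1) C(1)] .
  have "aff_dim (\<phi> C) = 1" using polar_aff_dim[OF c S C(1)] C by simp
  moreover have "polytope (\<phi> C)" using Cf Q face_of_polytope_polytope by blast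
  \<comment> \<open>A polytope of dimension at most 1 is a simplex, so \<open>\<phi> C\<close> is a
    segment; its end points are the images of the two facets sought.\<close>
  ultimately obtain n where "n simplex \<phi> C"
    using polytope_lowdim_imp_simplex[of "\<phi> C"] by auto
  then have "1 simplex \<phi> C" using aff_dim_simplex \<open>aff_dim (\<phi> C) = 1\<close> by fastforce
  then obtain A where A: "int (card A) = 1 + 1" "\<phi> C = convex hull A"
    by (auto simp: simplex)
  then have "card A = 2" by simp
  then obtain a b where ab: "a \<noteq> b" "\<phi> C = closed_segment a b"
    using A by (metis card_2_iff segment_convex_hull)
  have ext: "{x} face_of Q \<and> x \<in> \<phi> C \<longleftrightarrow> x = a \<or> x = b" for x
    using face_of_face[OF Cf, of "{x}"] ab by (auto simp: face_of_singleton extreme_point_of_segment)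
  obtain F where F: "F face_of S" "{a} = \<phi> F" using ext polar_surj[OF c] by metis
  obtain G where G: "G face_of S" "{b} = \<phi> G" using ext polar_surj[OF c] by metis
  have "K face_of S \<and> C \<subseteq> K \<and> aff_dim K = aff_dim S - 1 \<longleftrightarrow> K = F \<or> K = G" for K
  proof
    assume K: "K face_of S \<and> C \<subseteq> K \<and> aff_dim K = aff_dim S - 1"
    then have "aff_dim (\<phi> K) = 0" using polar_aff_dim[OF c S] by simp
    then obtain x where x: "\<phi> K = {x}" using aff_dim_eq_0 by blast
    have "{x} face_of Q" "x \<in> \<phi> C" using x polar_inj[OF c] C K by (metis, metis insert_subset)
    then have "x = a \<or> x = b" using ext by blast
    then show "K = F \<or> K = G" using x F G polar_inj(1)[OF c] K by metis
  next
    assume K: "K = F \<or> K = G"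
    then have Kf: "K face_of S" using F G by blast
    have "aff_dim (\<phi> K) = 0" "\<phi> K \<subseteq> \<phi> C" using K F G ab by (metis aff_dim_sing, auto)
    then show "K face_of S \<and> C \<subseteq> K \<and> aff_dim K = aff_dim S - 1"
      using polar_aff_dim[OF c S Kf] polar_inj(2)[OF c Kf C(1)] Kf by auto
  qed
  moreover have "F \<noteq> G" using F G ab by auto
  ultimately show ?thesis by (intro exI[of _ F] exI[of _ G]) auto
qed

section \<open>Shellings in terms of the face lattice\<close>

fun prefix_all :: "('b set \<Rightarrow> 'b \<Rightarrow> bool) \<Rightarrow> 'b set \<Rightarrow> 'b list \<Rightarrow> bool" where
  "prefix_all R A [] \<longleftrightarrow> True"
| "prefix_all R A (x # xs) \<longleftrightarrow> R A x \<and> prefix_all R (insert x A) xs"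

lemma prefix_all_append:
  "prefix_all R A (xs @ ys) \<longleftrightarrow> prefix_all R A xs \<and> prefix_all R (A \<union> set xs) ys"
  by (induction xs arbitrary: A) auto

lemma prefix_all_nth:
  "prefix_all R A xs \<longleftrightarrow> (\<forall>j<length xs. R (A \<union> set (take j xs)) (xs ! j))"
proof (induction xs arbitrary: A)
  case (Cons x xs)
  show ?case
  proof
    assume L: "prefix_all R A (x # xs)"
    show "\<forall>j<length (x # xs). R (A \<union> set (take j (x # xs))) ((x # xs) ! j)"
    proof (intro allI impI)
      fix j assume "j < length (x # xs)"
      then show "R (A \<union> set (take j (x # xs))) ((x # xs) ! j)"
        using L Cons.IH[of "insert x A"] by (cases j) auto
    qed
  next
    assume R: "\<forall>j<length (x # xs). R (A \<union> set (take j (x # xs))) ((x # xs) ! j)"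
    have "R (insert x A \<union> set (take j xs)) (xs ! j)" if "j < length xs" for j
      using R[rule_format, of "Suc j"] that by simp
    then show "prefix_all R A (x # xs)" using R[rule_format, of 0] Cons.IH[of "insert x A"] by simp
  qed
qed simp

text \<open>Nonemptiness is built in because a facet of a shelling must meet its
  predecessors.\<close>

definition conn :: "('b \<times> 'b) set \<Rightarrow> 'b set \<Rightarrow> bool" where
  "conn r A \<longleftrightarrow> A \<noteq> {} \<and> (\<forall>x\<in>A. \<forall>y\<in>A. (x, y) \<in> (r \<inter> A \<times> A)\<^sup>*)"

text \<open>For an order of the edges of a polygon, with \<open>r\<close> relating edges that meet,
  this is the shelling condition.\<close>

definition grows :: "('b \<times> 'b) set \<Rightarrow> 'b set \<Rightarrow> 'b list \<Rightarrow> bool" where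
  "grows r = prefix_all (\<lambda>A x. A = {} \<or> (\<exists>p\<in>A. (p, x) \<in> r))"

lemma conn_exit:
  assumes "conn r Z" "B \<subseteq> Z" "B \<noteq> {}" "B \<noteq> Z"
  shows "\<exists>p\<in>B. \<exists>x\<in>Z - B. (p, x) \<in> r"
proof (rule ccontr)
  assume *: "\<not> ?thesis"
  obtain b z where bz: "b \<in> B" "z \<in> Z - B" using assms by blast
  then have "(b, z) \<in> (r \<inter> Z \<times> Z)\<^sup>*" using assms unfolding conn_def by blast
  then have "z \<in> B"
    by (induction rule: rtrancl_induct) (use bz * in auto)
  then show False using bz by blast
qed

lemma conn_grows:
  assumes "finite Z" "conn r Z" "B \<subseteq> Z"
  shows "\<exists>xs. distinct xs \<and> set xs = Z - B \<and> grows r B xs"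
  using assms(3)
proof (induction "card (Z - B)" arbitrary: B rule: less_induct)
  case less
  show ?case
  proof (cases "B = Z")
    case True
    then show ?thesis by (intro exI[of _ "[]"]) (simp add: grows_def)
  next
    case False
    then obtain x where x: "x \<in> Z - B" "B = {} \<or> (\<exists>p\<in>B. (p, x) \<in> r)"
      using conn_exit[OF assms(2) less.prems] less.prems by blast
    have "Z - insert x B \<subset> Z - B" using x by blast
    then have "card (Z - insert x B) < card (Z - B)"
      using assms(1) by (simp add: psubset_card_mono)
    moreover have "insert x B \<subseteq> Z" using x less.prems by blast
    ultimately obtain xs where "distinct xs" "set xs = Z - insert x B" "grows r (insert x B) xs"
      using less.hyps[of "insert x B"] by blast
    then show ?thesis using x by (intro exI[of _ "x # xs"]) (auto simp: grows_def)
  qed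
qed

lemma grows_conn:
  assumes "sym r" "grows r A xs" "A = {} \<or> conn r A" "A \<union> set xs \<noteq> {}"
  shows "conn r (A \<union> set xs)"
  using assms(2-)
proof (induction xs arbitrary: A)
  case (Cons x xs)
  have "conn r (insert x A)"
  proof (cases "A = {}")
    case True then show ?thesis by (simp add: conn_def)
  next
    case False
    then have A: "conn r A" using Cons by blast
    obtain p where p: "p \<in> A" "(p, x) \<in> r" using Cons.prems False by (auto simp: grows_def)
    let ?R = "(r \<inter> insert x A \<times> insert x A)\<^sup>*"
    have sub: "(r \<inter> A \<times> A)\<^sup>* \<subseteq> ?R" by (rule rtrancl_mono) blast
    have px: "(p, x) \<in> ?R" "(x, p) \<in> ?R" using p assms(1) by (auto dest: symD)
    have "(y, p) \<in> ?R \<and> (p, y) \<in> ?R" if "y \<in> insert x A" for y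
      using that px A p sub unfolding conn_def by blast
    then show ?thesis unfolding conn_def by (meson insert_not_empty rtrancl_trans)
  qed
  then show ?case using Cons.IH[of "insert x A"] Cons.prems by (simp add: grows_def)
qed simp

text \<open>Greedy growth exhausts \<open>A\<close> and then continues to \<open>Z\<close>. Being an
  initial segment of some shelling of a polygon thus becomes connectedness of a set, which no longer
  mentions an order; \<open>grows_conn\<close> is the converse.\<close>

lemma conn_enumerate:
  assumes "finite Z" "conn r Z" "A \<subseteq> Z" "conn r A"
  shows "\<exists>xs ys. distinct (xs @ ys) \<and> set xs = A \<and> set (xs @ ys) = Z \<and> grows r {} (xs @ ys)"
proof -
  obtain xs where xs: "distinct xs" "set xs = A" "grows r {} xs"
    using conn_grows[of A r "{}"] assms finite_subset by auto
  obtain ys where ys: "distinct ys" "set ys = Z - A" "grows r A ys"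
    using conn_grows[OF assms(1-3)] by blast
  show ?thesis using xs ys assms
    by (intro exI[of _ xs] exI[of _ ys]) (auto simp: grows_def prefix_all_append)
qed

text \<open>The sets \<open>E\<close>, \<open>S\<close>, \<open>X\<close> are the edges, 2-faces and 3-faces of a 4-polytope at a vertex \<open>w\<close>, that is
  the facets, edges and vertices of the facet \<open>\<phi> {w}\<close> of the polar. A shelling of \<open>\<phi> {w}\<close> is an
  enumeration of \<open>E\<close>, and two edges of a facet of \<open>\<phi> {w}\<close> meet iff the corresponding 2-faces
  are related by \<open>sadj X\<close>.\<close>

definition sadj :: "'a set set \<Rightarrow> ('a set \<times> 'a set) set" where
  "sadj X = {(s, t). \<exists>x\<in>X. s \<subseteq> x \<and> t \<subseteq> x}"

lemma sym_sadj: "sym (sadj X)"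
  by (auto simp: sym_def sadj_def)

definition new_ridges :: "'a set set \<Rightarrow> 'a set set \<Rightarrow> 'a set \<Rightarrow> 'a set set" where
  "new_ridges S A e = {s \<in> S. e \<subseteq> s \<and> (\<exists>c\<in>A. c \<subseteq> s)}"

text \<open>Inclusions are reversed: \<open>e\<close> is a polygon attached to the polygons in
  \<open>A\<close>. The edges along which it is attached must form a connected set, and every corner
  \<open>x\<close> shared with an earlier polygon must lie on one of them, so that the intersection
  is pure.\<close>

definition link_step :: "'a set set \<Rightarrow> 'a set set \<Rightarrow> 'a set set \<Rightarrow> 'a set \<Rightarrow> bool" where
  "link_step S X A e \<longleftrightarrow> A = {} \<or>
     conn (sadj X) (new_ridges S A e) \<and>
     (\<forall>x\<in>X. \<forall>c\<in>A. e \<subseteq> x \<and> c \<subseteq> x \<longrightarrow> (\<exists>s\<in>new_ridges S A e. s \<subseteq> x))"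

text \<open>Connectedness of the boundary of each polygon is carried along as a condition: it
  supplies a full shelling of the polygon, which a shelling demands even of the first facet.\<close>

definition link_shelling :: "'a set set \<Rightarrow> 'a set set \<Rightarrow> 'a set set \<Rightarrow> 'a set list \<Rightarrow> bool" where
  "link_shelling E S X es \<longleftrightarrow> distinct es \<and> set es = E \<and>
     (\<forall>e\<in>E. conn (sadj X) {s \<in> S. e \<subseteq> s}) \<and> prefix_all (link_step S X) {} es"

definition faces_over :: "'a::euclidean_space set \<Rightarrow> int \<Rightarrow> 'a set \<Rightarrow> 'a set set" where
  "faces_over P k F = {G. G face_of P \<and> F \<subseteq> G \<and> aff_dim G = k}"

lemma finite_faces_over: "polytope P \<Longrightarrow> finite (faces_over P k F)"
  by (rule finite_subset[OF _ finite_polytope_faces[of P]]) (auto simp: faces_over_def)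

lemma face_eqI_aff_dim:
  assumes "polytope P" "F face_of P" "G face_of P" "F \<subseteq> G" "aff_dim F = aff_dim G"
  shows "F = G"
  using aff_dim_face_less[OF assms(1-3)] assms(4,5) by fastforce

text \<open>A relative interior point of \<open>K\<close> lies in some member of the family, and a
  face containing such a point contains \<open>K\<close>.\<close>

lemma face_subset_Union_faces:
  fixes P :: "'a::euclidean_space set"
  assumes "K face_of P" "K \<noteq> {}" "\<And>F. F \<in> \<F> \<Longrightarrow> F face_of P" "K \<subseteq> \<Union>\<F>"
  shows "\<exists>F\<in>\<F>. K \<subseteq> F"
proof -
  obtain x where x: "x \<in> rel_interior K"
    using assms face_of_imp_convex rel_interior_eq_empty by blast
  then obtain F where F: "F \<in> \<F>" "x \<in> F" using assms(4) rel_interior_subset by blast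
  have "K \<subseteq> P" using assms(1) by (rule face_of_imp_subset)
  then have "K \<subseteq> F"
    by (rule subset_of_face_of[OF assms(3)[OF F(1)]]) (use F x in auto)
  then show ?thesis using F by blast
qed

section \<open>Shellings of the polar, level by level, in terms of faces of \<open>P\<close>\<close>

locale polar4 =
  fixes P Q :: "'a::euclidean_space set" and \<phi> :: "'a set \<Rightarrow> 'a set"
  assumes P: "polytope P" and P4: "aff_dim P = 4" and polar: "combinatorial_polar P Q \<phi>"
begin

lemma Q: "polytope Q"
  using polar combinatorial_polar_def by blast

lemma phi_face: "F face_of P \<Longrightarrow> \<phi> F face_of Q"
  using polar_inj(3)[OF polar] by blast

lemma phi_eq: "F face_of P \<Longrightarrow> G face_of P \<Longrightarrow> \<phi> F = \<phi> G \<longleftrightarrow> F = G"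
  using polar_inj(1)[OF polar] by blast

lemma phi_subset: "F face_of P \<Longrightarrow> G face_of P \<Longrightarrow> \<phi> F \<subseteq> \<phi> G \<longleftrightarrow> G \<subseteq> F"
  using polar_inj(2)[OF polar] by blast

lemma phi_polytope: "F face_of P \<Longrightarrow> polytope (\<phi> F)"
  using phi_face Q face_of_polytope_polytope by blast

lemma phi_dim: "F face_of P \<Longrightarrow> aff_dim (\<phi> F) = 3 - aff_dim F"
  using polar_aff_dim[OF polar P] P4 by simp

lemma P_face: "P face_of P"
  using P by (simp add: face_of_refl polytope_imp_convex)

lemma phi_empty: "F face_of P \<Longrightarrow> \<phi> F = {} \<longleftrightarrow> F = P"
  using phi_eq[of F P] polar_top_bot(1)[OF polar P] P_face by metis

lemma inj_phi: "inj_on \<phi> {F. F face_of P}"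
  by (auto simp: inj_on_def phi_eq)

lemma facets_phi:
  assumes F: "F face_of P" and d: "aff_dim F \<le> 2"
  shows "{K. K facet_of \<phi> F} = \<phi> ` faces_over P (aff_dim F + 1) F"
proof (intro set_eqI iffI)
  fix K assume "K \<in> {K. K facet_of \<phi> F}"
  then have K: "K face_of \<phi> F" "aff_dim K = aff_dim (\<phi> F) - 1" by (auto simp: facet_of_def)
  have KQ: "K face_of Q" using face_of_trans[OF K(1) phi_face[OF F]] .
  obtain G where G: "G face_of P" "K = \<phi> G" using polar_surj[OF polar KQ] by blast
  have "\<phi> G \<subseteq> \<phi> F" using K G face_of_imp_subset by blast
  then have "F \<subseteq> G" using phi_subset G F by blast
  moreover have "aff_dim G = aff_dim F + 1" using K G F phi_dim[of F] phi_dim[of G] by simp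
  ultimately show "K \<in> \<phi> ` faces_over P (aff_dim F + 1) F" using G by (auto simp: faces_over_def)
next
  fix K assume "K \<in> \<phi> ` faces_over P (aff_dim F + 1) F"
  then obtain G where G: "G face_of P" "K = \<phi> G" "F \<subseteq> G" "aff_dim G = aff_dim F + 1"
    by (auto simp: faces_over_def)
  have "K \<subseteq> \<phi> F" using G F phi_subset by blast
  then have "K face_of \<phi> F" using G face_of_face[OF phi_face[OF F]] phi_face by blast
  moreover have "aff_dim K = aff_dim (\<phi> F) - 1" "aff_dim K \<ge> 0"
    using G F d phi_dim[of F] phi_dim[of G] by auto
  ultimately show "K \<in> {K. K facet_of \<phi> F}" by (auto simp: facet_of_def)
qed

lemma shelling_facets: "shelling R Fs \<Longrightarrow> distinct Fs \<and> set Fs = {F. F facet_of R}"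
  by (auto elim: shelling.cases)

lemma shelling_map:
  assumes F: "F face_of P" and d: "aff_dim F \<le> 2" and sh: "shelling (\<phi> F) Fs"
  shows "\<exists>gs. Fs = map \<phi> gs \<and> distinct gs \<and> set gs = faces_over P (aff_dim F + 1) F"
proof -
  let ?Z = "faces_over P (aff_dim F + 1) F"
  have set: "distinct Fs" "set Fs = \<phi> ` ?Z" using shelling_facets[OF sh] facets_phi[OF F d] by auto
  have inj: "inj_on \<phi> ?Z" by (rule inj_on_subset[OF inj_phi]) (auto simp: faces_over_def)
  let ?gs = "map (inv_into ?Z \<phi>) Fs"
  have "map \<phi> ?gs = Fs"
    unfolding map_map by (rule map_idI) (simp add: set f_inv_into_f)
  moreover have "set ?gs = ?Z" using inj set by auto
  moreover have "distinct ?gs" using calculation set by (metis distinct_map)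
  ultimately show ?thesis by metis
qed

lemma shelling_two_face:
  assumes s: "s face_of P" "aff_dim s = 2"
  shows "shelling (\<phi> s) (map \<phi> xs) \<longleftrightarrow> distinct (map \<phi> xs) \<and> \<phi> ` set xs = \<phi> ` faces_over P 3 s"
proof
  assume "shelling (\<phi> s) (map \<phi> xs)"
  then show "distinct (map \<phi> xs) \<and> \<phi> ` set xs = \<phi> ` faces_over P 3 s"
    using shelling_facets[of "\<phi> s" "map \<phi> xs"] facets_phi[of s] s by simp
next
  assume "distinct (map \<phi> xs) \<and> \<phi> ` set xs = \<phi> ` faces_over P 3 s"
  then show "shelling (\<phi> s) (map \<phi> xs)"
    using facets_phi[of s] s phi_polytope[of s] phi_dim[of s]
    by (intro shelling.points) auto
qed

text \<open>The intersection of two faces of the polar is again a face \<open>\<phi> x\<close>,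
  where \<open>x\<close> contains both \<open>g\<close> and \<open>a\<close>, and
  \<open>x \<noteq> P\<close> says that it is nonempty. Coverings by faces are tested at relative
  interior points. Equality of unions then becomes a lattice statement: \<open>B\<close> consists of
  all common ridges, and every common face lies in one of them.\<close>

lemma union_faces_eq:
  assumes g: "g face_of P" "aff_dim g = d" "d \<le> 2"
    and A: "\<And>a. a \<in> A \<Longrightarrow> a face_of P"
    and B: "B \<subseteq> faces_over P (d + 1) g" "B \<noteq> {}"
  shows "\<phi> g \<inter> \<Union>(\<phi> ` A) = \<Union>(\<phi> ` B) \<longleftrightarrow>
    B = {h \<in> faces_over P (d + 1) g. \<exists>a\<in>A. a \<subseteq> h} \<and>
    (\<forall>x a. x face_of P \<and> x \<noteq> P \<and> a \<in> A \<and> g \<subseteq> x \<and> a \<subseteq> x \<longrightarrow> (\<exists>h\<in>B. h \<subseteq> x))"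
    (is "?L \<longleftrightarrow> ?R")
proof
  have Bf: "h face_of P \<and> g \<subseteq> h \<and> aff_dim h = d + 1" if "h \<in> B" for h
    using B that by (auto simp: faces_over_def)
  assume L: ?L
  have pure: "\<exists>h\<in>B. h \<subseteq> x" if x: "x face_of P" "x \<noteq> P" "a \<in> A" "g \<subseteq> x" "a \<subseteq> x" for x a
  proof -
    have "\<phi> x \<subseteq> \<phi> g" "\<phi> x \<subseteq> \<phi> a" using x g A phi_subset by auto
    then have "\<phi> x \<subseteq> \<Union>(\<phi> ` B)" using L x by blast
    moreover have "\<phi> x \<noteq> {}" using phi_empty x by blast
    ultimately obtain h where "h \<in> B" "\<phi> x \<subseteq> \<phi> h"
      using face_subset_Union_faces[OF phi_face[OF x(1)], of "\<phi> ` B"] Bf phi_face by blast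
    then show ?thesis using Bf[of h] phi_subset[of x h] x(1) by blast
  qed
  have "B = {h \<in> faces_over P (d + 1) g. \<exists>a\<in>A. a \<subseteq> h}"
  proof (intro set_eqI iffI)
    fix h assume h: "h \<in> B"
    have "h \<noteq> P" using Bf[OF h] g P4 by auto
    then have "\<phi> h \<noteq> {}" using phi_empty Bf h by blast
    moreover have "\<phi> h \<subseteq> \<Union>(\<phi> ` A)" using L h by blast
    ultimately obtain a where a: "a \<in> A" "\<phi> h \<subseteq> \<phi> a"
      using face_subset_Union_faces[of "\<phi> h" Q "\<phi> ` A"] A Bf[OF h] phi_face by blast
    then show "h \<in> {h \<in> faces_over P (d + 1) g. \<exists>a\<in>A. a \<subseteq> h}"
      using h B phi_subset[OF _ A[OF a(1)], of h] Bf[OF h] a by auto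
  next
    fix h assume h: "h \<in> {h \<in> faces_over P (d + 1) g. \<exists>a\<in>A. a \<subseteq> h}"
    then have hf: "h face_of P" "g \<subseteq> h" "aff_dim h = d + 1" by (auto simp: faces_over_def)
    then have "h \<noteq> P" using g P4 by auto
    then obtain h' where h': "h' \<in> B" "h' \<subseteq> h" using pure[of h] h hf by blast
    then have "h' = h" using face_eqI_aff_dim[OF P] Bf[OF h'(1)] hf by auto
    then show "h \<in> B" using h' by blast
  qed
  then show ?R using pure by blast
next
  have Bf: "h face_of P \<and> g \<subseteq> h \<and> aff_dim h = d + 1" if "h \<in> B" for h
    using B that by (auto simp: faces_over_def)
  assume R: ?R
  show ?L
  proof
    show "\<Union>(\<phi> ` B) \<subseteq> \<phi> g \<inter> \<Union>(\<phi> ` A)"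
    proof
      fix y assume "y \<in> \<Union>(\<phi> ` B)"
      then obtain h where h: "h \<in> B" "y \<in> \<phi> h" by blast
      then obtain a where "a \<in> A" "a \<subseteq> h" using R by blast
      then show "y \<in> \<phi> g \<inter> \<Union>(\<phi> ` A)"
        using h Bf[OF h(1)] phi_subset g A by (metis IntI UN_I subsetD)
    qed
    show "\<phi> g \<inter> \<Union>(\<phi> ` A) \<subseteq> \<Union>(\<phi> ` B)"
    proof
      fix y assume "y \<in> \<phi> g \<inter> \<Union>(\<phi> ` A)"
      then obtain a where a: "a \<in> A" "y \<in> \<phi> g" "y \<in> \<phi> a" by blast
      have "\<phi> g \<inter> \<phi> a face_of Q" using a g A phi_face face_of_Int by blast
      then obtain x where x: "x face_of P" "\<phi> g \<inter> \<phi> a = \<phi> x"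
        using polar_surj[OF polar] by blast
      then have "g \<subseteq> x" "a \<subseteq> x" using phi_subset g A a by (metis inf_le1, metis inf_le2)
      moreover have "x \<noteq> P" using x a phi_empty P_face by blast
      ultimately obtain h where "h \<in> B" "h \<subseteq> x" using R x a by blast
      then have "\<phi> x \<subseteq> \<phi> h" using phi_subset Bf x by blast
      then show "y \<in> \<Union>(\<phi> ` B)" using x a \<open>h \<in> B\<close> by blast
    qed
  qed
qed

text \<open>The number \<open>r\<close> of the definition becomes a split \<open>hs @ ks\<close>,
  and \<open>union_faces_eq\<close> replaces the geometric intersection. With \<open>d\<close> equal
  to -1, 0 and 1 the same statement serves for the polar itself, for its facets and for its
  polygons.\<close>

lemma shelling_step:
  assumes F: "F face_of P" and d: "aff_dim F = d" "d \<le> 1"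
    and gs: "set gs = faces_over P (d + 1) F"
  shows "shelling (\<phi> F) (map \<phi> gs) \<longleftrightarrow>
    distinct gs \<and> (\<exists>hs. shelling (\<phi> (hd gs)) (map \<phi> hs) \<and> set hs = faces_over P (d + 2) (hd gs)) \<and>
    (\<forall>j. 0 < j \<and> j < length gs \<longrightarrow>
       (\<exists>hs ks. shelling (\<phi> (gs ! j)) (map \<phi> (hs @ ks)) \<and> hs \<noteq> [] \<and>
          set (hs @ ks) = faces_over P (d + 2) (gs ! j) \<and>
          set hs = {h \<in> faces_over P (d + 2) (gs ! j). \<exists>a\<in>set (take j gs). a \<subseteq> h} \<and>
          (\<forall>x a. x face_of P \<and> x \<noteq> P \<and> a \<in> set (take j gs) \<and> gs ! j \<subseteq> x \<and> a \<subseteq> x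
             \<longrightarrow> (\<exists>h\<in>set hs. h \<subseteq> x))))" (is "?L \<longleftrightarrow> ?R")
proof -
  let ?Z = "faces_over P (d + 1) F"
  have inj: "inj_on \<phi> ?Z" by (rule inj_on_subset[OF inj_phi]) (auto simp: faces_over_def)
  have dims: "polytope (\<phi> F)" "aff_dim (\<phi> F) > 1" using phi_polytope[OF F] phi_dim[OF F] d by auto
  have face: "g face_of P" "aff_dim g = d + 1" if "g \<in> set gs" for g
    using that gs by (auto simp: faces_over_def)
  have base: "distinct (map \<phi> gs) \<longleftrightarrow> distinct gs" "set (map \<phi> gs) = {K. K facet_of \<phi> F}"
    using facets_phi[OF F] d gs inj by (auto simp: distinct_map)
  have ne: "gs \<noteq> []"
  proof -
    have "F \<noteq> P" using d P4 by auto
    then have "?Z \<noteq> {}" using exists_covering_face[OF P F] d by (auto simp: faces_over_def)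
    then show ?thesis using gs by auto
  qed
  have hd: "hd gs \<in> set gs" using ne by simp
  have prev: "a face_of P" if "a \<in> set (take j gs)" for a j
    using face(1)[OF in_set_takeD[OF that]] .
  have prefix: "set (take j (map \<phi> gs)) = \<phi> ` set (take j gs)" for j
    by (simp add: take_map)
  have uf: "\<phi> (gs ! j) \<inter> \<Union>(\<phi> ` set (take j gs)) = \<Union>(\<phi> ` set hs) \<longleftrightarrow>
    set hs = {h \<in> faces_over P (d + 2) (gs ! j). \<exists>a\<in>set (take j gs). a \<subseteq> h} \<and>
    (\<forall>x a. x face_of P \<and> x \<noteq> P \<and> a \<in> set (take j gs) \<and> gs ! j \<subseteq> x \<and> a \<subseteq> x
             \<longrightarrow> (\<exists>h\<in>set hs. h \<subseteq> x))"
    if "j < length gs" "set hs \<subseteq> faces_over P (d + 2) (gs ! j)" "hs \<noteq> []" for hs j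
    using union_faces_eq[of "gs ! j" "d + 1" "set (take j gs)" "set hs"] that face[of "gs ! j"] d prev
    by (simp add: add.assoc)
  show ?thesis
  proof
    assume L: ?L
    then obtain Gs where Gs: "shelling (hd (map \<phi> gs)) Gs" and
      step: "\<And>j. 0 < j \<and> j < length (map \<phi> gs) \<Longrightarrow>
             \<exists>Gs r. shelling (map \<phi> gs ! j) Gs \<and> 1 \<le> r \<and> r \<le> length Gs \<and>
                     map \<phi> gs ! j \<inter> \<Union> (set (take j (map \<phi> gs))) = \<Union> (set (take r Gs))"
      using dims by (cases rule: shelling.cases) auto
    have "shelling (\<phi> (hd gs)) Gs" using Gs ne by (simp add: hd_map)
    then have 1: "\<exists>hs. shelling (\<phi> (hd gs)) (map \<phi> hs) \<and> set hs = faces_over P (d + 2) (hd gs)"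
      using shelling_map[of "hd gs" Gs] face[OF hd] d by (auto simp: add.assoc)
    have 2: "\<exists>hs ks. shelling (\<phi> (gs ! j)) (map \<phi> (hs @ ks)) \<and> hs \<noteq> [] \<and>
          set (hs @ ks) = faces_over P (d + 2) (gs ! j) \<and>
          set hs = {h \<in> faces_over P (d + 2) (gs ! j). \<exists>a\<in>set (take j gs). a \<subseteq> h} \<and>
          (\<forall>x a. x face_of P \<and> x \<noteq> P \<and> a \<in> set (take j gs) \<and> gs ! j \<subseteq> x \<and> a \<subseteq> x
             \<longrightarrow> (\<exists>h\<in>set hs. h \<subseteq> x))" if j: "0 < j" "j < length gs" for j
    proof -
      obtain Gs r where G: "shelling (\<phi> (gs ! j)) Gs" "1 \<le> r" "r \<le> length Gs"
        "\<phi> (gs ! j) \<inter> \<Union> (\<phi> ` set (take j gs)) = \<Union> (set (take r Gs))"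
        using step[of j] j by (auto simp: take_map)
      obtain ks where ks: "Gs = map \<phi> ks" "set ks = faces_over P (d + 2) (gs ! j)"
        using shelling_map[of "gs ! j" Gs] face[of "gs ! j"] d j G by (auto simp: add.assoc)
      have "\<phi> (gs ! j) \<inter> \<Union> (\<phi> ` set (take j gs)) = \<Union> (\<phi> ` set (take r ks))"
        using G ks by (simp add: take_map)
      moreover have "set (take r ks) \<subseteq> faces_over P (d + 2) (gs ! j)"
        using ks set_take_subset by metis
      moreover have "take r ks \<noteq> []" using G ks by auto
      ultimately have "take r ks \<noteq> [] \<and>
          set (take r ks) = {h \<in> faces_over P (d + 2) (gs ! j). \<exists>a\<in>set (take j gs). a \<subseteq> h} \<and>
          (\<forall>x a. x face_of P \<and> x \<noteq> P \<and> a \<in> set (take j gs) \<and> gs ! j \<subseteq> x \<and> a \<subseteq> x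
             \<longrightarrow> (\<exists>h\<in>set (take r ks). h \<subseteq> x))" using uf[of j "take r ks"] j by blast
      moreover have "shelling (\<phi> (gs ! j)) (map \<phi> (take r ks @ drop r ks))"
        "set (take r ks @ drop r ks) = faces_over P (d + 2) (gs ! j)"
        using G ks unfolding append_take_drop_id by auto
      ultimately show ?thesis by blast
    qed
    show ?R using 1 2 L shelling_facets[OF L] base by blast
  next
    assume R: ?R
    show ?L
    proof (rule shelling.step)
      show "\<exists>Gs. shelling (hd (map \<phi> gs)) Gs" using R ne by (auto simp: hd_map)
      show "\<forall>j. 0 < j \<and> j < length (map \<phi> gs) \<longrightarrow>
             map \<phi> gs ! j \<inter> \<Union> (set (take j (map \<phi> gs))) \<noteq> {} \<and>
             (\<exists>Gs r. shelling (map \<phi> gs ! j) Gs \<and> 1 \<le> r \<and> r \<le> length Gs \<and>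
                     map \<phi> gs ! j \<inter> \<Union> (set (take j (map \<phi> gs))) = \<Union> (set (take r Gs)))"
      proof (intro allI impI)
        fix j assume "0 < j \<and> j < length (map \<phi> gs)"
        then have j: "0 < j" "j < length gs" by auto
        obtain hs ks where *: "shelling (\<phi> (gs ! j)) (map \<phi> (hs @ ks))" "hs \<noteq> []"
          "set (hs @ ks) = faces_over P (d + 2) (gs ! j)"
          "set hs = {h \<in> faces_over P (d + 2) (gs ! j). \<exists>a\<in>set (take j gs). a \<subseteq> h}"
          "\<forall>x a. x face_of P \<and> x \<noteq> P \<and> a \<in> set (take j gs) \<and> gs ! j \<subseteq> x \<and> a \<subseteq> x
             \<longrightarrow> (\<exists>h\<in>set hs. h \<subseteq> x)"
          using R[THEN conjunct2, THEN conjunct2, rule_format, OF conjI[OF j]] by blast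
        have eq: "\<phi> (gs ! j) \<inter> \<Union> (\<phi> ` set (take j gs)) = \<Union> (\<phi> ` set hs)"
          using uf[of j hs] * j by blast
        obtain h where h: "h \<in> set hs" using *(2) by (meson list.set_sel(1))
        then have "h face_of P" "aff_dim h = d + 2" using *(3) by (auto simp: faces_over_def)
        then have "\<phi> h \<noteq> {}" using phi_empty d P4 by auto
        then have "\<Union> (\<phi> ` set hs) \<noteq> {}" using h by blast
        then show "map \<phi> gs ! j \<inter> \<Union> (set (take j (map \<phi> gs))) \<noteq> {} \<and>
             (\<exists>Gs r. shelling (map \<phi> gs ! j) Gs \<and> 1 \<le> r \<and> r \<le> length Gs \<and>
                     map \<phi> gs ! j \<inter> \<Union> (set (take j (map \<phi> gs))) = \<Union> (set (take r Gs)))"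
          using eq j *(1,2) unfolding prefix
          by (intro conjI exI[of _ "map \<phi> (hs @ ks)"] exI[of _ "length hs"])
            (simp_all add: Suc_le_eq take_map)
      qed
    qed (use dims base R in auto)
  qed
qed

end

lemma proper_face_aff_dim_less:
  fixes P :: "'a::euclidean_space set"
  assumes "polytope P" "x face_of P" "x \<noteq> P"
  shows "aff_dim x < aff_dim P"
  using assms face_of_aff_dim_lt polytope_imp_convex by blast

lemma two_faces_aff_dim:
  fixes P :: "'a::euclidean_space set"
  assumes P: "polytope P" and "g face_of P" "a face_of P" "x face_of P" "a \<noteq> g"
    "aff_dim a = aff_dim g" "g \<subseteq> x" "a \<subseteq> x"
  shows "aff_dim g < aff_dim x"
proof -
  have "g \<noteq> x" using assms face_eqI_aff_dim[OF P] by metis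
  then show ?thesis using aff_dim_face_less[OF P] assms by blast
qed

context polar4
begin

lemma faces_over_nonempty:
  assumes "F face_of P" "aff_dim F = d" "d < 4"
  shows "faces_over P (d + 1) F \<noteq> {}"
proof -
  have "F \<noteq> P" using assms P4 by auto
  then show ?thesis using exists_covering_face[OF P assms(1)] assms(2) unfolding faces_over_def by blast
qed

text \<open>\<open>\<phi> s\<close> is a segment, so any order of its end points is a shelling and
  any set of end points is an initial segment.\<close>

lemma shelling_two_face_exists:
  assumes s: "s face_of P" "aff_dim s = 2" and A: "A \<subseteq> faces_over P 3 s"
  shows "\<exists>hs ks. shelling (\<phi> s) (map \<phi> (hs @ ks)) \<and> set (hs @ ks) = faces_over P 3 s \<and> set hs = A"
proof -
  have fin: "finite (faces_over P 3 s)" using P finite_faces_over by blast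
  obtain hs where hs: "distinct hs" "set hs = A"
    using finite_distinct_list finite_subset[OF A fin] by blast
  obtain ks where ks: "distinct ks" "set ks = faces_over P 3 s - A"
    using finite_distinct_list[of "faces_over P 3 s - A"] fin by blast
  have d: "distinct (hs @ ks)" "set (hs @ ks) = faces_over P 3 s" using hs ks A by auto
  have "inj_on \<phi> (set (hs @ ks))" unfolding d
    by (rule inj_on_subset[OF inj_phi]) (auto simp: faces_over_def)
  then have "distinct (map \<phi> (hs @ ks))" unfolding distinct_map using d by simp
  moreover have "\<phi> ` set (hs @ ks) = \<phi> ` faces_over P 3 s" using d by simp
  ultimately have "shelling (\<phi> s) (map \<phi> (hs @ ks))" using shelling_two_face[OF s] by blast
  then show ?thesis using d hs by blast
qed

text \<open>In the polygon \<open>\<phi> e\<close> purity is automatic: a proper face above two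
  different 2-faces is 3-dimensional, so it is itself a shared corner. Only the requirement to meet
  an earlier edge remains.\<close>

lemma shelling_edge:
  assumes e: "e face_of P" "aff_dim e = 1" "w \<in> e" and gs: "set gs = faces_over P 2 e"
  shows "shelling (\<phi> e) (map \<phi> gs) \<longleftrightarrow> distinct gs \<and> grows (sadj (faces_over P 3 {w})) {} gs"
    (is "_ \<longleftrightarrow> _ \<and> grows ?r {} gs")
proof -
  have gs': "set gs = faces_over P (1 + 1) e" using gs by simp
  have face: "gs ! j face_of P" "aff_dim (gs ! j) = 2" "e \<subseteq> gs ! j" if "j < length gs" for j
    using nth_mem[OF that] gs by (auto simp: faces_over_def)
  have gs_ne: "gs \<noteq> []"
    using faces_over_nonempty[OF e(1,2)] gs by auto
  show ?thesis
  proof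
    assume "shelling (\<phi> e) (map \<phi> gs)"
    note L0 = this[unfolded shelling_step[OF e(1,2) order.refl gs']]
    have L: "distinct gs" "\<exists>hs. hs \<noteq> [] \<and>
        set hs = {h \<in> faces_over P 3 (gs ! j). \<exists>a\<in>set (take j gs). a \<subseteq> h}"
      if "0 < j \<and> j < length gs" for j
      using L0 L0[THEN conjunct2, THEN conjunct2, rule_format, OF that] by auto
    have "set (take j gs) = {} \<or> (\<exists>p\<in>set (take j gs). (p, gs ! j) \<in> ?r)" if "j < length gs" for j
    proof (cases "j = 0")
      case False
      then have "0 < j \<and> j < length gs" using that by simp
      from L(2)[OF this] obtain hs where hs:
        "hs \<noteq> [] \<and> set hs = {h \<in> faces_over P 3 (gs ! j). \<exists>a\<in>set (take j gs). a \<subseteq> h}" ..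
      then have "hd hs \<in> {h \<in> faces_over P 3 (gs ! j). \<exists>a\<in>set (take j gs). a \<subseteq> h}"
        by (metis list.set_sel(1))
      then obtain h a where "h \<in> faces_over P 3 (gs ! j)" "a \<in> set (take j gs)" "a \<subseteq> h"
        by blast
      moreover have "h \<in> faces_over P 3 {w}" "gs ! j \<subseteq> h"
        using calculation(1) face(3)[OF that] e(3) by (auto simp: faces_over_def)
      ultimately have "(a, gs ! j) \<in> ?r" unfolding sadj_def by blast
      then show ?thesis using \<open>a \<in> set (take j gs)\<close> by blast
    qed simp
    then show "distinct gs \<and> grows ?r {} gs" using L0 by (simp add: grows_def prefix_all_nth)
  next
    assume R: "distinct gs \<and> grows ?r {} gs"
    show "shelling (\<phi> e) (map \<phi> gs)"
      unfolding shelling_step[OF e(1,2) order.refl gs']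
    proof (intro conjI allI impI)
      show "distinct gs" using R by blast
      show "\<exists>hs. shelling (\<phi> (hd gs)) (map \<phi> hs) \<and> set hs = faces_over P (1 + 2) (hd gs)"
        using shelling_two_face_exists[of "hd gs" "{}"] face[of 0] gs_ne
        by (simp add: hd_conv_nth)
    next
      fix j assume j: "0 < j \<and> j < length gs"
      let ?A = "{h \<in> faces_over P (1 + 2) (gs ! j). \<exists>a\<in>set (take j gs). a \<subseteq> h}"
      have "set (take j gs) \<noteq> {}" using j by auto
      then obtain p where p: "p \<in> set (take j gs)" "(p, gs ! j) \<in> ?r"
        using R j by (auto simp: grows_def prefix_all_nth)
      then have "?A \<noteq> {}" using face j by (auto simp: sadj_def faces_over_def)
      then obtain hs ks where hk: "shelling (\<phi> (gs ! j)) (map \<phi> (hs @ ks))"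
        "set (hs @ ks) = faces_over P 3 (gs ! j)" "set hs = ?A"
        using shelling_two_face_exists[of "gs ! j" ?A] face j by auto
      have ne: "hs \<noteq> []" using \<open>?A \<noteq> {}\<close> hk(3) by auto
      have pure: "\<forall>x a. x face_of P \<and> x \<noteq> P \<and> a \<in> set (take j gs) \<and> gs ! j \<subseteq> x \<and> a \<subseteq> x
             \<longrightarrow> (\<exists>h\<in>set hs. h \<subseteq> x)"
      proof (intro allI impI)
        fix x a
        assume x: "x face_of P \<and> x \<noteq> P \<and> a \<in> set (take j gs) \<and> gs ! j \<subseteq> x \<and> a \<subseteq> x"
        have "a \<noteq> gs ! j" using x R j by (metis distinct_take in_set_conv_nth in_set_takeD length_take
              min_less_iff_conj nth_eq_iff_index_eq nth_take less_irrefl)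
        moreover have "a face_of P" "aff_dim a = 2"
          using x in_set_takeD[of a j gs] gs by (auto simp: faces_over_def)
        ultimately have "2 < aff_dim x"
          using two_faces_aff_dim[OF P face(1)[of j], of a x] face(2) x j by auto
        moreover have "aff_dim x < 4" using proper_face_aff_dim_less[OF P, of x] x P4 by simp
        ultimately have "x \<in> ?A" using x by (auto simp: faces_over_def)
        then show "\<exists>h\<in>set hs. h \<subseteq> x" using hk by blast
      qed
      show "\<exists>hs ks. shelling (\<phi> (gs ! j)) (map \<phi> (hs @ ks)) \<and> hs \<noteq> [] \<and>
          set (hs @ ks) = faces_over P (1 + 2) (gs ! j) \<and> set hs = ?A \<and>
          (\<forall>x a. x face_of P \<and> x \<noteq> P \<and> a \<in> set (take j gs) \<and> gs ! j \<subseteq> x \<and> a \<subseteq> x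
             \<longrightarrow> (\<exists>h\<in>set hs. h \<subseteq> x))"
        by (rule exI[of _ hs], rule exI[of _ ks], use hk ne pure in simp)
    qed
  qed
qed

lemma shelling_edge_conn:
  assumes e: "e face_of P" "aff_dim e = 1" "w \<in> e"
    and A: "A \<subseteq> faces_over P 2 e"
    and c: "conn (sadj (faces_over P 3 {w})) (faces_over P 2 e)" "conn (sadj (faces_over P 3 {w})) A"
  shows "\<exists>hs ks. shelling (\<phi> e) (map \<phi> (hs @ ks)) \<and> set (hs @ ks) = faces_over P 2 e \<and> set hs = A"
proof -
  obtain hs ks where "distinct (hs @ ks)" "set hs = A" "set (hs @ ks) = faces_over P 2 e"
    "grows (sadj (faces_over P 3 {w})) {} (hs @ ks)"
    using conn_enumerate[OF finite_faces_over[OF P] c(1) A c(2)] by blast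
  then show ?thesis using shelling_edge[OF e, of "hs @ ks"] by blast
qed

lemma conn_shelling_edge:
  assumes e: "e face_of P" "aff_dim e = 1" "w \<in> e"
    and sh: "shelling (\<phi> e) (map \<phi> (hs @ ks))" "set (hs @ ks) = faces_over P 2 e"
  shows "conn (sadj (faces_over P 3 {w})) (faces_over P 2 e)"
    and "hs \<noteq> [] \<Longrightarrow> conn (sadj (faces_over P 3 {w})) (set hs)"
proof -
  have g: "grows (sadj (faces_over P 3 {w})) {} (hs @ ks)"
    using shelling_edge[OF e sh(2)] sh(1) by blast
  have ne: "faces_over P 2 e \<noteq> {}"
    using faces_over_nonempty[OF e(1,2)] by simp
  show "conn (sadj (faces_over P 3 {w})) (faces_over P 2 e)"
    using grows_conn[OF sym_sadj g disjI1[OF refl]] ne unfolding sh(2) by simp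
  show "conn (sadj (faces_over P 3 {w})) (set hs)" if "hs \<noteq> []"
    using grows_conn[OF sym_sadj, of _ "{}" hs] g that by (auto simp: grows_def prefix_all_append)
qed

text \<open>A proper face containing \<open>e\<close> and an earlier edge is 2- or 3-dimensional. A
  2-face is itself a ridge, which leaves the purity condition over the 3-faces in
  \<open>link_step\<close>; the connected sets of ridges are the initial segments of polygon
  shellings.\<close>

lemma shelling_vertex:
  assumes w: "{w} face_of P" and gs: "set gs = faces_over P 1 {w}"
  shows "shelling (\<phi> {w}) (map \<phi> gs) \<longleftrightarrow>
    link_shelling (faces_over P 1 {w}) (faces_over P 2 {w}) (faces_over P 3 {w}) gs"
    (is "_ \<longleftrightarrow> link_shelling ?E ?S ?X gs")
proof -
  have w0: "aff_dim {w} = 0" by simp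
  have gs': "set gs = faces_over P (0 + 1) {w}" using gs by simp
  have face: "gs ! j face_of P" "aff_dim (gs ! j) = 1" "w \<in> gs ! j" if "j < length gs" for j
    using nth_mem[OF that] gs by (auto simp: faces_over_def)
  have gs_ne: "gs \<noteq> []"
    using faces_over_nonempty[OF w w0] gs by auto
  have S_over: "{s \<in> ?S. e \<subseteq> s} = faces_over P 2 e" if "w \<in> e" for e
    using that by (auto simp: faces_over_def)
  have new: "new_ridges ?S A e = {h \<in> faces_over P (0 + 2) e. \<exists>a\<in>A. a \<subseteq> h}" if "w \<in> e" for A e
    using that by (auto simp: faces_over_def new_ridges_def)
  show ?thesis
  proof
    assume "shelling (\<phi> {w}) (map \<phi> gs)"
    note L = this[unfolded shelling_step[OF w w0 zero_le_one gs']]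
    obtain hs0 where hs0: "shelling (\<phi> (gs ! 0)) (map \<phi> (hs0 @ []))"
      "set (hs0 @ []) = faces_over P 2 (gs ! 0)"
      using L gs_ne by (auto simp: hd_conv_nth)
    have step: "conn (sadj ?X) {s \<in> ?S. gs ! j \<subseteq> s} \<and> link_step ?S ?X (set (take j gs)) (gs ! j)"
      if j: "j < length gs" for j
    proof (cases "j = 0")
      case True
      then show ?thesis
        using conn_shelling_edge(1)[OF face[OF j], of hs0 "[]"] hs0 S_over[OF face(3)[OF j]]
        by (simp add: link_step_def)
    next
      case False
      obtain hs ks where hk: "shelling (\<phi> (gs ! j)) (map \<phi> (hs @ ks))" "hs \<noteq> []"
         "set (hs @ ks) = faces_over P (0 + 2) (gs ! j)"
         "set hs = {h \<in> faces_over P (0 + 2) (gs ! j). \<exists>a\<in>set (take j gs). a \<subseteq> h}"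
         "\<forall>x a. x face_of P \<and> x \<noteq> P \<and> a \<in> set (take j gs) \<and> gs ! j \<subseteq> x \<and> a \<subseteq> x
             \<longrightarrow> (\<exists>h\<in>set hs. h \<subseteq> x)"
        using L[THEN conjunct2, THEN conjunct2, rule_format, of j] False j by blast
      have "new_ridges ?S (set (take j gs)) (gs ! j) = set hs" using new face[OF j] hk(4) by simp
      moreover have "conn (sadj ?X) (set hs)" "conn (sadj ?X) (faces_over P 2 (gs ! j))"
        using conn_shelling_edge[OF face[OF j] hk(1)] hk by auto
      moreover have "\<exists>s\<in>set hs. s \<subseteq> x"
        if x: "x \<in> ?X" "c \<in> set (take j gs)" "gs ! j \<subseteq> x \<and> c \<subseteq> x" for x c
      proof -
        have "x face_of P" "x \<noteq> P" using x(1) P4 by (auto simp: faces_over_def)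
        then show ?thesis using hk(5)[rule_format, of x c] x by simp
      qed
      ultimately show ?thesis unfolding link_step_def S_over[OF face(3)[OF j]] by simp
    qed
    show "link_shelling ?E ?S ?X gs"
      unfolding link_shelling_def prefix_all_nth
    proof (intro conjI ballI allI impI)
      fix e assume "e \<in> ?E"
      then obtain j where "j < length gs" "e = gs ! j" unfolding gs[symmetric] in_set_conv_nth by blast
      then show "conn (sadj ?X) {s \<in> ?S. e \<subseteq> s}" using step by blast
    next
      fix j assume "j < length gs"
      then show "link_step ?S ?X ({} \<union> set (take j gs)) (gs ! j)" using step by simp
    qed (use L gs in auto)
  next
    assume R: "link_shelling ?E ?S ?X gs"
    have conn: "conn (sadj ?X) (faces_over P 2 (gs ! j))" if "j < length gs" for j
      using R S_over[OF face(3)[OF that]] gs nth_mem[OF that] by (auto simp: link_shelling_def)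
    have step: "link_step ?S ?X (set (take j gs)) (gs ! j)" if "j < length gs" for j
      using R that by (simp add: link_shelling_def prefix_all_nth)
    have dist: "distinct gs" using R by (simp add: link_shelling_def)
    show "shelling (\<phi> {w}) (map \<phi> gs)"
      unfolding shelling_step[OF w w0 zero_le_one gs']
    proof (intro conjI allI impI)
      show "distinct gs" by fact
      have 0: "0 < length gs" using gs_ne by simp
      show "\<exists>hs. shelling (\<phi> (hd gs)) (map \<phi> hs) \<and> set hs = faces_over P (0 + 2) (hd gs)"
        using shelling_edge_conn[OF face[OF 0] order.refl conn[OF 0] conn[OF 0]] gs_ne
        by (simp add: hd_conv_nth) (metis map_append set_append)
    next
      fix j assume j: "0 < j \<and> j < length gs"
      let ?A = "{h \<in> faces_over P (0 + 2) (gs ! j). \<exists>a\<in>set (take j gs). a \<subseteq> h}"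
      have "set (take j gs) \<noteq> {}" using j by auto
      moreover have "new_ridges ?S (set (take j gs)) (gs ! j) = ?A" using new face(3) j by simp
      ultimately have "conn (sadj ?X) ?A \<and> (\<forall>x\<in>?X. \<forall>c\<in>set (take j gs).
           gs ! j \<subseteq> x \<and> c \<subseteq> x \<longrightarrow> (\<exists>s\<in>?A. s \<subseteq> x))"
        using step[of j] j unfolding link_step_def by simp
      then have ls: "conn (sadj ?X) ?A" "\<And>x c. x \<in> ?X \<Longrightarrow> c \<in> set (take j gs) \<Longrightarrow>
           gs ! j \<subseteq> x \<Longrightarrow> c \<subseteq> x \<Longrightarrow> \<exists>s\<in>?A. s \<subseteq> x"
        by blast+
      obtain hs ks where hk: "shelling (\<phi> (gs ! j)) (map \<phi> (hs @ ks))"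
        "set (hs @ ks) = faces_over P 2 (gs ! j)" "set hs = ?A"
        using shelling_edge_conn[OF face[of j] _ conn ls(1)] j by auto
      have ne: "hs \<noteq> []" using ls(1) hk(3) unfolding conn_def by auto
      have pure: "\<forall>x a. x face_of P \<and> x \<noteq> P \<and> a \<in> set (take j gs) \<and> gs ! j \<subseteq> x \<and> a \<subseteq> x
             \<longrightarrow> (\<exists>h\<in>set hs. h \<subseteq> x)"
      proof (intro allI impI)
        fix x a
        assume x: "x face_of P \<and> x \<noteq> P \<and> a \<in> set (take j gs) \<and> gs ! j \<subseteq> x \<and> a \<subseteq> x"
        have "a \<noteq> gs ! j" using x dist j by (metis distinct_take in_set_conv_nth in_set_takeD length_take
              min_less_iff_conj nth_eq_iff_index_eq nth_take less_irrefl)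
        moreover have "a face_of P" "aff_dim a = 1"
          using x in_set_takeD[of a j gs] gs by (auto simp: faces_over_def)
        ultimately have "1 < aff_dim x"
          using two_faces_aff_dim[OF P face(1)[of j], of a x] face(2) x j by auto
        moreover have "aff_dim x < 4" using proper_face_aff_dim_less[OF P, of x] x P4 by simp
        ultimately consider "aff_dim x = 2" | "aff_dim x = 3" by linarith
        then show "\<exists>h\<in>set hs. h \<subseteq> x"
        proof cases
          case 1
          then have "x \<in> ?A" using x by (auto simp: faces_over_def)
          then show ?thesis using hk by blast
        next
          case 2
          then have "x \<in> ?X" using x face(3)[of j] j by (auto simp: faces_over_def)
          then show ?thesis using ls(2)[of x a] x hk by blast
        qed
      qed
      show "\<exists>hs ks. shelling (\<phi> (gs ! j)) (map \<phi> (hs @ ks)) \<and> hs \<noteq> [] \<and>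
          set (hs @ ks) = faces_over P (0 + 2) (gs ! j) \<and> set hs = ?A \<and>
          (\<forall>x a. x face_of P \<and> x \<noteq> P \<and> a \<in> set (take j gs) \<and> gs ! j \<subseteq> x \<and> a \<subseteq> x
             \<longrightarrow> (\<exists>h\<in>set hs. h \<subseteq> x))"
        by (rule exI[of _ hs], rule exI[of _ ks], use hk ne pure in simp)
    qed
  qed
qed

end

section \<open>The shelling property as a condition at each vertex\<close>

lemma edge_segment:
  fixes P :: "'a::euclidean_space set"
  assumes P: "polytope P" and h: "h face_of P" "aff_dim h = 1"
    and w: "w \<in> vertices P" "w \<in> h"
  shows "\<exists>u\<in>vertices P. u \<noteq> w \<and> h = closed_segment w u"
    and "u \<in> vertices P \<Longrightarrow> u \<in> h \<Longrightarrow> u \<noteq> w \<Longrightarrow> h = closed_segment w u"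
proof -
  have "polytope h" using P h face_of_polytope_polytope by blast
  then obtain n where "n simplex h" using polytope_lowdim_imp_simplex[of h] h by auto
  then have "1 simplex h" using aff_dim_simplex h by fastforce
  then obtain A where A: "int (card A) = 1 + 1" "h = convex hull A"
    by (auto simp: simplex)
  then have "card A = 2" by simp
  then obtain a b where ab: "a \<noteq> b" "h = closed_segment a b"
    using A by (metis card_2_iff segment_convex_hull)
  have "u = a \<or> u = b" if "u \<in> vertices P" "u \<in> h" for u
    using that extreme_point_of_face[OF h(1)] ab extreme_point_of_segment[of u a b]
    by (auto simp: vertices_def)
  moreover have "a \<in> vertices P" "b \<in> vertices P"
    using extreme_point_of_face[OF h(1)] ab extreme_point_of_segment[of _ a b]
    by (auto simp: vertices_def)
  ultimately have *: "{u \<in> vertices P. u \<in> h} = {a, b}" using ab by auto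
  have w': "w = a \<or> w = b" using * w by blast
  then show "\<exists>u\<in>vertices P. u \<noteq> w \<and> h = closed_segment w u"
    using * ab(1) unfolding ab(2) by (elim disjE) (auto simp: closed_segment_commute)
  show "h = closed_segment w u" if u: "u \<in> vertices P" "u \<in> h" "u \<noteq> w"
  proof -
    have "u = a \<or> u = b" using * u by blast
    then show ?thesis using w' u(3) unfolding ab(2) by (auto simp: closed_segment_commute)
  qed
qed

lemma vertices_face: "F face_of P \<Longrightarrow> vertices F = vertices P \<inter> F"
  using extreme_point_of_face by (auto simp: vertices_def)

lemma finite_vertices: "polytope P \<Longrightarrow> finite (vertices P)"
  unfolding vertices_def using finite_polyhedron_extreme_points polytope_imp_polyhedron by blast

definition in_edges :: "('a::euclidean_space \<times> 'a) set \<Rightarrow> 'a \<Rightarrow> 'a set set" where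
  "in_edges E w = (\<lambda>a. closed_segment a w) ` {a. (a, w) \<in> E}"

lemma digraph_arc:
  assumes "polytopal_digraph P E" "(a, b) \<in> E"
  shows "a \<in> vertices P" "b \<in> vertices P" "a \<noteq> b" "closed_segment a b face_of P"
    "aff_dim (closed_segment a b) = 1"
proof -
  have e: "closed_segment a b edge_of P" using assms by (auto simp: polytopal_digraph_def)
  then show f: "closed_segment a b face_of P" "aff_dim (closed_segment a b) = 1"
    by (auto simp: edge_of_def)
  then show "a \<noteq> b" by auto
  show "a \<in> vertices P" "b \<in> vertices P"
    using extreme_point_of_face[OF f(1)] extreme_point_of_segment by (auto simp: vertices_def)
qed

lemma topological_order_exists:
  assumes "finite V" "acyclic E"
  shows "\<exists>ws. distinct ws \<and> set ws = V \<and> (\<forall>i<length ws. \<forall>j<length ws. (ws ! i, ws ! j) \<in> E \<longrightarrow> i < j)"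
proof -
  have "\<exists>ws. distinct ws \<and> set ws = V \<and> sorted_wrt (\<lambda>x y. (y, x) \<notin> E) ws"
    using assms(1)
  proof (induction "card V" arbitrary: V rule: less_induct)
    case less
    show ?case
    proof (cases "V = {}")
      case False
      have "acyclic (E \<inter> V \<times> V)" using assms(2) acyclic_subset by blast
      then have "wf (E \<inter> V \<times> V)" using less.prems by (simp add: finite_acyclic_wf)
      then obtain m where m: "m \<in> V" "\<And>y. (y, m) \<in> E \<inter> V \<times> V \<Longrightarrow> y \<notin> V"
        using False wf_eq_minimal by (metis ex_in_conv)
      have "card (V - {m}) < card V" using m less.prems by (meson card_Diff1_less)
      then obtain ws where "distinct ws" "set ws = V - {m}" "sorted_wrt (\<lambda>x y. (y, x) \<notin> E) ws"
        using less.hyps less.prems by blast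
      moreover have "(x, m) \<notin> E" if "x \<in> V" for x using m(2)[of x] m(1) that by blast
      ultimately have "distinct (m # ws) \<and> set (m # ws) = V \<and> sorted_wrt (\<lambda>x y. (y, x) \<notin> E) (m # ws)"
        using m(1) by auto
      then show ?thesis by blast
    qed simp
  qed
  then obtain ws where ws: "distinct ws" "set ws = V" "sorted_wrt (\<lambda>x y. (y, x) \<notin> E) ws" by blast
  have "i < j" if "i < length ws" "j < length ws" "(ws ! i, ws ! j) \<in> E" for i j
  proof (rule ccontr)
    assume "\<not> i < j"
    then consider "j < i" | "i = j" by linarith
    then show False
      using sorted_wrt_nth_less[OF ws(3)] that assms(2) unfolding acyclic_def by cases auto
  qed
  then show ?thesis using ws by blast
qed

definition vertex_shelling :: "'a::euclidean_space set \<Rightarrow> 'a \<Rightarrow> 'a set list \<Rightarrow> bool" where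
  "vertex_shelling P w = link_shelling (faces_over P 1 {w}) (faces_over P 2 {w}) (faces_over P 3 {w})"

text \<open>\<open>V\<close> will be the set of vertices that precede \<open>w\<close> in a
  topological sort. Members of \<open>V\<close> that are no neighbours of \<open>w\<close> do no
  harm, as an edge at \<open>w\<close> contains only one other vertex.\<close>

lemma in_edges_iff:
  fixes P :: "'a::euclidean_space set"
  assumes P: "polytope P" and G: "polytopal_digraph P E" and w: "w \<in> vertices P"
    and V: "\<And>a. (a, w) \<in> E \<Longrightarrow> a \<in> V" "\<And>a. a \<in> V \<Longrightarrow> (w, a) \<notin> E" "V \<subseteq> vertices P" "w \<notin> V"
  shows "{h \<in> faces_over P 1 {w}. \<exists>a\<in>V. a \<in> h} = in_edges E w"
proof (intro set_eqI iffI)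
  fix h assume "h \<in> {h \<in> faces_over P 1 {w}. \<exists>a\<in>V. a \<in> h}"
  then obtain a where h: "h face_of P" "aff_dim h = 1" "w \<in> h" "a \<in> V" "a \<in> h"
    by (auto simp: faces_over_def)
  then have eq: "h = closed_segment w a" using edge_segment(2)[OF P h(1,2) w h(3)] V by blast
  then have "closed_segment w a edge_of P" using h by (simp add: edge_of_def)
  then have "(a, w) \<in> E" using G V(2)[OF h(4)] unfolding polytopal_digraph_def by blast
  then show "h \<in> in_edges E w" unfolding in_edges_def eq closed_segment_commute[of w] by blast
next
  fix h assume "h \<in> in_edges E w"
  then obtain a where a: "h = closed_segment a w" "(a, w) \<in> E" by (auto simp: in_edges_def)
  then show "h \<in> {h \<in> faces_over P 1 {w}. \<exists>a\<in>V. a \<in> h}"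
    using digraph_arc[OF G a(2)] V(1)[OF a(2)] by (auto simp: faces_over_def)
qed

lemma vertex_face: "w \<in> vertices P \<longleftrightarrow> {w} face_of P"
  by (simp add: vertices_def face_of_singleton)

lemma vertices_faces_over: "faces_over P 0 {} = (\<lambda>w. {w}) ` vertices P"
  by (auto simp: faces_over_def vertex_face aff_dim_eq_0)

text \<open>Which edges at \<open>w\<close> lead to earlier vertices is decided by the orientation
  alone, so whatever the topological sort, the facet of \<open>w\<close> meets its predecessors
  along the faces of the in-edges.\<close>

lemma shelling_property_imp:
  fixes P :: "'a::euclidean_space set"
  assumes P: "polytope P" "aff_dim P = 4" and G: "polytopal_digraph P E"
    and sp: "shelling_property P E" and w: "w \<in> vertices P"
  shows "\<exists>l1 l2. vertex_shelling P w (l1 @ l2) \<and> set l1 = in_edges E w"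
proof -
  obtain Q \<phi> ws where *: "combinatorial_polar P Q \<phi>" "topological_sort P E ws"
    "shelling Q (map (\<lambda>w. \<phi> {w}) ws)" using sp shelling_property_def by blast
  interpret polar4 P Q \<phi> using P * by unfold_locales
  have ws: "distinct ws" "set ws = vertices P"
    "\<And>i j. i < length ws \<Longrightarrow> j < length ws \<Longrightarrow> (ws ! i, ws ! j) \<in> E \<Longrightarrow> i < j"
    using *(2) by (auto simp: topological_sort_def)
  let ?gs = "map (\<lambda>w. {w}) ws"
  have sh: "shelling (\<phi> {}) (map \<phi> ?gs)" using * polar_top_bot(2)[OF polar P(1)] by (simp add: comp_def)
  have gs: "set ?gs = faces_over P (-1 + 1) {}" using ws by (simp add: vertices_faces_over)
  have d: "aff_dim ({} :: 'a set) = -1" "(-1::int) \<le> 1" by auto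
  note L = sh[unfolded shelling_step[OF empty_face_of d gs]]
  obtain j where j: "j < length ws" "w = ws ! j" using w ws by (metis in_set_conv_nth)
  have fw: "{w} face_of P" using w vertex_face by blast
  have "w \<notin> set (take j ws)" using ws(1) j
    by (metis distinct_take id_take_nth_drop not_distinct_conv_prefix distinct_append
        list.set_intros(1) disjoint_iff)
  then have In: "{h \<in> faces_over P 1 {w}. \<exists>a\<in>set (take j ws). a \<in> h} = in_edges E w"
  proof (intro in_edges_iff[OF P(1) G w])
    show "a \<in> set (take j ws)" if "(a, w) \<in> E" for a
    proof -
      have "a \<in> set ws" using digraph_arc(1)[OF G that] ws by blast
      then obtain i where i: "i < length ws" "a = ws ! i" by (metis in_set_conv_nth)
      then have "i < j" using ws(3) j that by blast
      then show ?thesis using i j by (auto simp: in_set_conv_nth)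
    qed
    show "(w, a) \<notin> E" if "a \<in> set (take j ws)" for a
    proof
      assume "(w, a) \<in> E"
      moreover obtain i where i: "i < j" "a = ws ! i" using \<open>a \<in> _\<close> j by (auto simp: in_set_conv_nth)
      ultimately show False using ws(3)[of j i] j by auto
    qed
    show "set (take j ws) \<subseteq> vertices P" using ws set_take_subset by metis
  qed
  show ?thesis
  proof (cases "j = 0")
    \<comment> \<open>Nothing precedes the first vertex, so its in-edges form the empty initial
      segment of whatever shelling its facet has.\<close>
    case True
    then have "hd ?gs = {w}" using j by (simp add: hd_map hd_conv_nth)
    then obtain hs where "shelling (\<phi> {w}) (map \<phi> hs)" "set hs = faces_over P 1 {w}" using L by auto
    then have "vertex_shelling P w ([] @ hs)" using shelling_vertex[OF fw] by (simp add: vertex_shelling_def)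
    moreover have "set [] = in_edges E w" using In True by simp
    ultimately show ?thesis by blast
  next
    case False
    have "0 < j \<and> j < length ?gs" using False j by simp
    from L[THEN conjunct2, THEN conjunct2, rule_format, OF this]
    obtain hs ks where hk: "shelling (\<phi> {w}) (map \<phi> (hs @ ks))" "set (hs @ ks) = faces_over P 1 {w}"
       "set hs = {h \<in> faces_over P 1 {w}. \<exists>a\<in>set (take j ?gs). a \<subseteq> h}"
      using j by auto
    have "vertex_shelling P w (hs @ ks)"
      using shelling_vertex[OF fw hk(2)] hk(1) by (simp add: vertex_shelling_def)
    moreover have "set hs = in_edges E w" using hk(3) In by (simp add: take_map)
    ultimately show ?thesis by blast
  qed
qed

text \<open>The vertex of \<open>x\<close> with least index has no in-arc inside \<open>x\<close>.
  Combined with uniqueness of sources, every later vertex of \<open>x\<close> has one.\<close>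

lemma first_vertex_source:
  assumes ws: "set ws = vertices P"
    and ord: "\<And>i j. i < length ws \<Longrightarrow> j < length ws \<Longrightarrow> (ws ! i, ws ! j) \<in> E \<Longrightarrow> i < j"
    and x: "x face_of P" "i < length ws" "ws ! i \<in> x"
  shows "\<exists>k\<le>i. source_in E x (ws ! k)"
proof -
  let ?k = "LEAST k. ws ! k \<in> x"
  have k: "ws ! ?k \<in> x" "?k \<le> i" using x(3) by (auto intro: LeastI Least_le)
  have "(u, ws ! ?k) \<notin> face_arcs E x" for u
  proof
    assume u: "(u, ws ! ?k) \<in> face_arcs E x"
    then have "u \<in> vertices P" "u \<in> x" using vertices_face[OF x(1)] by (auto simp: face_arcs_def)
    then obtain m where m: "m < length ws" "u = ws ! m" using ws by (metis in_set_conv_nth)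
    then have "m < ?k" using ord[of m ?k] u k x by (auto simp: face_arcs_def)
    then show False using not_less_Least m \<open>u \<in> x\<close> by blast
  qed
  moreover have "ws ! ?k \<in> vertices x" using vertices_face[OF x(1)] k ws x nth_mem[of ?k ws] by auto
  ultimately show ?thesis using k by (auto simp: source_in_def)
qed

text \<open>For an acyclic USO, purity of the intersections on the top level is automatic: a vertex that
  is preceded by another vertex of a face \<open>x\<close> is not the source of \<open>x\<close>, so it has an in-arc
  inside \<open>x\<close>.\<close>

lemma shelling_propertyI:
  fixes P :: "'a::euclidean_space set"
  assumes P: "polytope P" "aff_dim P = 4" and G: "polytopal_digraph P E"
    and "acyclic E" and uso: "USO P E"
    and ex: "\<And>w. w \<in> vertices P \<Longrightarrow> \<exists>l1 l2. vertex_shelling P w (l1 @ l2) \<and> set l1 = in_edges E w"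
  shows "shelling_property P E"
proof -
  have "P \<noteq> {}" using P by auto
  then obtain Q \<phi> where *: "combinatorial_polar P Q \<phi>" using exists_combinatorial_polar P by blast
  interpret polar4 P Q \<phi> using P * by unfold_locales
  obtain ws where ws: "distinct ws" "set ws = vertices P"
    "\<forall>i<length ws. \<forall>j<length ws. (ws ! i, ws ! j) \<in> E \<longrightarrow> i < j"
    using topological_order_exists[OF finite_vertices[OF P(1)] \<open>acyclic E\<close>] by blast
  have ord: "\<And>i j. i < length ws \<Longrightarrow> j < length ws \<Longrightarrow> (ws ! i, ws ! j) \<in> E \<Longrightarrow> i < j" using ws(3) by blast
  have ts: "topological_sort P E ws" using ws by (simp add: topological_sort_def)
  let ?gs = "map (\<lambda>w. {w}) ws"
  have gs: "set ?gs = faces_over P (-1 + 1) {}" using ws by (simp add: vertices_faces_over)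
  have d: "aff_dim ({} :: 'a set) = -1" "(-1::int) \<le> 1" by auto
  have vs: "\<exists>l1 l2. shelling (\<phi> {w}) (map \<phi> (l1 @ l2)) \<and> set (l1 @ l2) = faces_over P 1 {w} \<and>
      set l1 = in_edges E w" if w: "w \<in> vertices P" for w
  proof -
    obtain l1 l2 where l: "vertex_shelling P w (l1 @ l2)" "set l1 = in_edges E w" using ex w by blast
    then have s: "set (l1 @ l2) = faces_over P 1 {w}" by (simp add: vertex_shelling_def link_shelling_def)
    have "{w} face_of P" using w vertex_face by blast
    then have "shelling (\<phi> {w}) (map \<phi> (l1 @ l2))" using shelling_vertex[OF _ s] l(1) by (simp add: vertex_shelling_def)
    then show ?thesis using s l(2) by blast
  qed
  have ne: "ws \<noteq> []" using gs faces_over_nonempty[of "{}" "-1"] by auto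
  have "shelling (\<phi> {}) (map \<phi> ?gs)"
    unfolding shelling_step[OF empty_face_of d gs]
  proof (intro conjI allI impI)
    show "distinct ?gs" using ws by (simp add: distinct_map)
    have "hd ws \<in> vertices P" using ne ws by (metis hd_in_set)
    from vs[OF this] show "\<exists>hs. shelling (\<phi> (hd ?gs)) (map \<phi> hs) \<and> set hs = faces_over P (-1 + 2) (hd ?gs)"
      using ne by (auto simp: hd_map simp flip: map_append set_append)
  next
    fix j assume "0 < j \<and> j < length ?gs"
    then have j: "0 < j" "j < length ws" by auto
    let ?w = "ws ! j"
    have w: "?w \<in> vertices P" using j ws nth_mem by metis
    obtain l1 l2 where l: "shelling (\<phi> {?w}) (map \<phi> (l1 @ l2))" "set (l1 @ l2) = faces_over P 1 {?w}"
      "set l1 = in_edges E ?w" using vs[OF w] by blast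
    have before: "a \<in> set (take j ws)" if "(a, ?w) \<in> E" for a
    proof -
      have "a \<in> set ws" using digraph_arc(1)[OF G that] ws by blast
      then obtain i where i: "i < length ws" "a = ws ! i" by (metis in_set_conv_nth)
      then have "i < j" using ord j that by blast
      then show ?thesis using i j by (auto simp: in_set_conv_nth)
    qed
    have In: "{h \<in> faces_over P 1 {?w}. \<exists>a\<in>set (take j ws). a \<in> h} = in_edges E ?w"
    proof (intro in_edges_iff[OF P(1) G w])
      show "(?w, a) \<notin> E" if "a \<in> set (take j ws)" for a
      proof
        assume "(?w, a) \<in> E"
        moreover obtain i where i: "i < j" "a = ws ! i" using \<open>a \<in> _\<close> j by (auto simp: in_set_conv_nth)
        ultimately show False using ord[of j i] j by auto
      qed
      show "set (take j ws) \<subseteq> vertices P" using ws set_take_subset by metis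
      show "?w \<notin> set (take j ws)" using ws(1) j by (auto simp: in_set_conv_nth nth_eq_iff_index_eq)
    qed (use before in auto)
    have pure: "\<exists>h\<in>set l1. h \<subseteq> x" if x: "x face_of P" "ws ! i \<in> x" "?w \<in> x" "i < j" for x i
    proof -
      obtain k where k: "k \<le> i" "source_in E x (ws ! k)"
        using first_vertex_source[OF ws(2) ord x(1), where i = i] x j by auto
      have "ws ! k \<noteq> ?w" using k x j ws(1) by (auto simp: nth_eq_iff_index_eq)
      moreover have "x \<noteq> {}" using x by blast
      ultimately have "\<not> source_in E x ?w" using uso k(2) x(1) unfolding USO_def by blast
      then obtain a where a: "(a, ?w) \<in> face_arcs E x"
        using w x(3) vertices_face[OF x(1)] by (auto simp: source_in_def)
      have "a \<in> x" using a vertices_face[OF x(1)] by (auto simp: face_arcs_def)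
      then have "closed_segment a ?w \<subseteq> x" using x face_of_imp_convex closed_segment_subset by blast
      then show ?thesis using a l(3) by (auto simp: in_edges_def face_arcs_def)
    qed
    have l1: "set l1 = {h \<in> faces_over P (-1 + 2) (?gs ! j). \<exists>a\<in>set (take j ?gs). a \<subseteq> h}"
      using In l(3) j by (simp add: take_map)
    \<comment> \<open>The purity argument, applied to the face \<open>P\<close> itself, yields an
      in-edge at every vertex but the first.\<close>
    have "ws ! 0 \<in> vertices P" using ws(2) ne by (metis length_greater_0_conv nth_mem)
    then have "l1 \<noteq> []"
      using pure[OF P_face, of 0] w j by (auto simp: vertices_def extreme_point_of_def)
    moreover have "\<forall>x a. x face_of P \<and> x \<noteq> P \<and> a \<in> set (take j ?gs) \<and> ?gs ! j \<subseteq> x \<and> a \<subseteq> x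
             \<longrightarrow> (\<exists>h\<in>set l1. h \<subseteq> x)"
    proof (intro allI impI)
      fix x a assume x: "x face_of P \<and> x \<noteq> P \<and> a \<in> set (take j ?gs) \<and> ?gs ! j \<subseteq> x \<and> a \<subseteq> x"
      then have "a \<in> set (take j ?gs)" by blast
      then obtain i where "i < j" "a = {ws ! i}" using j by (auto simp: in_set_conv_nth)
      then show "\<exists>h\<in>set l1. h \<subseteq> x" using pure[of x i] x j by auto
    qed
    ultimately show "\<exists>hs ks. shelling (\<phi> (?gs ! j)) (map \<phi> (hs @ ks)) \<and> hs \<noteq> [] \<and>
          set (hs @ ks) = faces_over P (-1 + 2) (?gs ! j) \<and>
          set hs = {h \<in> faces_over P (-1 + 2) (?gs ! j). \<exists>a\<in>set (take j ?gs). a \<subseteq> h} \<and>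
          (\<forall>x a. x face_of P \<and> x \<noteq> P \<and> a \<in> set (take j ?gs) \<and> ?gs ! j \<subseteq> x \<and> a \<subseteq> x
             \<longrightarrow> (\<exists>h\<in>set hs. h \<subseteq> x))"
      using l j by (rule_tac exI[of _ l1], rule_tac exI[of _ l2], unfold l1[symmetric]) simp
  qed
  then have "shelling Q (map (\<lambda>w. \<phi> {w}) ws)"
    using polar_top_bot(2)[OF polar P(1)] by (simp add: comp_def)
  then show ?thesis using * ts shelling_property_def by blast
qed

section \<open>Links of a vertex on the cutting hyperplane\<close>

text \<open>Adjacent elements may be merged by \<open>f\<close>; this is what allows new 2-faces of
  \<open>T\<close> to be collapsed onto old ones.\<close>

lemma conn_image:
  assumes c: "conn r A" and f: "\<And>x y. x \<in> A \<Longrightarrow> y \<in> A \<Longrightarrow> (x, y) \<in> r \<Longrightarrow> f x = f y \<or> (f x, f y) \<in> r'"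
  shows "conn r' (f ` A)"
proof -
  have "(f x, f y) \<in> (r' \<inter> f ` A \<times> f ` A)\<^sup>*" if "(x, y) \<in> (r \<inter> A \<times> A)\<^sup>*" "x \<in> A" for x y
    using that
  proof (induction rule: rtrancl_induct)
    case (step y z)
    then have "f y = f z \<or> (f y, f z) \<in> r' \<inter> f ` A \<times> f ` A" using f[of y z] by auto
    then show ?case using step by (metis rtrancl.rtrancl_into_rtrancl)
  qed simp
  then show ?thesis using c unfolding conn_def by blast
qed

lemma conn_clique:
  assumes "A \<noteq> {}" "\<And>x y. x \<in> A \<Longrightarrow> y \<in> A \<Longrightarrow> (x, y) \<in> r"
  shows "conn r A"
  using assms unfolding conn_def by blast

lemma conn_extend:
  assumes s: "sym r" and c: "conn r A" and AB: "A \<subseteq> B"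
    and ex: "\<And>b. b \<in> B - A \<Longrightarrow> \<exists>a\<in>A. (b, a) \<in> r"
  shows "conn r B"
proof -
  let ?R = "(r \<inter> B \<times> B)\<^sup>*"
  obtain p where p: "p \<in> A" using c conn_def by (metis ex_in_conv)
  have sub: "(r \<inter> A \<times> A)\<^sup>* \<subseteq> ?R" by (rule rtrancl_mono) (use AB in blast)
  have A: "(a, p) \<in> ?R \<and> (p, a) \<in> ?R" if "a \<in> A" for a
    using c p that sub unfolding conn_def by blast
  have "(b, p) \<in> ?R \<and> (p, b) \<in> ?R" if b: "b \<in> B" for b
  proof (cases "b \<in> A")
    case False
    then obtain a where a: "a \<in> A" "(b, a) \<in> r" using ex b by blast
    then have "(b, a) \<in> ?R" "(a, b) \<in> ?R" using AB b symD[OF s a(2)] by auto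
    then show ?thesis using A[OF a(1)] by (meson rtrancl_trans)
  qed (use A in blast)
  then show ?thesis using p AB unfolding conn_def by (meson empty_iff rtrancl_trans subsetD)
qed

text \<open>
  The links of a vertex \<open>w\<close>, \<open>w = v3\<close> or \<open>w = v4\<close>, in \<open>P\<close> and in its truncation \<open>T\<close>. The three
  indices stand for the neighbours of \<open>v\<close> other than \<open>w\<close>, the index 2 for the one in the cutting
  hyperplane. \<open>V\<close> is the edge from \<open>w\<close> to \<open>v\<close>, \<open>G i\<close> the 2-face at \<open>V\<close> in direction \<open>i\<close>, \<open>X i\<close> the
  3-face at \<open>V\<close> missing direction \<open>i\<close>, and \<open>x i\<close> the other edge of \<open>G i\<close> at \<open>w\<close>. In \<open>T\<close> the new
  3-face \<open>Y\<close> has edges \<open>t i\<close> and 2-faces \<open>D i\<close> (missing \<open>t i\<close>) at \<open>w\<close>, and \<open>\<kappa>\<close> cuts the old faces.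
  If \<open>t 2\<close> is already an edge of \<open>P\<close>, then \<open>G 2\<close> is a triangle that vanishes in \<open>T\<close>. Dually, the
  triangle \<open>V\<close> is starred, or two thirds of it are while the last third is merged with the
  neighbouring facet \<open>x 2\<close>.
\<close>

locale cut_link =
  fixes PE PS PS' PX TE TS TX :: "'a set set" and \<kappa> :: "'a set \<Rightarrow> 'a set"
    and V Y :: "'a set" and t G D X x :: "nat \<Rightarrow> 'a set" and Old :: "'a set set"
    and I :: "nat set"
  defines "Old \<equiv> PE - {V}" and "I \<equiv> {0, 1, 2}"
  assumes V: "V \<in> PE"
    and TE: "TE = Old \<union> t ` I" and TS: "TS = \<kappa> ` PS' \<union> D ` I" and TX: "TX = insert Y (\<kappa> ` PX)"
    and t_inj: "\<And>i j. i \<in> I \<Longrightarrow> j \<in> I \<Longrightarrow> t i = t j \<Longrightarrow> i = j"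
    and t_new: "t 0 \<notin> Old" "t 1 \<notin> Old" and t_old: "t 2 \<in> Old \<Longrightarrow> t 2 = x 2"
    and PS': "PS' = (if t 2 \<in> Old then PS - {G 2} else PS)"
    and kappa_ES: "\<And>e s. e \<in> Old \<Longrightarrow> s \<in> PS' \<Longrightarrow> e \<subseteq> \<kappa> s \<longleftrightarrow> e \<subseteq> s"
    and kappa_EX: "\<And>e z. e \<in> Old \<Longrightarrow> z \<in> PX \<Longrightarrow> e \<subseteq> \<kappa> z \<longleftrightarrow> e \<subseteq> z"
    and kappa_SX: "\<And>s z. s \<in> PS' \<Longrightarrow> z \<in> PX \<Longrightarrow> \<kappa> s \<subseteq> \<kappa> z \<longleftrightarrow> s \<subseteq> z"
    and kappa_inj: "inj_on \<kappa> PS'"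
    and tS: "\<And>i s. i \<in> I \<Longrightarrow> t i \<notin> Old \<Longrightarrow> s \<in> PS' \<Longrightarrow> t i \<subseteq> \<kappa> s \<longleftrightarrow> s = G i"
    and tX: "\<And>i z. i \<in> I \<Longrightarrow> t i \<notin> Old \<Longrightarrow> z \<in> PX \<Longrightarrow> t i \<subseteq> \<kappa> z \<longleftrightarrow> (\<exists>j\<in>I. j \<noteq> i \<and> z = X j)"
    and D_old: "\<And>e i. e \<in> Old \<Longrightarrow> e \<noteq> t 2 \<Longrightarrow> i \<in> I \<Longrightarrow> \<not> e \<subseteq> D i"
    and D_new: "\<And>i j. i \<in> I \<Longrightarrow> j \<in> I \<Longrightarrow> t j \<subseteq> D i \<longleftrightarrow> i \<noteq> j"
    and D_X: "\<And>i z. i \<in> I \<Longrightarrow> z \<in> PX \<Longrightarrow> D i \<subseteq> \<kappa> z \<longleftrightarrow> z = X i"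
    and Y_S: "\<And>s. s \<in> PS' \<Longrightarrow> \<not> \<kappa> s \<subseteq> Y"
    and D_Y: "\<And>i. i \<in> I \<Longrightarrow> D i \<subseteq> Y"
    and GX: "\<And>i. i \<in> I \<Longrightarrow> G i \<in> PS" "\<And>i. i \<in> I \<Longrightarrow> X i \<in> PX"
    and V_S: "\<And>s. s \<in> PS \<Longrightarrow> V \<subseteq> s \<longleftrightarrow> s \<in> G ` I"
    and V_X: "\<And>z. z \<in> PX \<Longrightarrow> V \<subseteq> z \<longleftrightarrow> z \<in> X ` I"
    and G_X: "\<And>i j. i \<in> I \<Longrightarrow> j \<in> I \<Longrightarrow> G j \<subseteq> X i \<longleftrightarrow> i \<noteq> j"
    and x_old: "\<And>i. i \<in> I \<Longrightarrow> x i \<in> Old"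
    and x_G: "\<And>e i. i \<in> I \<Longrightarrow> e \<in> Old \<Longrightarrow> e \<subseteq> G i \<longleftrightarrow> e = x i"
    and span: "\<And>e c s z. e \<in> PE \<Longrightarrow> c \<in> PE \<Longrightarrow> e \<noteq> c \<Longrightarrow> s \<in> PS \<Longrightarrow> z \<in> PX \<Longrightarrow>
      e \<subseteq> s \<Longrightarrow> c \<subseteq> s \<Longrightarrow> e \<subseteq> z \<Longrightarrow> c \<subseteq> z \<Longrightarrow> s \<subseteq> z"
    and fan: "\<And>s s' c. t 2 \<in> Old \<Longrightarrow> c \<in> I \<Longrightarrow> c \<noteq> 2 \<Longrightarrow> s \<in> PS' \<Longrightarrow> s' \<in> PS' \<Longrightarrow> t 2 \<subseteq> s \<Longrightarrow>
      t 2 \<subseteq> s' \<Longrightarrow> s \<subseteq> X c \<Longrightarrow> s' \<subseteq> X c \<Longrightarrow> s = s'"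
begin

lemma V_old: "V \<notin> Old" "Old \<subseteq> PE" "PE = insert V Old"
  using V by (auto simp: Old_def)

lemma third: "i \<in> I \<Longrightarrow> j \<in> I \<Longrightarrow> \<exists>k\<in>I. k \<noteq> i \<and> k \<noteq> j"
  by (auto simp: I_def)

text \<open>\<open>V\<close> and \<open>x i\<close> span \<open>G i\<close>. As \<open>V\<close>
  lies in \<open>X i\<close>, an \<open>x i\<close> in \<open>X i\<close> would pull in
  \<open>G i\<close>, although \<open>G i\<close> points in the missing direction.\<close>

lemma x_X: assumes "i \<in> I" "k \<in> I" shows "x i \<subseteq> X k \<longleftrightarrow> k \<noteq> i"
proof
  assume a: "x i \<subseteq> X k"
  show "k \<noteq> i"
  proof
    assume "k = i"
    have "G i \<subseteq> X i"
    proof (rule span[of V "x i"])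
      show "V \<subseteq> G i" using V_S GX assms by blast
      show "x i \<subseteq> G i" using x_G x_old assms by blast
      show "V \<subseteq> X i" using V_X GX assms by blast
    qed (use a \<open>k = i\<close> V_old x_old GX assms in auto)
    then show False using G_X assms by blast
  qed
next
  assume "k \<noteq> i"
  have "x i \<subseteq> G i" using x_G[OF assms(1) x_old[OF assms(1)]] by simp
  also have "G i \<subseteq> X k" using G_X[OF assms(2,1)] \<open>k \<noteq> i\<close> by simp
  finally show "x i \<subseteq> X k" .
qed

lemma x_inj: "i \<in> I \<Longrightarrow> j \<in> I \<Longrightarrow> x i = x j \<Longrightarrow> i = j"
  using x_X by metis

lemma G_inj: "i \<in> I \<Longrightarrow> j \<in> I \<Longrightarrow> G i = G j \<Longrightarrow> i = j"
  using x_G x_old x_inj by metis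

lemma PS'_sub: "PS' \<subseteq> PS"
  using PS' by auto

lemma in_PS': "s \<in> PS \<Longrightarrow> e \<in> Old \<Longrightarrow> e \<noteq> t 2 \<Longrightarrow> e \<subseteq> s \<Longrightarrow> s \<in> PS'"
  using PS' x_G[of 2 e] t_old by (auto simp: I_def)

lemma t_old_iff: "i \<in> I \<Longrightarrow> t i \<in> Old \<Longrightarrow> i = 2 \<and> t i = x i"
  using t_new t_old by (auto simp: I_def)

lemma t_in_X: assumes "j \<in> I" "k \<in> I" "k \<noteq> j" shows "t j \<subseteq> \<kappa> (X k)"
proof (cases "t j \<in> Old")
  case True
  then show ?thesis using x_X kappa_EX GX assms t_old_iff by metis
qed (use tX assms GX in blast)

lemma x_in_G: "i \<in> I \<Longrightarrow> x i \<subseteq> G i"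
  using x_G x_old by blast

lemma sadj_old:
  assumes "s \<in> PS'" "s' \<in> PS'" "(\<kappa> s, \<kappa> s') \<in> sadj TX"
  shows "(s, s') \<in> sadj PX"
proof -
  obtain z where z: "z \<in> TX" "\<kappa> s \<subseteq> z" "\<kappa> s' \<subseteq> z" using assms by (auto simp: sadj_def)
  then obtain r where r: "r \<in> PX" "z = \<kappa> r" using Y_S[OF assms(1)] unfolding TX by blast
  then have "s \<subseteq> r" "s' \<subseteq> r" using z kappa_SX assms by auto
  then show ?thesis using r by (auto simp: sadj_def)
qed

text \<open>Besides \<open>Y\<close>, which contains no cut of an old 2-face, the only 3-face of
  \<open>T\<close> containing \<open>D i\<close> is \<open>\<kappa> (X i)\<close>.\<close>

lemma sadj_D:
  assumes "s \<in> PS'" "i \<in> I" "(\<kappa> s, D i) \<in> sadj TX \<or> (D i, \<kappa> s) \<in> sadj TX"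
  shows "s \<subseteq> X i"
proof -
  obtain z where z: "z \<in> TX" "\<kappa> s \<subseteq> z" "D i \<subseteq> z" using assms by (auto simp: sadj_def)
  then obtain r where r: "r \<in> PX" "z = \<kappa> r" using Y_S[OF assms(1)] unfolding TX by blast
  then show ?thesis using z kappa_SX[OF assms(1) r(1)] D_X[OF assms(2) r(1)] by simp
qed

lemma kappa_D: "s \<in> PS' \<Longrightarrow> i \<in> I \<Longrightarrow> \<kappa> s \<noteq> D i"
  using Y_S D_Y by blast

lemma conn_old:
  assumes M: "M \<subseteq> PS'" and c: "conn (sadj TX) (\<kappa> ` M)"
  shows "conn (sadj PX) M"
proof -
  have inv: "inv_into PS' \<kappa> (\<kappa> s) = s" if "s \<in> M" for s
    using kappa_inj M that by (simp add: inv_into_f_f subset_iff)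
  have "conn (sadj PX) (inv_into PS' \<kappa> ` (\<kappa> ` M))"
  proof (rule conn_image[OF c])
    fix s s' assume "s \<in> \<kappa> ` M" "s' \<in> \<kappa> ` M" "(s, s') \<in> sadj TX"
    then obtain r r' where r: "r \<in> M" "r' \<in> M" "s = \<kappa> r" "s' = \<kappa> r'" "(\<kappa> r, \<kappa> r') \<in> sadj TX" by blast
    then have "(r, r') \<in> sadj PX" using sadj_old M by blast
    then show "inv_into PS' \<kappa> s = inv_into PS' \<kappa> s' \<or> (inv_into PS' \<kappa> s, inv_into PS' \<kappa> s') \<in> sadj PX"
      using r inv by simp
  qed
  moreover have "inv_into PS' \<kappa> ` (\<kappa> ` M) = M" using inv by (force simp: image_image)
  ultimately show ?thesis by simp
qed

text \<open>All \<open>D j\<close> with \<open>j \<in> J\<close> are collapsed onto the one element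
  \<open>y\<close>. A \<open>D j\<close> touches an old 2-face only inside \<open>X j\<close>, where
  that 2-face is equal or adjacent to \<open>y\<close> by assumption, so adjacency survives.\<close>

lemma conn_retract:
  assumes M: "M \<subseteq> PS'" and c: "conn (sadj TX) (\<kappa> ` M \<union> D ` J)" and J: "J \<subseteq> I"
    and y: "\<And>j s. j \<in> J \<Longrightarrow> s \<in> M \<Longrightarrow> s \<subseteq> X j \<Longrightarrow> s = y \<or> (s, y) \<in> sadj PX \<and> (y, s) \<in> sadj PX"
  shows "conn (sadj PX) (M \<union> (if J = {} then {} else {y}))"
proof -
  define g where "g = (\<lambda>s. if s \<in> D ` J then y else inv_into PS' \<kappa> s)"
  have gk: "g (\<kappa> s) = s" if "s \<in> M" for s
    using kappa_inj M that kappa_D[of s] J unfolding g_def by (auto simp: inv_into_f_f subset_iff)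
  have gD: "g (D j) = y" if "j \<in> J" for j using that by (simp add: g_def)
  have "conn (sadj PX) (g ` (\<kappa> ` M \<union> D ` J))"
  proof (rule conn_image[OF c])
    fix s s' assume *: "s \<in> \<kappa> ` M \<union> D ` J" "s' \<in> \<kappa> ` M \<union> D ` J" "(s, s') \<in> sadj TX"
    show "g s = g s' \<or> (g s, g s') \<in> sadj PX"
    proof (cases "s \<in> D ` J")
      case True
      then obtain j where j: "j \<in> J" "s = D j" by blast
      show ?thesis
      proof (cases "s' \<in> D ` J")
        case False
        then obtain r where r: "r \<in> M" "s' = \<kappa> r" using * by blast
        then have "r \<subseteq> X j" using sadj_D[of r j] M J j * by blast
        then show ?thesis using y[OF j(1) r(1)] gk r gD j by auto
      qed (use True gD in auto)
    next
      case False
      then obtain r where r: "r \<in> M" "s = \<kappa> r" using * by blast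
      show ?thesis
      proof (cases "s' \<in> D ` J")
        case True
        then obtain j where j: "j \<in> J" "s' = D j" by blast
        then have "r \<subseteq> X j" using sadj_D[of r j] M J r * by blast
        then show ?thesis using y[OF j(1) r(1)] gk r gD j by auto
      next
        case False
        then obtain r' where r': "r' \<in> M" "s' = \<kappa> r'" using * by blast
        then show ?thesis using sadj_old[of r r'] * r gk M by auto
      qed
    qed
  qed
  moreover have "g ` (\<kappa> ` M \<union> D ` J) = M \<union> (if J = {} then {} else {y})"
    using gk gD by (auto simp: image_Un image_image)
  ultimately show ?thesis by simp
qed

definition two :: "'a set set \<Rightarrow> bool" where
  "two A \<longleftrightarrow> (\<exists>i\<in>I. \<exists>j\<in>I. i \<noteq> j \<and> t i \<in> A \<and> t j \<in> A)"

text \<open>The edges of \<open>P\<close> shelled by the time that the edges in \<open>A\<close> have been shelled in \<open>T\<close>: the edge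
  \<open>V\<close> takes the place of the second of the \<open>t i\<close>.\<close>

definition lift :: "'a set set \<Rightarrow> 'a set set" where
  "lift A = A \<inter> Old \<union> (if two A then {V} else {})"

text \<open>While \<open>V\<close> still waits for a second \<open>t i\<close>, the one present must
  have its old neighbour \<open>x i\<close> already shelled. Otherwise \<open>\<kappa> (G i)\<close>
  could serve as a ridge in \<open>T\<close> without counterpart in \<open>P\<close>, and
  \<open>V\<close> could not be attached along \<open>G i\<close>.\<close>

definition good :: "'a set set \<Rightarrow> bool" where
  "good A \<longleftrightarrow> (\<forall>i\<in>I. t i \<in> A \<and> \<not> two A \<longrightarrow> x i \<in> A)"

lemma two_mono: "two A \<Longrightarrow> two (insert e A)"
  by (auto simp: two_def)

abbreviation old_ridges :: "'a set set \<Rightarrow> 'a set \<Rightarrow> 'a set set" where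
  "old_ridges A e \<equiv> {s \<in> PS'. e \<subseteq> s \<and> (\<exists>c\<in>A \<inter> Old. c \<subseteq> s)}"

text \<open>The ridges of \<open>e\<close> in \<open>T\<close> and in \<open>P\<close> differ only
  through the triangle: \<open>T\<close> sees the \<open>t i\<close> and \<open>P\<close> sees
  \<open>V\<close>. Ridges seen in \<open>T\<close> turn out to be ridges in \<open>P\<close>, and
  every additional ridge of \<open>P\<close> is adjacent to one of them.\<close>

lemma step_old:
  assumes A: "A \<subseteq> TE" "A \<noteq> {}" "good A" and e: "e \<in> Old" "e \<noteq> t 2" "e \<notin> A"
    and st: "link_step TS TX A e"
  shows "link_step PS PX (lift A) e"
proof -
  let ?N = "{s \<in> PS'. e \<subseteq> s \<and> (\<exists>c\<in>A. c \<subseteq> \<kappa> s)}"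
  have NT: "new_ridges TS A e = \<kappa> ` ?N"
  proof (intro set_eqI iffI)
    fix s assume "s \<in> new_ridges TS A e"
    then have s: "s \<in> TS" "e \<subseteq> s" "\<exists>c\<in>A. c \<subseteq> s" by (auto simp: new_ridges_def)
    then obtain r where "r \<in> PS'" "s = \<kappa> r" using D_old[OF e(1,2)] unfolding TS by blast
    then show "s \<in> \<kappa> ` ?N" using s kappa_ES[OF e(1)] by simp
  next
    fix s assume "s \<in> \<kappa> ` ?N"
    then show "s \<in> new_ridges TS A e" using kappa_ES[OF e(1)] by (auto simp: new_ridges_def TS)
  qed
  have N_iff: "(\<exists>c\<in>A. c \<subseteq> \<kappa> s) \<longleftrightarrow> (\<exists>c\<in>A \<inter> Old. c \<subseteq> s) \<or> (\<exists>i\<in>I. t i \<in> A \<and> t i \<notin> Old \<and> s = G i)"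
    if s: "s \<in> PS'" for s
  proof
    assume "\<exists>c\<in>A. c \<subseteq> \<kappa> s"
    then obtain c where c: "c \<in> A" "c \<subseteq> \<kappa> s" by blast
    show "(\<exists>c\<in>A \<inter> Old. c \<subseteq> s) \<or> (\<exists>i\<in>I. t i \<in> A \<and> t i \<notin> Old \<and> s = G i)"
    proof (cases "c \<in> Old")
      case True
      then show ?thesis using c kappa_ES[OF True s] by blast
    next
      case False
      then obtain i where "i \<in> I" "c = t i" using A(1) c(1) unfolding TE by blast
      then show ?thesis using c False tS[of i s] s by blast
    qed
  next
    assume "(\<exists>c\<in>A \<inter> Old. c \<subseteq> s) \<or> (\<exists>i\<in>I. t i \<in> A \<and> t i \<notin> Old \<and> s = G i)"
    then show "\<exists>c\<in>A. c \<subseteq> \<kappa> s"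
    proof
      assume "\<exists>c\<in>A \<inter> Old. c \<subseteq> s"
      then obtain c where "c \<in> A" "c \<in> Old" "c \<subseteq> s" by blast
      then show ?thesis using kappa_ES[of c s] s by blast
    next
      assume "\<exists>i\<in>I. t i \<in> A \<and> t i \<notin> Old \<and> s = G i"
      then obtain i where "i \<in> I" "t i \<in> A" "t i \<notin> Old" "s = G i" by blast
      then show ?thesis using tS[of i s] s by blast
    qed
  qed
  have conn0: "conn (sadj TX) (\<kappa> ` ?N)"
    and pure00: "\<forall>z\<in>TX. \<forall>c\<in>A. e \<subseteq> z \<and> c \<subseteq> z \<longrightarrow> (\<exists>s\<in>\<kappa> ` ?N. s \<subseteq> z)"
    using st A(2) unfolding link_step_def NT by simp_all
  have pure0: "\<exists>s\<in>?N. \<kappa> s \<subseteq> z" if zc: "z \<in> TX" "c \<in> A" "e \<subseteq> z" "c \<subseteq> z" for z c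
  proof -
    obtain s where "s \<in> \<kappa> ` ?N" "s \<subseteq> z"
      using pure00[rule_format, OF zc(1,2) conjI[OF zc(3,4)]] by (elim bexE)
    then obtain r where "r \<in> ?N" "\<kappa> r \<subseteq> z" by (elim imageE) simp
    then show ?thesis by (rule bexI[rotated])
  qed
  have pure1: "\<exists>s\<in>?N. s \<subseteq> z" if zc: "z \<in> PX" "c \<in> A" "e \<subseteq> z" "c \<subseteq> \<kappa> z" for z c
  proof -
    have "\<kappa> z \<in> TX" "e \<subseteq> \<kappa> z" using zc TX kappa_EX[OF e(1)] by auto
    from pure0[OF this(1) zc(2) this(2) zc(4)] obtain s where s: "s \<in> ?N" "\<kappa> s \<subseteq> \<kappa> z" ..
    then have "s \<subseteq> z" using kappa_SX[of s z] zc(1) by simp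
    then show ?thesis using s(1) by (rule bexI)
  qed
  let ?NP = "new_ridges PS (lift A) e"
  have sub: "?N \<subseteq> ?NP"
  proof
    fix s assume s: "s \<in> ?N"
    then have "s \<in> PS'" "\<exists>c\<in>A. c \<subseteq> \<kappa> s" by auto
    then have "(\<exists>c\<in>A \<inter> Old. c \<subseteq> s) \<or> (\<exists>i\<in>I. t i \<in> A \<and> t i \<notin> Old \<and> s = G i)"
      using N_iff by simp
    then consider "\<exists>c\<in>A \<inter> Old. c \<subseteq> s" | i where "i \<in> I" "t i \<in> A" "t i \<notin> Old" "s = G i"
      by blast
    then show "s \<in> ?NP"
    proof cases
      case 1
      then show ?thesis using s PS'_sub by (auto simp: new_ridges_def lift_def)
    next
      \<comment> \<open>The ridge \<open>G i\<close> comes from \<open>t i\<close>, so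
        \<open>e = x i\<close> is not yet shelled; \<open>good\<close> then yields a second
        \<open>t j\<close>, and \<open>V\<close> takes over the role of \<open>t i\<close>.\<close>
      case 2
      then have "e = x i" using s x_G e by blast
      then have "two A" using A(3) 2 e by (auto simp: good_def)
      then show ?thesis using s PS'_sub 2 V_S GX by (auto simp: new_ridges_def lift_def)
    qed
  qed
  \<comment> \<open>An additional ridge is shared with \<open>V\<close> only, hence is some
    \<open>G i\<close>. With \<open>t j\<close> present and \<open>k\<close> the third index, purity
    in \<open>T\<close> at \<open>\<kappa> (X k)\<close> provides a ridge inside \<open>X k\<close>,
    which contains \<open>G i\<close> as well.\<close>
  have adj: "\<exists>a\<in>?N. (s, a) \<in> sadj PX" if s: "s \<in> ?NP - ?N" for s
  proof -
    have sP: "s \<in> PS" "e \<subseteq> s" using s by (auto simp: new_ridges_def)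
    have s': "s \<in> PS'" using in_PS' sP e by blast
    have no: "\<not> (\<exists>c\<in>A \<inter> Old. c \<subseteq> s)" using s s' sP N_iff by blast
    then have two: "two A" and Vs: "V \<subseteq> s"
      using s by (auto simp: new_ridges_def lift_def split: if_splits)
    obtain i where i: "i \<in> I" "s = G i" using Vs V_S sP by blast
    obtain j where j: "j \<in> I" "j \<noteq> i" "t j \<in> A" using two unfolding two_def by metis
    obtain k where k: "k \<in> I" "k \<noteq> i" "k \<noteq> j" using third i j by blast
    have "G i \<subseteq> X k" using G_X i k by blast
    then obtain a where "a \<in> ?N" "a \<subseteq> X k"
      using pure1[of "X k" "t j"] GX k j t_in_X[of j k] sP i by blast
    have "(s, a) \<in> sadj PX" unfolding sadj_def
      using \<open>G i \<subseteq> X k\<close> i(2) GX(2)[OF k(1)] \<open>a \<subseteq> X k\<close> by blast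
    then show ?thesis using \<open>a \<in> ?N\<close> by (rule bexI)
  qed
  have "conn (sadj PX) ?N" by (rule conn_old[OF _ conn0]) blast
  then have "conn (sadj PX) ?NP" using conn_extend[OF sym_sadj _ sub] adj by blast
  moreover have "\<exists>s\<in>?NP. s \<subseteq> z" if z: "z \<in> PX" "c \<in> lift A" "e \<subseteq> z" "c \<subseteq> z" for z c
  proof (cases "c = V")
    case False
    then have "c \<in> A" "c \<subseteq> \<kappa> z" using z kappa_EX by (auto simp: lift_def split: if_splits)
    from pure1[OF z(1) this(1) z(3) this(2)] obtain s where s: "s \<in> ?N" "s \<subseteq> z" ..
    show ?thesis by (rule bexI[where x = s]) (rule s(2), rule subsetD[OF sub s(1)])
  next
    case True
    then have "two A" using z V_old(1) by (auto simp: lift_def split: if_splits)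
    obtain k where k: "k \<in> I" "z = X k" using V_X z True by blast
    obtain j where "j \<in> I" "j \<noteq> k" "t j \<in> A" using \<open>two A\<close> unfolding two_def by metis
    then have "t j \<in> A" "t j \<subseteq> \<kappa> z" using t_in_X[of j k] k by auto
    from pure1[OF z(1) this(1) z(3) this(2)] obtain s where s: "s \<in> ?N" "s \<subseteq> z" ..
    show ?thesis by (rule bexI[where x = s]) (rule s(2), rule subsetD[OF sub s(1)])
  qed
  ultimately show ?thesis unfolding link_step_def by blast
qed

lemma G_clique:
  assumes "s \<in> G ` I" "s' \<in> G ` I"
  shows "(s, s') \<in> sadj PX"
proof -
  obtain i j where ij: "i \<in> I" "j \<in> I" "s = G i" "s' = G j" using assms by blast
  then obtain k where "k \<in> I" "k \<noteq> i" "k \<noteq> j" using third by blast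
  then have "X k \<in> PX" "s \<subseteq> X k" "s' \<subseteq> X k" using ij G_X GX by auto
  then show ?thesis unfolding sadj_def by blast
qed

lemma V_ridges:
  assumes "A \<subseteq> Old" shows "new_ridges PS A V = G ` {i \<in> I. x i \<in> A}"
proof (intro set_eqI iffI)
  fix s assume "s \<in> new_ridges PS A V"
  then obtain i c where "i \<in> I" "s = G i" "c \<in> A" "c \<subseteq> G i" using V_S by (auto simp: new_ridges_def)
  then show "s \<in> G ` {i \<in> I. x i \<in> A}" using x_G assms by blast
next
  fix s assume "s \<in> G ` {i \<in> I. x i \<in> A}"
  then obtain i where i: "i \<in> I" "x i \<in> A" "s = G i" by blast
  then have "V \<subseteq> G i" "G i \<in> PS" "x i \<subseteq> G i" using V_S GX x_in_G by blast+
  then show "s \<in> new_ridges PS A V" using i unfolding new_ridges_def by blast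
qed

text \<open>In a triangle any nonempty set of edges is connected. Every corner but
  \<open>X a\<close> lies on the edge \<open>G a\<close>, so purity can fail only at
  \<open>X a\<close>.\<close>

lemma step_V:
  assumes A: "A \<subseteq> Old" and a: "a \<in> I" "x a \<in> A"
    and pure: "\<And>c. c \<in> A \<Longrightarrow> c \<subseteq> X a \<Longrightarrow> \<exists>i\<in>I. i \<noteq> a \<and> x i \<in> A"
  shows "link_step PS PX A V"
proof -
  have "conn (sadj PX) (new_ridges PS A V)"
    unfolding V_ridges[OF A] using a by (intro conn_clique) (auto intro!: G_clique)
  moreover have "\<exists>s\<in>new_ridges PS A V. s \<subseteq> z" if z: "z \<in> PX" "c \<in> A" "V \<subseteq> z" "c \<subseteq> z" for z c
  proof -
    obtain k where k: "k \<in> I" "z = X k" using V_X z by blast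
    have "\<exists>i\<in>I. i \<noteq> k \<and> x i \<in> A" using a pure z k by metis
    then show ?thesis unfolding V_ridges[OF A] using G_X k by blast
  qed
  ultimately show ?thesis unfolding link_step_def by blast
qed

lemma new_ridge_t:
  assumes A: "A \<subseteq> TE" and b: "b \<in> I" "t b \<notin> Old" "t b \<notin> A" and s: "s \<in> new_ridges TS A (t b)"
  shows "s = \<kappa> (G b) \<and> x b \<in> A \<or> (\<exists>i\<in>I. \<exists>j\<in>I. s = D i \<and> i \<noteq> j \<and> t j \<in> A)"
proof -
  obtain c where c: "s \<in> TS" "t b \<subseteq> s" "c \<in> A" "c \<subseteq> s" using s by (auto simp: new_ridges_def)
  have c': "c \<in> Old \<and> c \<noteq> t 2 \<or> (\<exists>j\<in>I. c = t j)" using c(3) A unfolding TE by (auto simp: I_def)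
  consider r where "r \<in> PS'" "s = \<kappa> r" | i where "i \<in> I" "s = D i" using c(1) unfolding TS by blast
  then show ?thesis
  proof cases
    case 1
    then have r: "r = G b" using tS b c by blast
    show ?thesis
    proof (cases "c \<in> Old")
      case True
      then have "c = x b" using kappa_ES[OF True 1(1)] c 1 r x_G b by blast
      then show ?thesis using c 1 r by blast
    next
      case False
      then obtain j where j: "j \<in> I" "c = t j" using c' by blast
      then have "G b = G j" using tS[of j r] 1 c False r by blast
      then show ?thesis using G_inj b j c by blast
    qed
  next
    case 2
    then show ?thesis using c' c D_old D_new by blast
  qed
qed

text \<open>With no other \<open>t i\<close> present the new edge can be attached only along
  \<open>\<kappa> (G b)\<close>, that is, to \<open>x b\<close>; this is what establishes
  \<open>good\<close>.\<close>

lemma step_first_t: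
  assumes A: "A \<subseteq> TE" "A \<noteq> {}" and none: "\<And>i. i \<in> I \<Longrightarrow> t i \<notin> A"
    and b: "b \<in> I" "t b \<notin> Old" and st: "link_step TS TX A (t b)"
  shows "x b \<in> A"
proof -
  obtain s where "s \<in> new_ridges TS A (t b)"
    using st A(2) unfolding link_step_def conn_def by blast
  then show ?thesis using new_ridge_t[OF A(1) b none[OF b(1)]] none by blast
qed

text \<open>Only purity at \<open>X a\<close> is in question, and it is inherited from
  \<open>T\<close>, because \<open>t b\<close> lies in \<open>\<kappa> (X a)\<close>. A ridge of
  \<open>t b\<close> in there is \<open>\<kappa> (G b)\<close>, which gives \<open>x b\<close>, or
  \<open>D a\<close>, which would require a second \<open>t j\<close> to be present already.\<close>

lemma step_second_t:
  assumes A: "A \<subseteq> TE" "A \<noteq> {}" "good A" "\<not> two A"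
    and a: "a \<in> I" "t a \<in> A" "a \<noteq> b"
    and b: "b \<in> I" "t b \<notin> Old" "t b \<notin> A" and st: "link_step TS TX A (t b)"
  shows "link_step PS PX (A \<inter> Old) V"
proof (rule step_V)
  show "x a \<in> A \<inter> Old" using A a x_old by (auto simp: good_def)
  fix c assume c: "c \<in> A \<inter> Old" "c \<subseteq> X a"
  have "\<kappa> (X a) \<in> TX" "t b \<subseteq> \<kappa> (X a)" "c \<subseteq> \<kappa> (X a)"
    using c a b TX GX kappa_EX t_in_X[of b a] by auto
  then obtain s where s: "s \<in> new_ridges TS A (t b)" "s \<subseteq> \<kappa> (X a)"
    using st A(2) c unfolding link_step_def by blast
  from new_ridge_t[OF A(1) b s(1)] show "\<exists>i\<in>I. i \<noteq> a \<and> x i \<in> A \<inter> Old"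
  proof
    assume "s = \<kappa> (G b) \<and> x b \<in> A"
    then show ?thesis using a b x_old by (intro bexI[of _ b]) auto
  next
    assume "\<exists>i\<in>I. \<exists>j\<in>I. s = D i \<and> i \<noteq> j \<and> t j \<in> A"
    then obtain i j where ij: "i \<in> I" "j \<in> I" "s = D i" "i \<noteq> j" "t j \<in> A" by blast
    have "X a = X i" using D_X[OF ij(1)] GX a s ij by blast
    then have "i = a" using G_X[of i i] G_X[of a i] a ij by auto
    then have "two A" using ij a unfolding two_def by metis
    then show ?thesis using A by blast
  qed
qed (use a in auto)

lemma old_ridges_t2:
  assumes "t 2 \<in> Old" "t 2 \<notin> A"
  shows "new_ridges PS (A \<inter> Old) (t 2) = old_ridges A (t 2)"
proof -
  have "(2::nat) \<in> I" by (simp add: I_def)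
  then have "c = t 2" if "c \<in> Old" "c \<subseteq> G 2" for c using x_G that t_old assms by metis
  then have "\<not> (\<exists>c\<in>A \<inter> Old. c \<subseteq> G 2)" using assms by blast
  then show ?thesis using assms PS' by (auto simp: new_ridges_def)
qed

text \<open>An old \<open>t 2\<close> borders old and new 2-faces at the same time. The new 2-face
  \<open>D i\<close> becomes a ridge as soon as some \<open>t j\<close> with
  \<open>j \<noteq> i\<close> has been shelled.\<close>

lemma ridges_t2:
  assumes A: "A \<subseteq> TE"
    and t2: "t 2 \<in> Old" "t 2 \<notin> A"
  shows "new_ridges TS A (t 2) = \<kappa> ` old_ridges A (t 2) \<union> D ` {i \<in> I. i \<noteq> 2 \<and> (\<exists>j\<in>I. j \<noteq> i \<and> t j \<in> A)}"
    (is "_ = _ \<union> D ` ?J")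
proof (intro set_eqI iffI)
  have 2: "2 \<in> I" by (simp add: I_def)
  fix s assume "s \<in> new_ridges TS A (t 2)"
  then obtain c where c: "s \<in> TS" "t 2 \<subseteq> s" "c \<in> A" "c \<subseteq> s" by (auto simp: new_ridges_def)
  have c2: "c \<noteq> t 2" using c t2 by blast
  consider r where "r \<in> PS'" "s = \<kappa> r" | i where "i \<in> I" "s = D i" using c(1) unfolding TS by blast
  then show "s \<in> \<kappa> ` old_ridges A (t 2) \<union> D ` ?J"
  proof cases
    case 1
    have r2: "t 2 \<subseteq> r" using kappa_ES[OF t2(1) 1(1)] c 1 by blast
    have "c \<in> Old"
    proof (rule ccontr)
      assume no: "c \<notin> Old"
      then obtain j where j: "j \<in> I" "c = t j" using c(3) A unfolding TE by blast
      then have "r = G j" using tS 1 c no by blast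
      then have "x 2 = x j" using x_G[OF j(1) t2(1)] r2 t_old t2 by metis
      then have "j = 2" using x_inj 2 j by blast
      then show False using j c2 by blast
    qed
    then have "c \<subseteq> r" using kappa_ES 1 c by blast
    then show ?thesis using 1 r2 c \<open>c \<in> Old\<close> by blast
  next
    case 2
    have "i \<noteq> 2" using D_new[OF 2(1) \<open>2 \<in> I\<close>] c 2 by blast
    moreover have "\<exists>j\<in>I. c = t j"
    proof (cases "c \<in> Old")
      case True
      then show ?thesis using D_old[OF True c2 2(1)] c 2 by blast
    qed (use c A in \<open>unfold TE, blast\<close>)
    moreover have "j \<noteq> i" if "j \<in> I" "c = t j" for j using D_new[OF 2(1) that(1)] c 2 that by blast
    ultimately have "i \<in> ?J" using 2(1) c(3) by auto
    then show ?thesis using 2(2) by blast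
  qed
next
  have 2: "2 \<in> I" by (simp add: I_def)
  fix s assume "s \<in> \<kappa> ` old_ridges A (t 2) \<union> D ` ?J"
  then consider r c where "r \<in> PS'" "s = \<kappa> r" "t 2 \<subseteq> r" "c \<in> A" "c \<in> Old" "c \<subseteq> r"
    | i j where "i \<in> I" "i \<noteq> 2" "j \<in> I" "j \<noteq> i" "t j \<in> A" "s = D i" by blast
  then show "s \<in> new_ridges TS A (t 2)"
  proof cases
    case 1
    then have "t 2 \<subseteq> \<kappa> r" "c \<subseteq> \<kappa> r" using kappa_ES t2 by auto
    then show ?thesis using 1 unfolding new_ridges_def TS by blast
  next
    case 2
    then have "t 2 \<subseteq> D i" "t j \<subseteq> D i" using D_new[OF 2(1)] \<open>2 \<in> I\<close> by auto
    then show ?thesis using 2 unfolding new_ridges_def TS by blast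
  qed
qed

lemma two_I: "2 \<in> I"
  by (simp add: I_def)

abbreviation new_at_t2 :: "'a set set \<Rightarrow> nat set" where
  "new_at_t2 A \<equiv> {i \<in> I. i \<noteq> 2 \<and> (\<exists>j\<in>I. j \<noteq> i \<and> t j \<in> A)}"

text \<open>Purity descends from \<open>T\<close>, except that the ridge provided inside
  \<open>\<kappa> (X j)\<close> may be the new 2-face \<open>D j\<close>; this is the second
  alternative.\<close>

lemma pure_t2:
  assumes A: "A \<subseteq> TE" "A \<noteq> {}" and t2: "t 2 \<in> Old" "t 2 \<notin> A" and st: "link_step TS TX A (t 2)"
    and z: "z \<in> PX" "c \<in> A \<inter> Old" "t 2 \<subseteq> z" "c \<subseteq> z"
  shows "(\<exists>s\<in>old_ridges A (t 2). s \<subseteq> z) \<or> (\<exists>j\<in>new_at_t2 A. z = X j)"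
proof -
  have "\<kappa> z \<in> TX" "t 2 \<subseteq> \<kappa> z" "c \<subseteq> \<kappa> z" using z t2 TX kappa_EX by auto
  then obtain s where s: "s \<in> new_ridges TS A (t 2)" "s \<subseteq> \<kappa> z"
    using st A(2) z(2) unfolding link_step_def by blast
  then consider r where "r \<in> old_ridges A (t 2)" "s = \<kappa> r" | j where "j \<in> new_at_t2 A" "s = D j"
    unfolding ridges_t2[OF A(1) t2] by blast
  then show ?thesis
  proof cases
    case 1
    then have "r \<subseteq> z" using kappa_SX[of r z] s z by auto
    then show ?thesis using 1 by blast
  next
    case 2
    then have "z = X j" using D_X[of j z] s z by auto
    then show ?thesis using 2 by blast
  qed
qed

lemma conn_t2:
  assumes A: "A \<subseteq> TE" "A \<noteq> {}" and t2: "t 2 \<in> Old" "t 2 \<notin> A" and st: "link_step TS TX A (t 2)"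
  shows "conn (sadj TX) (\<kappa> ` old_ridges A (t 2) \<union> D ` new_at_t2 A)"
  using st A(2) ridges_t2[OF A(1) t2] by (simp add: link_step_def)

lemma step_t2_none:
  assumes A: "A \<subseteq> TE" "A \<noteq> {}" and none: "\<And>i. i \<in> I \<Longrightarrow> t i \<notin> A"
    and t2: "t 2 \<in> Old" and st: "link_step TS TX A (t 2)"
  shows "link_step PS PX (A \<inter> Old) (t 2)"
proof -
  have t2A: "t 2 \<notin> A" using none two_I by blast
  have J: "new_at_t2 A = {}" using none by auto
  have "conn (sadj PX) (old_ridges A (t 2) \<union> (if new_at_t2 A = {} then {} else {Y}))"
    by (rule conn_retract[OF _ conn_t2[OF A t2 t2A st]]) (use J in auto)
  then have "conn (sadj PX) (new_ridges PS (A \<inter> Old) (t 2))"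
    unfolding old_ridges_t2[OF t2 t2A] J by simp
  moreover have "\<exists>s\<in>new_ridges PS (A \<inter> Old) (t 2). s \<subseteq> z"
    if "z \<in> PX" "c \<in> A \<inter> Old" "t 2 \<subseteq> z" "c \<subseteq> z" for z c
    unfolding old_ridges_t2[OF t2 t2A] using pure_t2[OF A t2 t2A st that] J by blast
  ultimately show ?thesis unfolding link_step_def by blast
qed

lemma G2_ridge:
  assumes t2: "t 2 \<in> Old" "t 2 \<notin> A"
  shows "new_ridges PS (insert V (A \<inter> Old)) (t 2) = insert (G 2) (old_ridges A (t 2))"
proof -
  have sub: "t 2 \<subseteq> G 2" "V \<subseteq> G 2" "G 2 \<in> PS"
    using x_in_G[OF two_I] t_old[OF t2(1)] V_S GX two_I by auto
  have only: "{s \<in> PS. t 2 \<subseteq> s \<and> V \<subseteq> s} = {G 2}"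
  proof (intro set_eqI iffI)
    fix s assume "s \<in> {s \<in> PS. t 2 \<subseteq> s \<and> V \<subseteq> s}"
    then have s: "s \<in> PS" "t 2 \<subseteq> s" "V \<subseteq> s" by auto
    obtain i where i: "i \<in> I" "s = G i" using V_S s by blast
    then have "x 2 = x i" using x_G t2 t_old s by metis
    then show "s \<in> {G 2}" using x_inj two_I i by blast
  qed (use sub in auto)
  have "new_ridges PS (insert V (A \<inter> Old)) (t 2) =
      {s \<in> PS. t 2 \<subseteq> s \<and> V \<subseteq> s} \<union> new_ridges PS (A \<inter> Old) (t 2)"
    by (auto simp: new_ridges_def)
  then show ?thesis unfolding only old_ridges_t2[OF t2] by simp
qed

lemma G2_pure: "t 2 \<in> Old \<Longrightarrow> z \<in> PX \<Longrightarrow> V \<subseteq> z \<Longrightarrow> t 2 \<subseteq> z \<Longrightarrow> G 2 \<subseteq> z"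
  using span[of V "t 2" "G 2" z] V_old x_in_G[OF two_I] t_old V_S GX two_I by auto

lemma G2_X: "j \<in> new_at_t2 A \<Longrightarrow> G 2 \<subseteq> X j"
  using G_X[of j 2] two_I by auto

lemma step_t2_V:
  assumes A: "A \<subseteq> TE" "A \<noteq> {}" and t2: "t 2 \<in> Old" "t 2 \<notin> A" and st: "link_step TS TX A (t 2)"
    and c: "conn (sadj PX) (insert (G 2) (old_ridges A (t 2)))"
  shows "link_step PS PX (insert V (A \<inter> Old)) (t 2)"
proof -
  have "\<exists>s\<in>insert (G 2) (old_ridges A (t 2)). s \<subseteq> z"
    if z: "z \<in> PX" "c \<in> insert V (A \<inter> Old)" "t 2 \<subseteq> z" "c \<subseteq> z" for z c
  proof (cases "c = V")
    case True
    then show ?thesis using G2_pure t2 z by blast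
  next
    case False
    then have "c \<in> A \<inter> Old" using z(2) by blast
    from pure_t2[OF A t2 st z(1) this z(3,4)] show ?thesis
    proof
      assume "\<exists>j\<in>new_at_t2 A. z = X j"
      then obtain j where "j \<in> new_at_t2 A" "z = X j" ..
      then show ?thesis using G2_X[of j A] by simp
    qed blast
  qed
  then show ?thesis unfolding link_step_def G2_ridge[OF t2] using c by blast
qed

text \<open>Every \<open>D j\<close> that is a ridge at \<open>t 2\<close> has
  \<open>j \<noteq> 2\<close>, so \<open>G 2\<close> lies in \<open>X j\<close>, and all these
  \<open>D j\<close> can be collapsed onto \<open>G 2\<close>.\<close>

lemma step_t2_last:
  assumes A: "A \<subseteq> TE" and two: "two A" and t2: "t 2 \<in> Old" "t 2 \<notin> A" and st: "link_step TS TX A (t 2)"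
  shows "link_step PS PX (insert V (A \<inter> Old)) (t 2)"
proof -
  have ne: "A \<noteq> {}" using two by (auto simp: two_def)
  obtain i j where ij: "i \<in> I" "j \<in> I" "i \<noteq> j" "t i \<in> A" "t j \<in> A" using two two_def by blast
  then have "i \<noteq> 2" using t2 by metis
  then have "i \<in> new_at_t2 A" using ij by auto
  then have J: "new_at_t2 A \<noteq> {}" by force
  have "conn (sadj PX) (old_ridges A (t 2) \<union> (if new_at_t2 A = {} then {} else {G 2}))"
  proof (rule conn_retract[OF _ conn_t2[OF A ne t2 st]])
    fix j s assume j: "j \<in> new_at_t2 A" "s \<subseteq> X j"
    then have "X j \<in> PX" "G 2 \<subseteq> X j" using GX(2)[of j] G2_X[OF j(1)] by auto
    then show "s = G 2 \<or> (s, G 2) \<in> sadj PX \<and> (G 2, s) \<in> sadj PX"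
      using j unfolding sadj_def by blast
  qed auto
  then have "conn (sadj PX) (insert (G 2) (old_ridges A (t 2)))"
    by (simp only: J if_False Un_insert_right Un_empty_right)
  then show ?thesis using step_t2_V[OF A ne t2 st] by blast
qed

text \<open>The order of \<open>t 2\<close> and \<open>V\<close> depends on how \<open>t 2\<close>
  was attached in \<open>T\<close>, where exactly one new 2-face \<open>D c\<close> is a ridge.
  Without old ridges, \<open>V\<close> comes first and \<open>t 2\<close> is attached to it along
  \<open>G 2\<close>. With old ridges, \<open>D c\<close> is tied to one of them inside
  \<open>X c\<close>, so \<open>t 2\<close> can come first; \<open>V\<close> is then attached along
  \<open>G a\<close> and \<open>G 2\<close>.\<close>

lemma step_t2_second:
  assumes A: "A \<subseteq> TE" "good A" "\<not> two A" and a: "a \<in> I" "t a \<in> A"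
    and t2: "t 2 \<in> Old" "t 2 \<notin> A" and st: "link_step TS TX A (t 2)"
  shows "link_step PS PX (A \<inter> Old) (t 2) \<and> link_step PS PX (insert (t 2) (A \<inter> Old)) V \<or>
    link_step PS PX (A \<inter> Old) V \<and> link_step PS PX (insert V (A \<inter> Old)) (t 2)"
proof -
  have ne: "A \<noteq> {}" using a by blast
  have a2: "a \<noteq> 2" using a t2 by metis
  have only: "t j \<in> A \<Longrightarrow> j \<in> I \<Longrightarrow> j = a" for j using A(3) a unfolding two_def by blast
  obtain c where c: "c \<in> I" "c \<noteq> a" "c \<noteq> 2" using third[OF a(1) two_I] by blast
  have Ic: "i = a \<or> i = c \<or> i = 2" if "i \<in> I" for i
    using that a(1) a2 c by (auto simp: I_def)
  have J: "new_at_t2 A = {c}"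
  proof (intro set_eqI iffI)
    fix i assume i: "i \<in> new_at_t2 A"
    then have "i \<noteq> a" using only by blast
    then show "i \<in> {c}" using Ic[of i] i by blast
  qed (use c a in auto)
  have xa: "x a \<in> A \<inter> Old" using A a x_old by (auto simp: good_def)
  let ?N = "old_ridges A (t 2)"
  show ?thesis
  proof (cases "?N = {}")
    case True
    have "link_step PS PX (A \<inter> Old) V"
    proof (rule step_V)
      fix d assume d: "d \<in> A \<inter> Old" "d \<subseteq> X a"
      \<comment> \<open>No ridge lies in \<open>X a\<close>: there is no old one, and the new one
        belongs to \<open>X c\<close>. So no earlier edge lies in \<open>X a\<close>, and purity
        there is vacuous.\<close>
      have "t 2 \<subseteq> X a" using t_old[OF t2(1)] x_X[OF two_I a(1)] a2 by simp
      from pure_t2[OF A(1) ne t2 st GX(2)[OF a(1)] d(1) this d(2)]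
      have "X a = X c" unfolding True J by simp
      then have False using G_X[of a a] G_X[of c a] a c by auto
      then show "\<exists>i\<in>I. i \<noteq> a \<and> x i \<in> A \<inter> Old" ..
    qed (use a xa in auto)
    moreover have "conn (sadj PX) (insert (G 2) ?N)" unfolding True
      by (rule conn_clique) (use G_clique two_I in auto)
    ultimately show ?thesis using step_t2_V[OF A(1) ne t2 st] by blast
  next
    case False
    have cT: "conn (sadj TX) (\<kappa> ` ?N \<union> {D c})" using conn_t2[OF A(1) ne t2 st] J by simp
    from False obtain r where r: "r \<in> ?N" unfolding ex_in_conv[symmetric] ..
    then have "\<kappa> r \<noteq> D c" using kappa_D c by blast
    have neq: "{D c} \<noteq> \<kappa> ` ?N \<union> {D c}"
    proof
      assume eq: "{D c} = \<kappa> ` ?N \<union> {D c}"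
      have "\<kappa> r \<in> {D c}" by (subst eq, rule UnI1, rule imageI, rule r)
      then show False using \<open>\<kappa> r \<noteq> D c\<close> by simp
    qed
    have "\<exists>p\<in>{D c}. \<exists>s\<in>(\<kappa> ` ?N \<union> {D c}) - {D c}. (p, s) \<in> sadj TX"
      by (rule conn_exit[OF cT Un_upper2 insert_not_empty neq])
    then obtain s where "s \<in> \<kappa> ` ?N" "(D c, s) \<in> sadj TX" by blast
    then obtain y where y: "y \<in> ?N" "y \<subseteq> X c" using sadj_D[OF _ c(1)] by blast
    \<comment> \<open>By \<open>fan\<close> the 2-face \<open>y\<close> is the only old ridge inside
      \<open>X c\<close>, so \<open>D c\<close> can be collapsed onto it without adding an
      element.\<close>
    have eq: "s = y" if "s \<in> ?N" "s \<subseteq> X c" for s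
      using fan[OF t2(1) c(1) c(3), of s y] that y by blast
    have "conn (sadj PX) (?N \<union> (if {c} = {} then {} else {y}))"
      by (rule conn_retract[OF _ _ _, where J = "{c}"]) (use cT c eq in auto)
    then have "conn (sadj PX) ?N" using y by (simp add: insert_absorb)
    moreover have "\<exists>s\<in>?N. s \<subseteq> z" if z: "z \<in> PX" "d \<in> A \<inter> Old" "t 2 \<subseteq> z" "d \<subseteq> z" for z d
      using pure_t2[OF A(1) ne t2 st z]
    proof
      assume "\<exists>j\<in>new_at_t2 A. z = X j"
      then have "z = X c" unfolding J by simp
      then show ?thesis using y by (intro bexI[where x = y]) auto
    qed
    ultimately have 1: "link_step PS PX (A \<inter> Old) (t 2)"
      unfolding link_step_def old_ridges_t2[OF t2] by blast
    have "link_step PS PX (insert (t 2) (A \<inter> Old)) V"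
    proof (rule step_V)
      show "\<exists>i\<in>I. i \<noteq> a \<and> x i \<in> insert (t 2) (A \<inter> Old)"
        using two_I a2 t_old[OF t2(1)] by (intro bexI[of _ 2]) auto
    qed (use a xa t2 in auto)
    then show ?thesis using 1 by blast
  qed
qed

lemma lift_insert:
  "lift (insert e A) = lift A \<union> ({e} \<inter> Old) \<union> (if two (insert e A) then {V} else {})"
  using two_mono[of A e] by (auto simp: lift_def)

lemma two_insert: "two (insert e A) \<longleftrightarrow> two A \<or> (\<exists>i\<in>I. \<exists>j\<in>I. i \<noteq> j \<and> e = t i \<and> t j \<in> A)"
proof
  assume "two (insert e A)"
  then obtain i j where ij: "i \<in> I" "j \<in> I" "i \<noteq> j" "t i \<in> insert e A" "t j \<in> insert e A"
    unfolding two_def by blast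
  then show "two A \<or> (\<exists>i\<in>I. \<exists>j\<in>I. i \<noteq> j \<and> e = t i \<and> t j \<in> A)"
    using t_inj[OF ij(1,2)] unfolding two_def by (metis insertE)
qed (auto simp: two_def)

text \<open>A step in \<open>T\<close> is answered in \<open>P\<close> by nothing for a new
  \<open>t i\<close> that comes first or third, by \<open>V\<close> for a new one that comes second,
  by \<open>e\<close> for an old edge, and by both when the old edge \<open>t 2\<close> comes
  second. For empty \<open>A\<close> the condition \<open>link_step\<close> would carry no
  information.\<close>

lemma lift_step:
  assumes A: "A \<subseteq> TE" "A \<noteq> {}" "good A" and e: "e \<in> TE" "e \<notin> A" and st: "link_step TS TX A e"
  shows "good (insert e A) \<and> (\<exists>l. distinct l \<and> set l = lift (insert e A) - lift A \<and>
      prefix_all (link_step PS PX) (lift A) l)"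
proof -
  consider (old) "e \<in> Old" "e \<noteq> t 2" | (new) b where "b \<in> I" "e = t b" "t b \<notin> Old"
    | (t2) "e = t 2" "t 2 \<in> Old"
  proof (cases "e \<in> Old")
    case True
    then show ?thesis using that(1,3) by (cases "e = t 2") auto
  next
    case False
    then show ?thesis using that(2) e(1) unfolding TE by blast
  qed
  then show ?thesis
  proof cases
    case old
    have nt: "e \<noteq> t i" if "i \<in> I" for i using t_old_iff[OF that] old by metis
    then have two: "two (insert e A) \<longleftrightarrow> two A" unfolding two_insert by blast
    have "good (insert e A)" using A(3) nt two by (auto simp: good_def)
    moreover have "set [e] = lift (insert e A) - lift A"
      unfolding lift_insert two using old e V_old(1) by (auto simp: lift_def)
    moreover have "link_step PS PX (lift A) e" using step_old A old e st by blast
    ultimately show ?thesis by (intro conjI exI[of _ "[e]"]) auto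
  next
    case new
    show ?thesis
    proof (cases "\<exists>a\<in>I. t a \<in> A")
      case False
      then have "\<not> two A" unfolding two_def by blast
      then have two: "\<not> two (insert e A)" using False unfolding two_insert by blast
      have "x b \<in> A" using step_first_t[OF A(1,2) _ new(1,3)] False st new by blast
      then have "good (insert e A)" unfolding good_def using False new t_inj by blast
      moreover have "lift (insert e A) - lift A = {}" unfolding lift_insert using two new by auto
      ultimately show ?thesis by (intro conjI exI[of _ "[]"]) auto
    next
      case True
      then obtain a where a: "a \<in> I" "t a \<in> A" by blast
      then have ab: "a \<noteq> b" using e new by blast
      then have two: "two (insert e A)" unfolding two_insert
        using a new(1,2) by (intro disjI2 bexI[of _ b] bexI[of _ a]) auto
      then have good: "good (insert e A)" by (simp add: good_def)
      show ?thesis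
      proof (cases "two A")
        case True
        then have "lift (insert e A) - lift A = {}" unfolding lift_insert using new by (auto simp: lift_def)
        then show ?thesis using good by (intro conjI exI[of _ "[]"]) auto
      next
        case False
        then have "lift (insert e A) - lift A = {V}" "lift A = A \<inter> Old"
          unfolding lift_insert using new two V_old(1) by (auto simp: lift_def)
        moreover have "link_step PS PX (A \<inter> Old) V"
          using step_second_t[OF A False a ab] new e st by blast
        ultimately show ?thesis using good by (intro conjI exI[of _ "[V]"]) auto
      qed
    qed
  next
    case t2
    show ?thesis
    proof (cases "\<exists>a\<in>I. t a \<in> A")
      case False
      then have "\<not> two A" unfolding two_def by blast
      then have two: "\<not> two (insert e A)" "\<not> two A" using False unfolding two_insert by blast+
      have good: "good (insert e A)" unfolding good_def using False t2 t_inj two_I t_old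
        by (metis insertCI insertE)
      have "lift A = A \<inter> Old" "lift (insert e A) - lift A = {e}"
        unfolding lift_insert using two t2 e by (auto simp: lift_def)
      then show ?thesis using step_t2_none[OF A(1,2) _ t2(2)] False st t2 good
        by (intro conjI exI[of _ "[e]"]) auto
    next
      case True
      then obtain a where a: "a \<in> I" "t a \<in> A" by blast
      then have "a \<noteq> 2" using e t2 by blast
      then have two: "two (insert e A)" unfolding two_insert
        using a t2(1) two_I by (intro disjI2 bexI[of _ 2] bexI[of _ a]) auto
      then have good: "good (insert e A)" by (simp add: good_def)
      have t2A: "t 2 \<notin> A" and st2: "link_step TS TX A (t 2)" and Vt2: "V \<noteq> t 2"
        using e st t2 V_old(1) by auto
      show ?thesis
      proof (cases "two A")
        case True
        then have "lift A = insert V (A \<inter> Old)" "lift (insert e A) - lift A = {e}"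
          unfolding lift_insert using two t2 e V_old(1) by (auto simp: lift_def)
        moreover have "link_step PS PX (insert V (A \<inter> Old)) e"
          using step_t2_last[OF A(1) True t2(2) t2A st2] t2 by simp
        ultimately show ?thesis using good by (intro conjI exI[of _ "[e]"]) auto
      next
        case False
        then have l: "lift A = A \<inter> Old" "lift (insert e A) - lift A = {e, V}"
          unfolding lift_insert using two t2 e V_old(1) by (auto simp: lift_def)
        from step_t2_second[OF A(1,3) False a t2(2) t2A st2] show ?thesis
        proof
          assume "link_step PS PX (A \<inter> Old) (t 2) \<and> link_step PS PX (insert (t 2) (A \<inter> Old)) V"
          then show ?thesis using good l t2 Vt2 by (intro conjI exI[of _ "[e, V]"]) auto
        next
          assume "link_step PS PX (A \<inter> Old) V \<and> link_step PS PX (insert V (A \<inter> Old)) (t 2)"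
          then show ?thesis using good l t2 Vt2 by (intro conjI exI[of _ "[V, e]"]) auto
        qed
      qed
    qed
  qed
qed

lemma lift_mono: "A \<subseteq> B \<Longrightarrow> lift A \<subseteq> lift B"
  by (auto simp: lift_def two_def) 

lemma lift_steps:
  assumes "A \<subseteq> TE" "A \<noteq> {}" "good A" "distinct l" "set l \<subseteq> TE - A" "prefix_all (link_step TS TX) A l"
  shows "good (A \<union> set l) \<and> (\<exists>l'. distinct l' \<and> set l' = lift (A \<union> set l) - lift A \<and>
      prefix_all (link_step PS PX) (lift A) l')"
  using assms
proof (induction l arbitrary: A)
  case Nil
  then show ?case by (intro conjI exI[of _ "[]"]) auto
next
  case (Cons e l)
  have e: "e \<in> TE" "e \<notin> A" "link_step TS TX A e" using Cons.prems by auto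
  obtain l1 where l1: "good (insert e A)" "distinct l1" "set l1 = lift (insert e A) - lift A"
    "prefix_all (link_step PS PX) (lift A) l1" using lift_step[OF Cons.prems(1-3) e] by blast
  have ih: "good (insert e A \<union> set l) \<and> (\<exists>l'. distinct l' \<and> set l' = lift (insert e A \<union> set l) - lift (insert e A) \<and>
      prefix_all (link_step PS PX) (lift (insert e A)) l')"
    by (rule Cons.IH) (use Cons.prems l1 e in auto)
  then obtain l2 where l2: "good (insert e A \<union> set l)" "distinct l2"
    "set l2 = lift (insert e A \<union> set l) - lift (insert e A)"
    "prefix_all (link_step PS PX) (lift (insert e A)) l2" by blast
  have m: "lift A \<subseteq> lift (insert e A)" "lift (insert e A) \<subseteq> lift (insert e A \<union> set l)"
    by (intro lift_mono; blast)+
  have eq: "A \<union> set (e # l) = insert e A \<union> set l" by simp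
  have "lift A \<union> set l1 = lift (insert e A)" using l1 m by blast
  then have "prefix_all (link_step PS PX) (lift A) (l1 @ l2)" using l1 l2 by (simp add: prefix_all_append)
  moreover have "distinct (l1 @ l2)" "set (l1 @ l2) = lift (insert e A \<union> set l) - lift A"
    using l1(2,3) l2(2,3) m by auto
  ultimately show ?case unfolding eq using l2(1) by blast
qed

text \<open>The first edge shelled is unconstrained, so \<open>good\<close> may fail while only new
  edges have been shelled. The first old edge restores it: if new edges precede, it shares a 2-face
  with some \<open>t i\<close>, which must be the cut of \<open>G i\<close> and makes it
  \<open>x i\<close>, unless it is \<open>t 2\<close> and itself the second part of the
  triangle.\<close>

lemma lift_start:
  assumes l: "prefix_all (link_step TS TX) {} (ts @ [e])" "distinct (ts @ [e])"
    and ts: "set ts \<subseteq> TE - Old" and e: "e \<in> Old"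
  shows "good (insert e (set ts)) \<and> (\<exists>l'. distinct l' \<and> set l' = lift (insert e (set ts)) \<and>
      prefix_all (link_step PS PX) {} l')"
proof -
  have tsI: "\<exists>i\<in>I. c = t i \<and> t i \<notin> Old" if "c \<in> set ts" for c using ts that unfolding TE by blast
  let ?A = "insert e (set ts)"
  have first: "link_step PS PX {} e" by (simp add: link_step_def)
  have "good ?A \<and> (two ?A \<longrightarrow> (\<exists>i\<in>I. e = x i))"
  proof (cases "ts = []")
    case True
    have "\<not> two ?A" using t_inj True by (auto simp: two_def)
    moreover have "good ?A" using True t_old_iff e by (auto simp: good_def)
    ultimately show ?thesis by blast
  next
    case False
    have "link_step TS TX (set ts) e" using l by (simp add: prefix_all_append)
    then obtain s where "s \<in> new_ridges TS (set ts) e"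
      using False unfolding link_step_def conn_def by (auto simp: ex_in_conv)
    then obtain c where c: "s \<in> TS" "e \<subseteq> s" "c \<in> set ts" "c \<subseteq> s" by (auto simp: new_ridges_def)
    obtain i where i: "i \<in> I" "c = t i" "t i \<notin> Old" using tsI[OF c(3)] by blast
    show ?thesis
    proof (cases "e = t 2")
      case True
      then have "i \<noteq> 2" using i e by metis
      then have "two ?A" unfolding two_def using i c True two_I by (intro bexI[of _ i] bexI[of _ 2]) auto
      then show ?thesis using True t_old e two_I by (auto simp: good_def)
    next
      case False
      have "e = x i"
      proof -
        consider r where "r \<in> PS'" "s = \<kappa> r" | j where "j \<in> I" "s = D j" using c(1) unfolding TS by blast
        then show ?thesis
        proof cases
          case 1
          then have "r = G i" using tS i c by blast
          then show ?thesis using kappa_ES[OF e 1(1)] 1 c x_G[OF i(1) e] by blast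
        next
          case 2
          then show ?thesis using D_old e False c by blast
        qed
      qed
      moreover have "good ?A" unfolding good_def
      proof (intro ballI impI)
        fix j assume j: "j \<in> I" "t j \<in> ?A \<and> \<not> two ?A"
        then have "j = i" using i c unfolding two_def by blast
        then show "x j \<in> ?A" using \<open>e = x i\<close> by simp
      qed
      ultimately show ?thesis using i by blast
    qed
  qed
  then have good: "good ?A" and xe: "two ?A \<Longrightarrow> \<exists>i\<in>I. e = x i" by blast+
  have old: "?A \<inter> Old = {e}" using ts e by blast
  show ?thesis
  proof (cases "two ?A")
    case False
    then have "lift ?A = {e}" using old by (simp add: lift_def)
    then show ?thesis using good first by (intro conjI exI[of _ "[e]"]) auto
  next
    case True
    then have lift: "lift ?A = {e, V}" using old by (auto simp: lift_def)
    obtain i where i: "i \<in> I" "e = x i" using xe[OF True] by blast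
    \<comment> \<open>\<open>e = x i\<close> is the only predecessor and does not lie in
      \<open>X i\<close>, so purity at that corner is vacuous.\<close>
    have "link_step PS PX {e} V"
      by (rule step_V[OF _ i(1)]) (use i e x_X in auto)
    moreover have "e \<noteq> V" using e V_old(1) by blast
    ultimately show ?thesis using good first lift by (intro conjI exI[of _ "[e, V]"]) auto
  qed
qed

lemma lift_prefix:
  assumes l: "prefix_all (link_step TS TX) {} l" "distinct l" "set l \<subseteq> TE" "set l \<inter> Old \<noteq> {}"
  shows "good (set l) \<and> (\<exists>l'. distinct l' \<and> set l' = lift (set l) \<and> prefix_all (link_step PS PX) {} l')"
proof -
  have "\<exists>e\<in>set l. e \<in> Old" using l by blast
  then obtain ts e es where sp: "l = ts @ e # es" "e \<in> Old" "\<forall>c\<in>set ts. c \<notin> Old"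
    using split_list_first_prop[of l "\<lambda>e. e \<in> Old"] by blast
  have l': "l = (ts @ [e]) @ es" using sp by simp
  let ?A = "insert e (set ts)"
  have p: "prefix_all (link_step TS TX) {} (ts @ [e])" "prefix_all (link_step TS TX) ?A es"
    using l(1) unfolding l' prefix_all_append by auto
  obtain l1 where l1: "good ?A" "distinct l1" "set l1 = lift ?A" "prefix_all (link_step PS PX) {} l1"
    using lift_start[OF p(1)] l sp by auto
  have sub: "?A \<subseteq> TE" "set es \<subseteq> TE - ?A" "distinct es" using l sp by auto
  obtain l2 where l2: "good (?A \<union> set es)" "distinct l2" "set l2 = lift (?A \<union> set es) - lift ?A"
    "prefix_all (link_step PS PX) (lift ?A) l2"
    using lift_steps[OF sub(1) insert_not_empty l1(1) sub(3,2) p(2)] by blast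
  have "set l = ?A \<union> set es" using sp by auto
  moreover have "lift ?A \<subseteq> lift (?A \<union> set es)" by (rule lift_mono) blast
  ultimately have "distinct (l1 @ l2) \<and> set (l1 @ l2) = lift (set l) \<and> prefix_all (link_step PS PX) {} (l1 @ l2)"
    using l1 l2 by (auto simp: prefix_all_append)
  then show ?thesis using l2(1) \<open>set l = _\<close> by metis
qed

text \<open>Around an old \<open>t 2\<close> the new 2-faces are collapsed onto the vanished
  \<open>G 2\<close>, which lies in every \<open>X j\<close> with
  \<open>j \<noteq> 2\<close>.\<close>

lemma conn_link:
  assumes c: "\<And>e. e \<in> TE \<Longrightarrow> conn (sadj TX) {s \<in> TS. e \<subseteq> s}" and e: "e \<in> PE"
  shows "conn (sadj PX) {s \<in> PS. e \<subseteq> s}"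
proof -
  consider "e = V" | "e \<in> Old" "e \<noteq> t 2" | "e = t 2" "t 2 \<in> Old" using e V_old(3) by blast
  then show ?thesis
  proof cases
    case 1
    have "G 2 \<in> {s \<in> PS. e \<subseteq> s}" using 1 V_S GX two_I by blast
    then show ?thesis using 1 V_S G_clique by (intro conn_clique) auto
  next
    case 2
    have eq: "{s \<in> PS. e \<subseteq> s} = {s \<in> PS'. e \<subseteq> s}" using in_PS' 2 PS'_sub by blast
    have "{s \<in> TS. e \<subseteq> s} = \<kappa> ` {s \<in> PS'. e \<subseteq> s}"
      unfolding TS using kappa_ES[OF 2(1)] D_old[OF 2] by auto
    then have "conn (sadj TX) (\<kappa> ` {s \<in> PS'. e \<subseteq> s})" using c[of e] 2 TE by auto
    then show ?thesis unfolding eq by (intro conn_old) auto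
  next
    case 3
    let ?M = "{s \<in> PS'. e \<subseteq> s}"
    have G2: "t 2 \<subseteq> G 2" "G 2 \<in> PS" using x_in_G[OF two_I] t_old[OF 3(2)] GX two_I by auto
    then have eq: "{s \<in> PS. e \<subseteq> s} = ?M \<union> {G 2}" using 3 PS' by auto
    have "{s \<in> TS. e \<subseteq> s} = \<kappa> ` ?M \<union> D ` (I - {2})"
      unfolding TS using kappa_ES[OF 3(2)] D_new[OF _ two_I] 3 by auto
    then have cT: "conn (sadj TX) (\<kappa> ` ?M \<union> D ` (I - {2}))" using c[of e] 3 TE by auto
    have ne: "I - {2} \<noteq> {}" by (auto simp: I_def)
    have "conn (sadj PX) (?M \<union> (if I - {2} = {} then {} else {G 2}))"
    proof (rule conn_retract[OF _ cT])
      fix j s assume j: "j \<in> I - {2}" "s \<subseteq> X j"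
      then have "X j \<in> PX" "G 2 \<subseteq> X j" using GX(2)[of j] G_X[of j 2] two_I by auto
      then show "s = G 2 \<or> (s, G 2) \<in> sadj PX \<and> (G 2, s) \<in> sadj PX"
        using j unfolding sadj_def by blast
    qed auto
    then show ?thesis unfolding eq by (simp only: ne if_False)
  qed
qed

lemma lift_TE: "lift TE = PE"
proof -
  have "two TE" unfolding two_def using TE t_inj[of 0 1]
    by (intro bexI[of _ 0] bexI[of _ 1]) (auto simp: I_def)
  moreover have "TE \<inter> Old = Old" using TE by blast
  ultimately have "lift TE = insert V Old" by (simp add: lift_def)
  then show ?thesis unfolding V_old(3)[symmetric] .
qed

text \<open>Lifting starts at the first old edge, so a nonempty prefix has to contain one. As
  \<open>lift\<close> is monotone and takes \<open>TE\<close> to \<open>PE\<close>, a prefix lifts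
  to a prefix of a complete shelling.\<close>

theorem lift_link_shelling:
  assumes sh: "link_shelling TE TS TX (l1 @ l2)" and l1: "l1 = [] \<or> set l1 \<inter> Old \<noteq> {}"
  shows "\<exists>l1' l2'. link_shelling PE PS PX (l1' @ l2') \<and> set l1' = lift (set l1)"
proof -
  have d: "distinct (l1 @ l2)" "set (l1 @ l2) = TE" "prefix_all (link_step TS TX) {} (l1 @ l2)"
    "\<And>e. e \<in> TE \<Longrightarrow> conn (sadj TX) {s \<in> TS. e \<subseteq> s}" using sh by (auto simp: link_shelling_def)
  have conn: "\<forall>e\<in>PE. conn (sadj PX) {s \<in> PS. e \<subseteq> s}" using conn_link d(4) by blast
  show ?thesis
  proof (cases "l1 = []")
    case True
    have "TE \<inter> Old \<noteq> {}" using TE x_old two_I by blast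
    then obtain l' where "distinct l'" "set l' = lift TE" "prefix_all (link_step PS PX) {} l'"
      using lift_prefix[OF d(3,1)] d(2) by auto
    then have "link_shelling PE PS PX ([] @ l')" using conn lift_TE by (simp add: link_shelling_def)
    moreover have "set [] = lift (set l1)" using True by (simp add: lift_def two_def)
    ultimately show ?thesis by blast
  next
    case False
    then have ne: "set l1 \<inter> Old \<noteq> {}" "set l1 \<noteq> {}" using l1 by auto
    have "prefix_all (link_step TS TX) {} l1" using d(3) by (simp add: prefix_all_append)
    then obtain l' where l': "good (set l1)" "distinct l'" "set l' = lift (set l1)"
      "prefix_all (link_step PS PX) {} l'" using lift_prefix[of l1] d ne by auto
    obtain l'' where l'': "distinct l''" "set l'' = lift (set l1 \<union> set l2) - lift (set l1)"
      "prefix_all (link_step PS PX) (lift (set l1)) l''"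
      using lift_steps[of "set l1" l2] d ne l' by (auto simp: prefix_all_append)
    have m: "lift (set l1) \<subseteq> PE" using lift_mono[of "set l1" TE] d(2) lift_TE by auto
    have "set l1 \<union> set l2 = TE" using d(2) by simp
    then have "link_shelling PE PS PX (l' @ l'')"
      using l' l'' m lift_TE conn by (auto simp: link_shelling_def prefix_all_append)
    then show ?thesis using l' by blast
  qed
qed

end

section \<open>Truncation of a simple vertex\<close>

lemma minimal_face:
  fixes P :: "'a::euclidean_space set"
  assumes P: "polytope P" and x: "x \<in> P"
  obtains G where "G face_of P" "x \<in> rel_interior G"
proof -
  have "P face_of P" using P by (simp add: face_of_refl polytope_imp_convex)
  then obtain G where G: "G face_of P" "x \<in> G"
    and min: "\<And>G'. G' face_of P \<Longrightarrow> x \<in> G' \<Longrightarrow> nat (aff_dim G) \<le> nat (aff_dim G')"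
    using ex_has_least_nat[of "\<lambda>G. G face_of P \<and> x \<in> G" P "\<lambda>G. nat (aff_dim G)"] x by auto
  have GP: "polytope G" using face_of_polytope_polytope[OF P G(1)] .
  have "x \<in> rel_interior G"
  proof (rule ccontr)
    assume "x \<notin> rel_interior G"
    then have "x \<in> rel_frontier G" using G(2) closure_subset by (auto simp: rel_frontier_def)
    then obtain F where F: "F facet_of G" "x \<in> F"
      using rel_frontier_of_polyhedron[OF polytope_imp_polyhedron[OF GP]] by auto
    have "F face_of P" using face_of_trans[OF facet_of_imp_face_of[OF F(1)] G(1)] .
    then have "nat (aff_dim G) \<le> nat (aff_dim F)" using min F(2) by blast
    moreover have "aff_dim F = aff_dim G - 1" "aff_dim F \<ge> 0"
      using F aff_dim_negative_iff[of F] by (auto simp: facet_of_def)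
    ultimately show False by linarith
  qed
  then show thesis using that G by blast
qed

lemma rel_interior_extend:
  fixes G :: "'a::euclidean_space set"
  assumes "convex G" "x \<in> rel_interior G" "y \<in> G"
  obtains e where "e > 0" "\<And>d. 0 < d \<Longrightarrow> d \<le> e \<Longrightarrow> x + d *\<^sub>R (x - y) \<in> G"
proof -
  have "y \<in> affine hull G" using assms hull_inc by metis
  then obtain m where m: "m > 1" "\<And>e. e > 1 \<and> e \<le> m \<Longrightarrow> (1 - e) *\<^sub>R y + e *\<^sub>R x \<in> G"
    using convex_rel_interior_if[OF assms(1,2)] by meson
  show thesis
  proof (rule that[of "m - 1"])
    fix d assume "0 < d" "d \<le> m - 1"
    then have "(1 - (1 + d)) *\<^sub>R y + (1 + d) *\<^sub>R x \<in> G" by (intro m(2)) auto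
    then show "x + d *\<^sub>R (x - y) \<in> G" by (simp add: algebra_simps)
  qed (use m in simp)
qed

lemma face_of_extend:
  assumes K: "K face_of S" and x: "x \<in> K" and y: "y \<in> S" and z: "x + d *\<^sub>R (x - y) \<in> S" and d: "d > 0"
  shows "y \<in> K"
proof (cases "x = y")
  case False
  have "x \<in> open_segment y (x + d *\<^sub>R (x - y))"
    unfolding in_segment
  proof (intro conjI exI[of _ "1 / (1 + d)"])
    show "y \<noteq> x + d *\<^sub>R (x - y)"
    proof
      assume "y = x + d *\<^sub>R (x - y)"
      then have "(1 + d) *\<^sub>R (x - y) = 0" by (simp add: algebra_simps)
      then show False using d False by auto
    qed
    define u where "u = 1 / (1 + d)"
    have u: "1 - u = d * u" "u * (1 + d) = 1" using d by (simp_all add: u_def field_simps)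
    have "(d * u) *\<^sub>R y + u *\<^sub>R (x + d *\<^sub>R (x - y)) = (u * (1 + d)) *\<^sub>R x"
      by (simp add: algebra_simps)
    then show "x = (1 - 1 / (1 + d)) *\<^sub>R y + (1 / (1 + d)) *\<^sub>R (x + d *\<^sub>R (x - y))"
      unfolding u_def[symmetric] u(1) u(2) by simp
  qed (use d in auto)
  then show ?thesis using face_ofD[OF K _ y z x] by blast
qed (use x in simp)

lemma rel_interior_meets_open:
  fixes G :: "'a::euclidean_space set"
  assumes "convex G" "open U" "G \<inter> U \<noteq> {}"
  shows "rel_interior G \<inter> U \<noteq> {}"
proof -
  have "G \<subseteq> closure (rel_interior G)" using convex_closure_rel_interior[OF assms(1)] closure_subset by metis
  then show ?thesis using open_Int_closure_eq_empty[OF assms(2), of "rel_interior G"] assms(3) by blast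
qed

lemma polytope_hull_vertices: "polytope P \<Longrightarrow> P = convex hull vertices P"
  unfolding vertices_def using Krein_Milman_Minkowski polytope_imp_compact polytope_imp_convex by blast

text \<open>For every \<open>i\<close> the point \<open>c i\<close> is where the edge from
  \<open>v\<close> to \<open>nb i\<close> meets the hyperplane. The indices 0 and 1 belong to the
  edges cut in their interior, 2 and 3 to those whose far end lies on the hyperplane.\<close>

locale truncation =
  fixes P :: "'a::euclidean_space set" and v a :: 'a and b :: real and nb c :: "nat \<Rightarrow> 'a"
  assumes P: "polytope P" and P4: "aff_dim P = 4" and v: "v \<in> vertices P"
    and nb: "neighbours P v = nb ` {0, 1, 2, 3}"
    and c_nb: "\<And>i. i \<in> {0, 1} \<Longrightarrow> c i \<in> open_segment v (nb i)"
    and c_eq: "\<And>i. i \<in> {2, 3} \<Longrightarrow> c i = nb i"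
    and nb_inj: "inj_on nb {0, 1, 2, 3}"
    and c_H: "\<And>i. i \<in> {0, 1, 2, 3} \<Longrightarrow> a \<bullet> c i = b"
    and pos: "\<And>w. w \<in> vertices P \<Longrightarrow> w \<notin> {v, nb 2, nb 3} \<Longrightarrow> a \<bullet> w > b"
begin

definition "J = {0, 1, 2, 3 :: nat}"
definition "H = {x. a \<bullet> x = b}"
definition "Hpos = {x. a \<bullet> x > b}"
definition "Hcl = {x. a \<bullet> x \<ge> b}"
definition "\<kappa> G = G \<inter> Hcl"
definition "T = \<kappa> P"

lemma convex_H: "convex H" "convex Hcl" "open Hpos" "affine H"
  by (auto simp: H_def Hcl_def Hpos_def convex_hyperplane convex_halfspace_ge open_halfspace_gt affine_hyperplane)

lemma convP: "convex P"
  using P polytope_imp_convex by blast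

lemma P_face: "P face_of P"
  using convP by (simp add: face_of_refl)

lemma face_convex: "G face_of P \<Longrightarrow> convex G"
  by (rule face_of_imp_convex)

lemma face_polytope: "G face_of P \<Longrightarrow> polytope G"
  by (rule face_of_polytope_polytope[OF P])

lemma vertices_P: "w \<in> vertices P \<Longrightarrow> w \<in> P"
  by (simp add: vertices_def extreme_point_of_def)

lemma nb_edge: assumes "i \<in> J" shows "closed_segment v (nb i) face_of P"
  "aff_dim (closed_segment v (nb i)) = 1" "nb i \<in> vertices P" "nb i \<noteq> v"
proof -
  have "nb i \<in> neighbours P v" using nb assms by (auto simp: J_def)
  then have "closed_segment v (nb i) edge_of P" by (simp add: neighbours_def)
  then show f: "closed_segment v (nb i) face_of P" "aff_dim (closed_segment v (nb i)) = 1"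
    by (auto simp: edge_of_def)
  then show "nb i \<noteq> v" by auto
  show "nb i \<in> vertices P"
    using extreme_point_of_face[OF f(1), of "nb i"] extreme_point_of_segment[of "nb i" v "nb i"]
    by (simp add: vertices_def)
qed

lemma nb_pos: assumes "i \<in> {0, 1}" shows "a \<bullet> nb i > b"
proof (rule pos)
  show "nb i \<in> vertices P" using nb_edge(3)[of i] assms by (auto simp: J_def)
  have "nb i \<noteq> v" using nb_edge(4)[of i] assms by (auto simp: J_def)
  moreover have "nb i \<noteq> nb 2" "nb i \<noteq> nb 3"
    using inj_onD[OF nb_inj, of i 2] inj_onD[OF nb_inj, of i 3] assms by auto
  ultimately show "nb i \<notin> {v, nb 2, nb 3}" by simp
qed

lemma v_neg: "a \<bullet> v < b"
proof -
  obtain u where u: "0 < u" "u < 1" "c 0 = (1 - u) *\<^sub>R v + u *\<^sub>R nb 0"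
    using c_nb[of 0] by (auto simp: in_segment)
  have "(1 - u) * (a \<bullet> v) + u * (a \<bullet> nb 0) = b" using c_H[of 0] u by (simp add: inner_add_right)
  then have "(1 - u) * (a \<bullet> v - b) + u * (a \<bullet> nb 0 - b) = 0" by (simp add: algebra_simps)
  moreover have "u * (a \<bullet> nb 0 - b) > 0" using u nb_pos[of 0] by simp
  ultimately have "(1 - u) * (a \<bullet> v - b) < 0" by linarith
  then show ?thesis using u by (simp add: mult_less_0_iff)
qed

section \<open>The vertex figure at \<open>v\<close> and the faces through \<open>v\<close>\<close>

lemma vertex_nonneg: "w \<in> vertices P \<Longrightarrow> w \<noteq> v \<Longrightarrow> a \<bullet> w \<ge> b"
  using pos[of w] c_H[of 2] c_H[of 3] c_eq[of 2] c_eq[of 3] by fastforce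

text \<open>All other vertices of \<open>G\<close> lie on the hyperplane or beyond it. A point of
  \<open>G\<close> is thus on a ray from \<open>v\<close> through a convex combination
  \<open>y\<close> of them, and the ray crosses the hyperplane inside \<open>G\<close>.\<close>

lemma ray:
  assumes G: "G face_of P" "v \<in> G" and g: "g \<in> G" "g \<noteq> v"
  obtains h s where "h \<in> G" "h \<in> H" "s > 0" "g = v + s *\<^sub>R (h - v)"
proof -
  have hit: "\<exists>h r. h \<in> G \<and> h \<in> H \<and> r > 0 \<and> h = v + r *\<^sub>R (y - v)" if y: "y \<in> G" "a \<bullet> y \<ge> b" for y
  proof -
    let ?r = "(b - a \<bullet> v) / (a \<bullet> y - a \<bullet> v)"
    have r: "0 < ?r" "?r \<le> 1" using y v_neg by auto
    have "v + ?r *\<^sub>R (y - v) = (1 - ?r) *\<^sub>R v + ?r *\<^sub>R y" by (simp add: algebra_simps)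
    also have "\<dots> \<in> G" using face_convex[OF G(1)] G(2) y(1) r by (intro convexD_alt) auto
    finally have 1: "v + ?r *\<^sub>R (y - v) \<in> G" .
    have "?r * (a \<bullet> y - a \<bullet> v) = b - a \<bullet> v" using y v_neg by simp
    then have "v + ?r *\<^sub>R (y - v) \<in> H" by (simp add: H_def inner_add_right inner_diff_right)
    then show ?thesis using 1 r by blast
  qed
  obtain y r where y: "y \<in> G" "a \<bullet> y \<ge> b" "r > 0" "g = v + r *\<^sub>R (y - v)"
  proof -
    let ?W = "vertices G - {v}"
    have VG: "vertices G = vertices P \<inter> G" by (rule vertices_face[OF G(1)])
    have hull: "G = convex hull (insert v ?W)"
      using polytope_hull_vertices[OF face_polytope[OF G(1)]] v G(2) VG by (simp add: insert_absorb)
    have "?W \<noteq> {}"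
    proof
      assume W: "?W = {}"
      have "G = convex hull (insert v {})" using hull unfolding W .
      then show False using g by simp
    qed
    have "g \<in> convex hull (insert v ?W)" using g(1) hull by blast
    then obtain u w y where uw: "u \<ge> 0" "w \<ge> 0" "u + w = 1" "y \<in> convex hull ?W" "g = u *\<^sub>R v + w *\<^sub>R y"
      unfolding convex_hull_insert[OF \<open>?W \<noteq> {}\<close>] by blast
    have "?W \<subseteq> {x. a \<bullet> x \<ge> b}" using VG vertex_nonneg by auto
    then have "convex hull ?W \<subseteq> {x. a \<bullet> x \<ge> b}" by (simp add: convex_halfspace_ge hull_minimal)
    then have y2: "a \<bullet> y \<ge> b" using uw by blast
    have "convex hull ?W \<subseteq> G" using hull hull_mono[of ?W "insert v ?W" convex] by blast
    then have y1: "y \<in> G" using uw by blast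
    have gy: "g = v + w *\<^sub>R (y - v)"
    proof -
      have u: "u = 1 - w" using uw by simp
      show ?thesis unfolding uw(5) u by (simp add: algebra_simps)
    qed
    then have "w \<noteq> 0" using g by auto
    then show thesis using that[of y w] y1 y2 gy uw by simp
  qed
  obtain h r' where h: "h \<in> G" "h \<in> H" "r' > 0" "h = v + r' *\<^sub>R (y - v)" using hit y by blast
  have "g = v + (r / r') *\<^sub>R (h - v)" using h y by simp
  then show thesis using that[of h "r / r'"] h y by simp
qed

lemma open_seg_c: assumes "G face_of P" "i \<in> J" "c i \<in> G" "i \<in> {0, 1} \<or> v \<in> G"
  shows "v \<in> G" "nb i \<in> G"
proof -
  have "v \<in> G \<and> nb i \<in> G"
  proof (cases "i \<in> {0, 1}")
    case True
    then show ?thesis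
      using face_ofD[OF assms(1) c_nb[OF True] vertices_P[OF v] vertices_P[OF nb_edge(3)[OF assms(2)]] assms(3)] by blast
  next
    case False
    then show ?thesis using assms c_eq[of i] by (auto simp: J_def)
  qed
  then show "v \<in> G" "nb i \<in> G" by auto
qed

lemma c_closed: "i \<in> J \<Longrightarrow> c i \<in> closed_segment v (nb i)"
  using c_nb[of i] c_eq[of i] open_closed_segment by (fastforce simp: J_def)

lemma c_in: assumes "convex G" "v \<in> G" "nb i \<in> G" "i \<in> J" shows "c i \<in> G"
  using c_closed[OF assms(4)] closed_segment_subset[OF assms(2,3,1)] by blast

lemma c_P: "i \<in> J \<Longrightarrow> c i \<in> P"
  using c_in[OF convP vertices_P[OF v] vertices_P[OF nb_edge(3)]] by blast

text \<open>Near the relative interior point \<open>x\<close> the set \<open>G\<close> fills its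
  affine hull, so the hyperplane meets the hull in a point; a hyperplane section lowers the
  dimension by at most 1.\<close>

lemma Int_H_singleton:
  assumes "convex G" "x \<in> rel_interior G" "G \<inter> H = {x}"
  shows "aff_dim G \<le> 1"
proof -
  have xG: "x \<in> G" "x \<in> H" using assms by auto
  obtain e where e: "e > 0" "ball x e \<inter> affine hull G \<subseteq> G"
    using assms(2) by (auto simp: mem_rel_interior_ball)
  let ?C = "affine hull G \<inter> H"
  have xC: "x \<in> ?C" using xG hull_inc by auto
  have "aff_dim (?C \<inter> ball x e) = aff_dim ?C"
    using xC e(1) by (intro aff_dim_convex_Int_open) (auto intro!: convex_Int convex_H simp: affine_imp_convex)
  moreover have "?C \<inter> ball x e \<subseteq> {x}" using e(2) assms(3) by auto
  then have "aff_dim (?C \<inter> ball x e) \<le> aff_dim {x}" by (rule aff_dim_subset)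
  ultimately have "aff_dim ?C \<le> 0" by simp
  moreover have "aff_dim ?C \<ge> aff_dim G - 1"
    using aff_dim_affine_Int_hyperplane[of "affine hull G" a b] xC by (auto simp: H_def split: if_splits)
  ultimately show ?thesis by linarith
qed

text \<open>The least face of \<open>P\<close> around an extreme point of the section meets the
  hyperplane in that point only, hence is a vertex or an edge. An edge that avoids \<open>v\<close>
  has both ends on the nonnegative side and would lie in the hyperplane entirely.\<close>

lemma section_extreme:
  assumes x: "x extreme_point_of (P \<inter> H)"
  shows "x \<in> c ` J"
proof -
  have xPH: "x \<in> P" "x \<in> H" using x by (auto simp: extreme_point_of_def)
  obtain G where G: "G face_of P" "x \<in> rel_interior G" using minimal_face[OF P xPH(1)] by blast
  have cG: "convex G" using face_convex[OF G(1)] .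
  have xG: "x \<in> G" using G rel_interior_subset by blast
  have "G \<inter> H \<subseteq> {x}"
  proof
    fix y assume y: "y \<in> G \<inter> H"
    obtain e where e: "e > 0" "\<And>d. 0 < d \<Longrightarrow> d \<le> e \<Longrightarrow> x + d *\<^sub>R (x - y) \<in> G"
      using rel_interior_extend[OF cG G(2)] y by blast
    have "x + e *\<^sub>R (x - y) \<in> G" using e by simp
    moreover have "x + e *\<^sub>R (x - y) \<in> H"
      using xPH y by (simp add: H_def inner_add_right inner_diff_right)
    ultimately have "x + e *\<^sub>R (x - y) \<in> P \<inter> H" using face_of_imp_subset[OF G(1)] by blast
    moreover have "{x} face_of (P \<inter> H)" using x by (simp add: face_of_singleton)
    moreover have "y \<in> P \<inter> H" using y face_of_imp_subset[OF G(1)] by blast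
    ultimately show "y \<in> {x}" using face_of_extend[of "{x}" "P \<inter> H" x y e] e(1) by blast
  qed
  then have GH: "G \<inter> H = {x}" using xG xPH by blast
  then have d1: "aff_dim G \<le> 1" using Int_H_singleton[OF cG G(2)] by blast
  have d0: "aff_dim G \<ge> 0" using xG(1) aff_dim_negative_iff[of G] by (metis empty_iff not_le)
  consider "aff_dim G = 0" | "aff_dim G = 1" using d0 d1 by linarith
  then show ?thesis
  proof cases
    case 1
    then obtain z where "G = {z}" using aff_dim_eq_0 by blast
    then have "G = {x}" using xG by simp
    then have "x \<in> vertices P" using G(1) vertex_face by blast
    then have "x \<in> {v, nb 2, nb 3}" using pos[of x] xPH(2) by (fastforce simp: H_def)
    moreover have "x \<noteq> v" using v_neg xPH(2) by (auto simp: H_def)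
    ultimately have "x = c 2 \<or> x = c 3" using c_eq[of 2] c_eq[of 3] by auto
    then show ?thesis by (auto simp: J_def)
  next
    case 2
    have "G = convex hull vertices G" using polytope_hull_vertices[OF face_polytope[OF G(1)]] .
    then obtain p where p: "p \<in> vertices G" using xG by fastforce
    have VG: "vertices G = vertices P \<inter> G" by (rule vertices_face[OF G(1)])
    obtain q where q: "q \<in> vertices P" "q \<noteq> p" "G = closed_segment p q"
      using edge_segment(1)[OF P G(1) 2, of p] p VG by blast
    have vG: "v \<in> G"
    proof (rule ccontr)
      assume "v \<notin> G"
      then have pq: "a \<bullet> p \<ge> b" "a \<bullet> q \<ge> b" using p q VG vertex_nonneg by auto
      have "x \<in> open_segment p q" using G(2) q by (simp add: rel_interior_closed_segment)
      then obtain u where u: "0 < u" "u < 1" "x = (1 - u) *\<^sub>R p + u *\<^sub>R q" by (auto simp: in_segment)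
      have "(1 - u) * (a \<bullet> p) + u * (a \<bullet> q) = b" using xPH(2) u by (simp add: H_def inner_add_right)
      then have "(1 - u) * (a \<bullet> p - b) + u * (a \<bullet> q - b) = 0" by (simp add: algebra_simps)
      moreover have "(1 - u) * (a \<bullet> p - b) \<ge> 0" "u * (a \<bullet> q - b) \<ge> 0" using u pq by auto
      ultimately have "(1 - u) * (a \<bullet> p - b) = 0" "u * (a \<bullet> q - b) = 0" by linarith+
      then have "a \<bullet> p = b" "a \<bullet> q = b" using u by auto
      then have "p \<in> G \<inter> H" "q \<in> G \<inter> H" using q(3) by (auto simp: H_def)
      then show False using GH q(2) by auto
    qed
    obtain r where r: "r \<in> vertices P" "r \<noteq> v" "G = closed_segment v r"
      using edge_segment(1)[OF P G(1) 2 v vG] by blast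
    have "closed_segment v r edge_of P" using r G 2 by (simp add: edge_of_def)
    then obtain i where i: "i \<in> J" "r = nb i" using nb by (auto simp: neighbours_def J_def)
    have "c i \<in> G \<inter> H" using c_closed[OF i(1)] r(3) i c_H[of i] by (auto simp: H_def J_def)
    then show ?thesis using GH i by auto
  qed
qed

lemma section_hull: "P \<inter> H = convex hull (c ` J)"
proof
  have "compact (P \<inter> H)"
    using polytope_imp_compact[OF P] by (auto simp: H_def intro!: compact_Int_closed closed_hyperplane)
  moreover have "convex (P \<inter> H)" using convP convex_H by (simp add: convex_Int)
  ultimately have "P \<inter> H = convex hull {x. x extreme_point_of (P \<inter> H)}"
    using Krein_Milman_Minkowski by blast
  also have "\<dots> \<subseteq> convex hull (c ` J)" using section_extreme by (intro hull_mono) blast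
  finally show "P \<inter> H \<subseteq> convex hull (c ` J)" .
  show "convex hull (c ` J) \<subseteq> P \<inter> H"
    by (rule hull_minimal) (use c_P c_H convex_H convP in \<open>auto simp: H_def J_def intro: convex_Int\<close>)
qed

lemma cone_aff_dim:
  assumes G: "G face_of P" "v \<in> G"
  shows "aff_dim G = aff_dim (G \<inter> H) + 1"
proof -
  have "G \<subseteq> affine hull (insert v (G \<inter> H))"
  proof
    fix g assume g: "g \<in> G"
    show "g \<in> affine hull (insert v (G \<inter> H))"
    proof (cases "g = v")
      case True
      then show ?thesis by (simp add: hull_inc)
    next
      case False
      obtain h s where h: "h \<in> G" "h \<in> H" "s > 0" "g = v + s *\<^sub>R (h - v)"
        using ray[OF G g False] by blast
      have "v \<in> affine hull (insert v (G \<inter> H))" "h \<in> affine hull (insert v (G \<inter> H))"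
        using h by (auto intro: hull_inc)
      then have "(1 - s) *\<^sub>R v + s *\<^sub>R h \<in> affine hull (insert v (G \<inter> H))"
        by (intro mem_affine) (auto simp: affine_affine_hull)
      moreover have "(1 - s) *\<^sub>R v + s *\<^sub>R h = g" by (simp add: h(4) algebra_simps)
      ultimately show ?thesis by simp
    qed
  qed
  then have "aff_dim G \<le> aff_dim (insert v (G \<inter> H))"
    by (metis aff_dim_affine_hull aff_dim_subset)
  moreover have "aff_dim (insert v (G \<inter> H)) \<le> aff_dim G"
    by (rule aff_dim_subset) (use G in auto)
  moreover have "v \<notin> affine hull (G \<inter> H)"
  proof -
    have "affine hull (G \<inter> H) \<subseteq> H" by (rule hull_minimal) (use convex_H in auto)
    then show ?thesis using v_neg by (auto simp: H_def)
  qed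
  ultimately show ?thesis by (simp add: aff_dim_insert)
qed

text \<open>Simplicity of \<open>v\<close> enters here: the section is 3-dimensional and spanned by
  four points, so it is a simplex.\<close>

lemma c_independent: "\<not> affine_dependent (c ` J)" "inj_on c J"
proof -
  have "aff_dim (P \<inter> H) = 3" using cone_aff_dim[OF P_face vertices_P[OF v]] P4 by simp
  then have d: "aff_dim (c ` J) = 3" using section_hull by (simp add: aff_dim_convex_hull)
  have "finite (c ` J)" "card J = 4" by (auto simp: J_def)
  moreover have "card (c ` J) \<le> card J" by (rule card_image_le) (simp add: J_def)
  moreover have "aff_dim (c ` J) \<le> int (card (c ` J)) - 1" using aff_dim_le_card[of "c ` J"] calculation(1) by blast
  ultimately have card: "card (c ` J) = 4" using d by linarith
  then show "\<not> affine_dependent (c ` J)" using d \<open>finite _\<close> by (simp add: affine_independent_iff_card)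
  have "finite J" "card J = 4" by (auto simp: J_def)
  then show "inj_on c J" using card eq_card_imp_inj_on[of J c] by simp
qed

definition "\<sigma> M = convex hull (c ` M)"

lemma sigma_H: "M \<subseteq> J \<Longrightarrow> \<sigma> M \<subseteq> P \<inter> H"
  unfolding section_hull \<sigma>_def by (intro hull_mono image_mono)

lemma sigma_mem: assumes "M \<subseteq> J" "i \<in> J" shows "c i \<in> \<sigma> M \<longleftrightarrow> i \<in> M"
proof
  assume "c i \<in> \<sigma> M"
  show "i \<in> M"
  proof (rule ccontr)
    assume "i \<notin> M"
    then have "c ` M \<subseteq> c ` J - {c i}" using assms c_independent(2) by (auto dest: inj_onD)
    then have "c i \<in> convex hull (c ` J - {c i})" using \<open>c i \<in> \<sigma> M\<close> hull_mono unfolding \<sigma>_def by blast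
    then have "c i \<in> affine hull (c ` J - {c i})" using convex_hull_subset_affine_hull by blast
    then show False using c_independent(1) assms(2) by (auto simp: affine_dependent_def)
  qed
qed (simp add: \<sigma>_def hull_inc)

lemma sigma_subset: assumes "M \<subseteq> J" "N \<subseteq> J" shows "\<sigma> M \<subseteq> \<sigma> N \<longleftrightarrow> M \<subseteq> N"
proof
  assume "\<sigma> M \<subseteq> \<sigma> N"
  then show "M \<subseteq> N" using sigma_mem[OF assms(1)] sigma_mem[OF assms(2)] assms by blast
qed (simp add: \<sigma>_def hull_mono image_mono)

lemma sigma_dim: assumes "M \<subseteq> J" shows "aff_dim (\<sigma> M) = int (card M) - 1"
proof -
  have "\<not> affine_dependent (c ` M)" using c_independent(1) assms affine_independent_subset image_mono by metis
  moreover have "card (c ` M) = card M" using c_independent(2) assms by (meson card_image inj_on_subset)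
  ultimately show ?thesis
    using aff_dim_affine_independent[of "c ` M"] by (simp add: \<sigma>_def aff_dim_convex_hull)
qed

lemma section_face: "K face_of (P \<inter> H) \<longleftrightarrow> (\<exists>M\<subseteq>J. K = \<sigma> M)"
proof -
  have "K face_of (P \<inter> H) \<longleftrightarrow> (\<exists>C\<subseteq>c ` J. K = convex hull C)"
    unfolding section_hull by (rule face_of_convex_hull_affine_independent[OF c_independent(1)])
  also have "\<dots> \<longleftrightarrow> (\<exists>M\<subseteq>J. K = \<sigma> M)" unfolding \<sigma>_def by (metis subset_image_iff)
  finally show ?thesis .
qed

text \<open>Over a face of the section \<open>P \<inter> H\<close>, the supporting hyperplane of the section is tilted about
  its intersection with \<open>H\<close> until it passes through \<open>v\<close>.\<close>

lemma exists_cone_face: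
  assumes M: "M \<subseteq> J"
  shows "\<exists>G. G face_of P \<and> v \<in> G \<and> G \<inter> H = \<sigma> M"
proof -
  have "polytope (P \<inter> H)" unfolding section_hull by (simp add: polytope_convex_hull J_def)
  moreover have "\<sigma> M face_of (P \<inter> H)" using section_face M by blast
  ultimately have "\<sigma> M exposed_face_of (P \<inter> H)"
    using exposed_face_of_polyhedron polytope_imp_polyhedron by blast
  then obtain p q where pq: "P \<inter> H \<subseteq> {x. p \<bullet> x \<le> q}" "\<sigma> M = (P \<inter> H) \<inter> {x. p \<bullet> x = q}"
    unfolding exposed_face_of_def by blast
  \<comment> \<open>\<open>l\<close> is chosen such that the tilted functional \<open>p'\<close>
    attains its level \<open>q'\<close> at \<open>v\<close>; on the hyperplane the tilt changes
    functional and level by the same amount.\<close>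
  define l where "l = (p \<bullet> v - q) / (a \<bullet> v - b)"
  define p' where "p' = p - l *\<^sub>R a"
  define q' where "q' = q - l * b"
  have pv: "p' \<bullet> v = q'"
  proof -
    have "l * (a \<bullet> v - b) = p \<bullet> v - q" using v_neg by (simp add: l_def)
    then show ?thesis by (simp add: p'_def q'_def inner_diff_left algebra_simps)
  qed
  have pH: "p' \<bullet> x - q' = p \<bullet> x - q" if "x \<in> H" for x
    using that by (simp add: p'_def q'_def H_def inner_diff_left)
  have le: "p' \<bullet> g \<le> q'" if g: "g \<in> P" for g
  proof (cases "g = v")
    case False
    obtain h s where h: "h \<in> P" "h \<in> H" "s > 0" "g = v + s *\<^sub>R (h - v)"
      using ray[OF P_face vertices_P[OF v] g False] by blast
    have "p' \<bullet> h \<le> q'" using pH[OF h(2)] pq(1) h by auto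
    then have "s * (p' \<bullet> h - q') \<le> 0" using h(3) by (simp add: mult_le_0_iff)
    moreover have "p' \<bullet> g = q' + s * (p' \<bullet> h - q')" using h(4) pv by (simp add: inner_add_right inner_diff_right)
    ultimately show ?thesis by simp
  qed (use pv in simp)
  have "P \<inter> {x. p' \<bullet> x = q'} face_of P" by (rule face_of_Int_supporting_hyperplane_le[OF convP le])
  moreover have "P \<inter> {x. p' \<bullet> x = q'} \<inter> H = \<sigma> M" unfolding pq(2) using pH by force
  ultimately show ?thesis using pv vertices_P[OF v] by blast
qed

text \<open>The choice is unique by \<open>cone_subset\<close>, and with \<open>Phi_surj\<close> the
  faces through \<open>v\<close> form the Boolean lattice of the subsets of
  \<open>J\<close>.\<close>

definition "\<Phi> M = (SOME G. G face_of P \<and> v \<in> G \<and> G \<inter> H = \<sigma> M)"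

lemma Phi: assumes "M \<subseteq> J" shows "\<Phi> M face_of P" "v \<in> \<Phi> M" "\<Phi> M \<inter> H = \<sigma> M"
  using someI_ex[OF exists_cone_face[OF assms]] unfolding \<Phi>_def by auto

text \<open>Faces through \<open>v\<close> are cones over their sections. Points up to the section
  are reached by convexity; for a point beyond it the section point lies inside the segment from
  \<open>v\<close>, so the face property applies.\<close>

lemma cone_subset:
  assumes G: "G face_of P" "v \<in> G" and G': "G' face_of P" "v \<in> G'"
  shows "G \<subseteq> G' \<longleftrightarrow> G \<inter> H \<subseteq> G' \<inter> H"
proof
  assume sub: "G \<inter> H \<subseteq> G' \<inter> H"
  show "G \<subseteq> G'"
  proof
    fix g assume g: "g \<in> G"
    show "g \<in> G'"
    proof (cases "g = v")
      case False
      obtain h s where h: "h \<in> G" "h \<in> H" "s > 0" "g = v + s *\<^sub>R (h - v)"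
        using ray[OF G g False] by blast
      then have hG': "h \<in> G'" using sub by blast
      have hv: "h \<noteq> v" using h(2) v_neg by (auto simp: H_def)
      show ?thesis
      proof (cases "s \<le> 1")
        case True
        have "g = (1 - s) *\<^sub>R v + s *\<^sub>R h" using h(4) by (simp add: algebra_simps)
        also have "\<dots> \<in> G'" using face_convex[OF G'(1)] G'(2) hG' h(3) True by (intro convexD_alt) auto
        finally show ?thesis .
      next
        case False
        have "h \<in> open_segment v g" unfolding in_segment
        proof (intro conjI exI[of _ "1 / s"])
          show "v \<noteq> g" using \<open>g \<noteq> v\<close> by simp
          have "(1 / s) *\<^sub>R g = (1 / s) *\<^sub>R v + (h - v)" using h(3) by (simp add: h(4) scaleR_add_right)
          then show "h = (1 - 1 / s) *\<^sub>R v + (1 / s) *\<^sub>R g" by (simp add: algebra_simps)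
        qed (use False in auto)
        then show ?thesis
          using face_ofD[OF G'(1) _ vertices_P[OF v] _ hG'] g face_of_imp_subset[OF G(1)] by blast
      qed
    qed (use G' in simp)
  qed
qed blast

lemma Phi_subset: assumes "M \<subseteq> J" "N \<subseteq> J" shows "\<Phi> M \<subseteq> \<Phi> N \<longleftrightarrow> M \<subseteq> N"
  using cone_subset[OF Phi(1,2)[OF assms(1)] Phi(1,2)[OF assms(2)]] Phi(3)[OF assms(1)] Phi(3)[OF assms(2)]
    sigma_subset[OF assms] by simp

lemma Phi_eq: "M \<subseteq> J \<Longrightarrow> N \<subseteq> J \<Longrightarrow> \<Phi> M = \<Phi> N \<longleftrightarrow> M = N"
  using Phi_subset[of M N] Phi_subset[of N M] by blast

lemma Phi_dim: assumes "M \<subseteq> J" shows "aff_dim (\<Phi> M) = int (card M)"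
  using cone_aff_dim[OF Phi(1,2)[OF assms]] Phi(3)[OF assms] sigma_dim[OF assms] by simp

lemma Phi_surj:
  assumes G: "G face_of P" "v \<in> G"
  obtains M where "M \<subseteq> J" "G = \<Phi> M"
proof -
  have "G \<inter> H face_of (P \<inter> H)" using face_of_slice[OF G(1) convex_H(1)] .
  then obtain M where M: "M \<subseteq> J" "G \<inter> H = \<sigma> M" using section_face by blast
  have "G = \<Phi> M"
    using cone_subset[OF G Phi(1,2)[OF M(1)]] cone_subset[OF Phi(1,2)[OF M(1)] G] Phi(3)[OF M(1)] M(2) by auto
  then show thesis using that M by blast
qed

lemma Phi_c: assumes "M \<subseteq> J" "i \<in> J" shows "c i \<in> \<Phi> M \<longleftrightarrow> i \<in> M"
proof -
  have "c i \<in> H" using c_H assms(2) by (auto simp: H_def J_def)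
  then have "c i \<in> \<Phi> M \<longleftrightarrow> c i \<in> \<sigma> M" using Phi(3)[OF assms(1)] by blast
  then show ?thesis using sigma_mem[OF assms] by simp
qed

lemma Phi_nb: assumes "M \<subseteq> J" "i \<in> J" shows "nb i \<in> \<Phi> M \<longleftrightarrow> i \<in> M"
  using Phi_c[OF assms] c_in[OF face_convex[OF Phi(1)[OF assms(1)]] Phi(2)[OF assms(1)]]
    open_seg_c(2)[OF Phi(1)[OF assms(1)]] Phi(2)[OF assms(1)] assms by blast

lemma Phi_edge: assumes "i \<in> J" shows "\<Phi> {i} = closed_segment v (nb i)"
proof -
  have s: "{i} \<subseteq> J" using assms by simp
  have "closed_segment v (nb i) \<subseteq> \<Phi> {i}"
    using closed_segment_subset[OF Phi(2)[OF s] _ face_convex[OF Phi(1)[OF s]]] Phi_nb[OF s assms] by blast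
  then show ?thesis
    using face_eqI_aff_dim[OF P nb_edge(1)[OF assms] Phi(1)[OF s]] nb_edge(2)[OF assms] Phi_dim[OF s] by simp
qed

section \<open>Faces of the truncated polytope\<close>

lemma Hcl_split: "Hcl = H \<union> Hpos"
  by (auto simp: Hcl_def H_def Hpos_def)

lemma kappa_face: "G face_of P \<Longrightarrow> \<kappa> G face_of T"
  unfolding \<kappa>_def T_def by (rule face_of_slice[OF _ convex_H(2)])

lemma T_polytope: "polytope T"
  unfolding T_def \<kappa>_def Hcl_def using polytope_Int_polyhedron[OF P polyhedron_halfspace_ge] .

lemma convT: "convex T"
  using T_polytope polytope_imp_convex by blast

lemma section_T: "P \<inter> H face_of T" "P \<inter> H = T \<inter> H"
proof -
  show eq: "P \<inter> H = T \<inter> H" by (auto simp: T_def \<kappa>_def Hcl_split)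
  show "P \<inter> H face_of T" unfolding eq unfolding H_def
    by (rule face_of_Int_supporting_hyperplane_ge[OF convT]) (auto simp: T_def \<kappa>_def Hcl_def)
qed

lemma sigma_face_T: "M \<subseteq> J \<Longrightarrow> \<sigma> M face_of T"
  using face_of_trans[OF _ section_T(1)] section_face by blast

lemma faceT_H: assumes "K face_of T" "K \<subseteq> H" obtains M where "M \<subseteq> J" "K = \<sigma> M"
proof -
  have "K \<subseteq> P \<inter> H" using assms face_of_imp_subset[OF assms(1)] section_T(2) by blast
  then have "K face_of P \<inter> H"
    using face_of_subset[OF assms(1)] face_of_imp_subset[OF section_T(1)] by blast
  then show thesis using section_face that by blast
qed

text \<open>Let \<open>G\<close> be the least face of \<open>P\<close> around a relative interior
  point \<open>x\<close> of \<open>K\<close>. As \<open>x\<close> is strictly on the positive side,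
  a segment from any point of \<open>\<kappa> G\<close> to \<open>x\<close> can be prolonged a
  little within \<open>T\<close>, and the face property pulls that point into
  \<open>K\<close>.\<close>

lemma faceT_pos:
  assumes K: "K face_of T" "\<not> K \<subseteq> H"
  obtains G where "G face_of P" "G \<inter> Hpos \<noteq> {}" "K = \<kappa> G"
proof -
  have cK: "convex K" using face_of_imp_convex[OF K(1)] .
  have "K \<noteq> {}" using K by blast
  then obtain x where x: "x \<in> rel_interior K" using rel_interior_eq_empty[OF cK] by blast
  have KT: "K \<subseteq> T" using face_of_imp_subset[OF K(1)] .
  have xK: "x \<in> K" using x rel_interior_subset by blast
  then have xP: "x \<in> P" using KT by (auto simp: T_def \<kappa>_def)
  have xpos: "a \<bullet> x > b"
  proof (rule ccontr)
    assume "\<not> a \<bullet> x > b"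
    then have "x \<in> P \<inter> H" using xK KT by (auto simp: T_def \<kappa>_def Hcl_def H_def)
    then have "K \<subseteq> P \<inter> H" using subset_of_face_of[OF section_T(1) KT] x by blast
    then show False using K(2) by blast
  qed
  obtain G where G: "G face_of P" "x \<in> rel_interior G" using minimal_face[OF P xP] by blast
  have xG: "x \<in> G" using G(2) rel_interior_subset by blast
  have "K \<subseteq> G" by (rule subset_of_face_of[OF G(1)]) (use KT x xG in \<open>auto simp: T_def \<kappa>_def\<close>)
  moreover have "\<kappa> G \<subseteq> K"
  proof
    fix y assume y: "y \<in> \<kappa> G"
    then have yG: "y \<in> G" by (simp add: \<kappa>_def)
    obtain e where e: "e > 0" "\<And>d. 0 < d \<Longrightarrow> d \<le> e \<Longrightarrow> x + d *\<^sub>R (x - y) \<in> G"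
      using rel_interior_extend[OF face_convex[OF G(1)] G(2) yG] by blast
    obtain d where d: "0 < d" "d \<le> e" "a \<bullet> (x + d *\<^sub>R (x - y)) \<ge> b"
    proof -
      \<comment> \<open>The prolongation is limited by \<open>e\<close> and by the slack
        \<open>a \<bullet> x - b\<close>; the added 1 keeps the denominator positive.\<close>
      define m where "m = \<bar>a \<bullet> (x - y)\<bar> + 1"
      define d where "d = min e ((a \<bullet> x - b) / m)"
      have m: "m > 0" by (simp add: m_def)
      have d0: "0 < d" "d \<le> e" using e xpos m by (auto simp: d_def)
      have "d * m \<le> a \<bullet> x - b" using m by (auto simp: d_def min_def field_simps)
      moreover have "d * (a \<bullet> (x - y)) \<ge> - (d * m)"
      proof -
        have "- m \<le> a \<bullet> (x - y)" by (simp add: m_def)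
        then have "d * (- m) \<le> d * (a \<bullet> (x - y))" using d0 by (intro mult_left_mono) auto
        then show ?thesis by simp
      qed
      ultimately have "a \<bullet> (x + d *\<^sub>R (x - y)) \<ge> b" by (simp add: inner_add_right)
      then show thesis using that d0 by blast
    qed
    have "x + d *\<^sub>R (x - y) \<in> T"
      using e(2)[OF d(1,2)] d(3) face_of_imp_subset[OF G(1)] by (auto simp: T_def \<kappa>_def Hcl_def)
    moreover have "y \<in> T" using y face_of_imp_subset[OF G(1)] by (auto simp: T_def \<kappa>_def)
    ultimately show "y \<in> K" using face_of_extend[OF K(1) xK] d(1) by blast
  qed
  ultimately have "K = \<kappa> G" using KT by (auto simp: T_def \<kappa>_def)
  moreover have "G \<inter> Hpos \<noteq> {}" using xG xpos by (auto simp: Hpos_def)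
  ultimately show thesis using that G by blast
qed

lemma kappa_not_H: "G \<inter> Hpos \<noteq> {} \<Longrightarrow> \<not> \<kappa> G \<subseteq> H"
  by (auto simp: \<kappa>_def Hcl_split H_def Hpos_def)

lemma kappa_dim: assumes "G face_of P" "G \<inter> Hpos \<noteq> {}" shows "aff_dim (\<kappa> G) = aff_dim G"
proof -
  have "aff_dim (G \<inter> Hpos) = aff_dim G"
    using aff_dim_convex_Int_open[OF face_convex[OF assms(1)] convex_H(3) assms(2)] .
  moreover have "aff_dim (G \<inter> Hpos) \<le> aff_dim (\<kappa> G)" "aff_dim (\<kappa> G) \<le> aff_dim G"
    by (rule aff_dim_subset; auto simp: \<kappa>_def Hcl_split)+
  ultimately show ?thesis by linarith
qed

lemma kappa_subset:
  assumes G: "G face_of P" "G \<inter> Hpos \<noteq> {}" and G': "G' face_of P"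
  shows "\<kappa> G \<subseteq> \<kappa> G' \<longleftrightarrow> G \<subseteq> G'"
proof
  assume s: "\<kappa> G \<subseteq> \<kappa> G'"
  obtain x where x: "x \<in> rel_interior G" "x \<in> Hpos"
    using rel_interior_meets_open[OF face_convex[OF G(1)] convex_H(3) G(2)] by blast
  then have "x \<in> G'" using s rel_interior_subset by (auto simp: \<kappa>_def Hcl_split)
  then show "G \<subseteq> G'" using subset_of_face_of[OF G' face_of_imp_subset[OF G(1)]] x by blast
qed (auto simp: \<kappa>_def)

lemma kappa_eq:
  "G face_of P \<Longrightarrow> G \<inter> Hpos \<noteq> {} \<Longrightarrow> G' face_of P \<Longrightarrow> G' \<inter> Hpos \<noteq> {} \<Longrightarrow> \<kappa> G = \<kappa> G' \<longleftrightarrow> G = G'"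
  using kappa_subset[of G G'] kappa_subset[of G' G] by blast

lemma P_pos: "P \<inter> Hpos \<noteq> {}"
  using nb_pos[of 0] vertices_P[OF nb_edge(3), of 0] by (auto simp: Hpos_def J_def)

lemma T_dim: "aff_dim T = 4"
  unfolding T_def using kappa_dim[OF P_face P_pos] P4 by simp

lemma pos_vertex: assumes "w \<in> vertices P" "w \<in> G" "w \<notin> {v, nb 2, nb 3}" shows "G \<inter> Hpos \<noteq> {}"
  using pos[OF assms(1,3)] assms(2) by (auto simp: Hpos_def)

lemma nopos_vertices: assumes "G face_of P" "G \<inter> Hpos = {}" shows "vertices G \<subseteq> {v, nb 2, nb 3}"
  using pos_vertex[of _ G] vertices_face[OF assms(1)] assms(2) by blast

lemma nopos_dim: assumes "G face_of P" "G \<inter> Hpos = {}"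
  shows "aff_dim G \<le> int (card (vertices G)) - 1" "aff_dim G \<le> 2"
proof -
  have fin: "finite (vertices G)" using finite_vertices[OF face_polytope[OF assms(1)]] .
  have "G = convex hull vertices G" using polytope_hull_vertices[OF face_polytope[OF assms(1)]] .
  then have "aff_dim G = aff_dim (vertices G)" by (metis aff_dim_convex_hull)
  then show 1: "aff_dim G \<le> int (card (vertices G)) - 1" using aff_dim_le_card[OF fin] by simp
  have "card (vertices G) \<le> card {v, nb 2, nb 3}"
    using nopos_vertices[OF assms] by (intro card_mono) auto
  also have "\<dots> \<le> 3" by (simp add: card_insert_if)
  finally show "aff_dim G \<le> 2" using 1 by linarith
qed

lemma face_subset_Hcl: assumes "G face_of P" "v \<notin> G" shows "G \<subseteq> Hcl" "\<kappa> G = G"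
proof -
  have "G = convex hull vertices G" using polytope_hull_vertices[OF face_polytope[OF assms(1)]] .
  also have "\<dots> \<subseteq> Hcl"
    by (rule hull_minimal)
      (use convex_H vertices_face[OF assms(1)] assms(2) vertex_nonneg in \<open>auto simp: Hcl_def\<close>)
  finally show "G \<subseteq> Hcl" .
  then show "\<kappa> G = G" by (auto simp: \<kappa>_def)
qed

lemma nb23: "nb 2 \<noteq> nb 3" "nb 2 \<noteq> v" "nb 3 \<noteq> v" "nb 2 \<in> vertices P" "nb 3 \<in> vertices P" "nb 2 \<in> H" "nb 3 \<in> H"
  using inj_onD[OF nb_inj, of 2 3] nb_edge(3,4)[of 2] nb_edge(3,4)[of 3] c_H[of 2] c_H[of 3] c_eq[of 2] c_eq[of 3]
  by (auto simp: J_def H_def)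

text \<open>\<open>F\<close> meets the 2-face \<open>\<Phi> {2, 3}\<close> in a face that misses
  \<open>v\<close> but contains two points, so this face is one-dimensional.\<close>

lemma edge_23:
  assumes F: "F face_of P" "v \<notin> F" "nb 2 \<in> F" "nb 3 \<in> F"
  shows "closed_segment (nb 2) (nb 3) face_of P"
proof -
  have sub: "{2, 3} \<subseteq> J" by (simp add: J_def)
  let ?K = "F \<inter> \<Phi> {2, 3}"
  have K: "?K face_of P" using face_of_Int[OF F(1) Phi(1)[OF sub]] .
  have n: "nb 2 \<in> ?K" "nb 3 \<in> ?K" using F Phi_nb[OF sub] sub by auto
  have "?K \<subset> \<Phi> {2, 3}" using Phi(2)[OF sub] F by blast
  then have "aff_dim ?K < 2" using aff_dim_face_less[OF P K Phi(1)[OF sub]] Phi_dim[OF sub] by simp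
  moreover have "aff_dim {nb 2, nb 3} \<le> aff_dim ?K" by (rule aff_dim_subset) (use n in auto)
  ultimately have "aff_dim ?K = 1" using nb23(1) by (simp add: aff_dim_2)
  then have "?K = closed_segment (nb 2) (nb 3)" using edge_segment(2)[OF P K _ nb23(4) n(1) nb23(5) n(2)] nb23(1) by auto
  then show ?thesis using K by simp
qed

lemma sigma_23: "\<sigma> {2, 3} = closed_segment (nb 2) (nb 3)"
  using c_eq[of 2] c_eq[of 3] by (simp add: \<sigma>_def segment_convex_hull)

text \<open>If the 2-face had a point beyond the hyperplane, the segment from \<open>v\<close> to
  that point would cross the edge, and the edge would have to contain \<open>v\<close>. This decides
  whether \<open>\<Phi> {2, 3}\<close> is a triangle that vanishes in \<open>T\<close>.\<close>

lemma Phi_23_pos: "closed_segment (nb 2) (nb 3) face_of P \<longleftrightarrow> \<Phi> {2, 3} \<inter> Hpos = {}"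
proof -
  have sub: "{2, 3} \<subseteq> J" by (simp add: J_def)
  note F = Phi[OF sub, unfolded sigma_23]
  show ?thesis
  proof
    assume e: "closed_segment (nb 2) (nb 3) face_of P"
    show "\<Phi> {2, 3} \<inter> Hpos = {}"
    proof (rule ccontr)
      assume "\<Phi> {2, 3} \<inter> Hpos \<noteq> {}"
      then obtain g where g: "g \<in> \<Phi> {2, 3}" "a \<bullet> g > b" by (auto simp: Hpos_def)
      define r where "r = (b - a \<bullet> v) / (a \<bullet> g - a \<bullet> v)"
      have r: "0 < r" "r < 1" using g v_neg by (auto simp: r_def)
      let ?h = "(1 - r) *\<^sub>R v + r *\<^sub>R g"
      have "v \<noteq> g" using g v_neg by auto
      then have o: "?h \<in> open_segment v g" using r by (auto simp: in_segment)
      have "r * (a \<bullet> g - a \<bullet> v) = b - a \<bullet> v" using g v_neg by (simp add: r_def)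
      moreover have "a \<bullet> ?h = a \<bullet> v + r * (a \<bullet> g - a \<bullet> v)" by (simp add: inner_add_right algebra_simps)
      ultimately have "a \<bullet> ?h = b" by simp
      moreover have "?h \<in> \<Phi> {2, 3}" using face_convex[OF F(1)] F(2) g r by (intro convexD_alt) auto
      ultimately have "?h \<in> closed_segment (nb 2) (nb 3)" using F(3) by (auto simp: H_def)
      then have "v \<in> closed_segment (nb 2) (nb 3)"
        using face_ofD[OF e o vertices_P[OF v]] g face_of_imp_subset[OF F(1)] by blast
      then have "v \<in> H" using F(3) by blast
      then show False using v_neg by (simp add: H_def)
    qed
  next
    assume "\<Phi> {2, 3} \<inter> Hpos = {}"
    then have "\<And>x. x \<in> \<Phi> {2, 3} \<Longrightarrow> a \<bullet> x \<le> b" by (force simp: Hpos_def)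
    then have "\<Phi> {2, 3} \<inter> H face_of \<Phi> {2, 3}"
      unfolding H_def by (rule face_of_Int_supporting_hyperplane_le[OF face_convex[OF F(1)]])
    then show "closed_segment (nb 2) (nb 3) face_of P" using face_of_trans[OF _ F(1)] F(3) by simp
  qed
qed

text \<open>A 2-face needs three vertices, and only \<open>v\<close>, \<open>nb 2\<close> and
  \<open>nb 3\<close> lie off the positive side.\<close>

lemma nopos_two_face:
  assumes s: "s face_of P" "aff_dim s = 2" "s \<inter> Hpos = {}"
  shows "s = \<Phi> {2, 3}"
proof -
  have sub: "{2, 3} \<subseteq> J" by (simp add: J_def)
  have "card (vertices s) \<ge> 3" using nopos_dim(1)[OF s(1,3)] s(2) by linarith
  moreover have "card {v, nb 2, nb 3} = 3" using nb23 by simp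
  ultimately have "vertices s = {v, nb 2, nb 3}" using nopos_vertices[OF s(1,3)] by (intro card_seteq) auto
  then have in_s: "v \<in> s" "nb 2 \<in> s" "nb 3 \<in> s" using vertices_face[OF s(1)] by auto
  obtain M where M: "M \<subseteq> J" "s = \<Phi> M" using Phi_surj[OF s(1) in_s(1)] by blast
  have "{2, 3} \<subseteq> M" using Phi_nb[OF M(1)] in_s M(2) sub by auto
  moreover have "card M = 2" using Phi_dim[OF M(1)] M(2) s(2) by simp
  moreover have "finite M" using M(1) finite_subset by (auto simp: J_def)
  ultimately have "M = {2, 3}" using card_seteq[of M "{2,3}"] by auto
  then show ?thesis using M by simp
qed

lemma vertices_T: "vertices T = vertices P - {v} \<union> {c 0, c 1}"
proof -
  have s: "c i \<in> vertices T" if "i \<in> J" for i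
    using sigma_face_T[of "{i}"] that vertex_face[of "c i" T] by (simp add: \<sigma>_def)
  show ?thesis
  proof (intro set_eqI iffI)
    fix w assume "w \<in> vertices T"
    then have w: "{w} face_of T" using vertex_face by blast
    show "w \<in> vertices P - {v} \<union> {c 0, c 1}"
    proof (cases "{w} \<subseteq> H")
      case True
      then obtain M where M: "M \<subseteq> J" "{w} = \<sigma> M" using faceT_H[OF w] by blast
      have "card M = 1" using sigma_dim[OF M(1)] unfolding M(2)[symmetric] by simp
      then obtain i where i: "M = {i}" using card_1_singletonE by blast
      then have "w = c i" "i \<in> J" using M by (auto simp: \<sigma>_def)
      then show ?thesis using c_eq[of i] nb_edge(3,4)[of i] by (auto simp: J_def)
    next
      case False
      obtain G where G: "G face_of P" "G \<inter> Hpos \<noteq> {}" "{w} = \<kappa> G" using faceT_pos[OF w False] by blast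
      have "aff_dim G = 0" using kappa_dim[OF G(1,2)] G(3) by (metis aff_dim_sing)
      then obtain z where "G = {z}" using aff_dim_eq_0 by blast
      moreover have "w \<in> G" using G(3) unfolding \<kappa>_def by blast
      ultimately have "G = {w}" by simp
      then have "w \<in> vertices P" "w \<noteq> v" using G v_neg vertex_face by (auto simp: Hpos_def)
      then show ?thesis by blast
    qed
  next
    fix w assume "w \<in> vertices P - {v} \<union> {c 0, c 1}"
    then consider "w \<in> vertices P" "w \<noteq> v" | "w = c 0" | "w = c 1" by blast
    then show "w \<in> vertices T"
    proof cases
      case 1
      then have f: "{w} face_of P" using vertex_face by blast
      then have "\<kappa> {w} = {w}" using face_subset_Hcl(2) 1 by blast
      then show ?thesis using kappa_face[OF f] vertex_face by metis
    qed (use s in \<open>auto simp: J_def\<close>)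
  qed
qed

end

section \<open>The links of the two neighbours of \<open>v\<close> on the hyperplane\<close>

locale truncation_link = truncation +
  fixes p q :: nat
  assumes pq: "p = 2 \<and> q = 3 \<or> p = 3 \<and> q = 2"
begin

text \<open>\<open>cut_link\<close> reserves the index 2 for the other neighbour of \<open>v\<close>
  in the hyperplane, which is \<open>nb q\<close>.\<close>

definition "dir i = (if i = 2 then q else i)"

lemma dir: assumes "i \<in> {0, 1, 2}" shows "dir i \<in> J" "dir i \<noteq> p" "J - {dir i} \<subseteq> J" "p \<in> J - {dir i}"
    "{p, dir i} \<subseteq> J" "card {p, dir i} = 2" "card (J - {dir i}) = 3"
  using pq assms by (auto simp: dir_def J_def)

lemma pJ: "p \<in> J" "q \<in> J" "p \<noteq> q" "{p} \<subseteq> J" "dir 2 = q" "finite J" "card J = 4"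
  using pq by (auto simp: J_def dir_def)

lemma dir_inj: "i \<in> {0, 1, 2} \<Longrightarrow> j \<in> {0, 1, 2} \<Longrightarrow> dir i = dir j \<longleftrightarrow> i = j"
  using pq by (auto simp: dir_def)

lemma dir_surj: "j \<in> J \<Longrightarrow> j \<noteq> p \<Longrightarrow> \<exists>i\<in>{0, 1, 2}. j = dir i"
  using pq by (auto simp: dir_def J_def)

lemma w: "nb p \<in> vertices P" "nb p \<in> H" "c p = nb p" "nb p \<in> Hcl" "nb p \<noteq> v"
  "nb q \<in> vertices P" "nb q \<in> H" "c q = nb q" "nb q \<noteq> v" "nb p \<noteq> nb q"
  using pq nb23 c_eq[of p] c_eq[of q] Hcl_split by auto

lemma two_dirs:
  assumes M: "M \<subseteq> J" "p \<in> M" "card M = 2" shows "\<exists>i\<in>{0, 1, 2}. M = {p, dir i}"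
proof -
  have "finite M" using M(1) pJ finite_subset by blast
  then have "card (M - {p}) = 1" using M by simp
  then obtain j where j: "M - {p} = {j}" using card_1_singletonE by blast
  then have "j \<in> J" "j \<noteq> p" "M = {p, j}" using M by auto
  then show ?thesis using dir_surj[of j] by blast
qed

lemma three_dirs:
  assumes M: "M \<subseteq> J" "p \<in> M" "card M = 3" shows "\<exists>i\<in>{0, 1, 2}. M = J - {dir i}"
proof -
  have "finite M" using M(1) pJ finite_subset by blast
  then have "card (J - M) = 1" using M pJ by (simp add: card_Diff_subset)
  then obtain j where j: "J - M = {j}" using card_1_singletonE by blast
  then have "j \<in> J" "j \<noteq> p" "M = J - {j}" using M by auto
  then show ?thesis using dir_surj[of j] by blast
qed

abbreviation "LinkP k \<equiv> faces_over P k {nb p}"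
abbreviation "LinkT k \<equiv> faces_over T k {nb p}"
abbreviation "V \<equiv> \<Phi> {p}"
abbreviation "t i \<equiv> \<sigma> {p, dir i}"
abbreviation "G i \<equiv> \<Phi> {p, dir i}"
abbreviation "D i \<equiv> \<sigma> (J - {dir i})"
abbreviation "X i \<equiv> \<Phi> (J - {dir i})"
abbreviation "PS' \<equiv> {s \<in> LinkP 2. s \<inter> Hpos \<noteq> {}}"

text \<open>The choice is backed by \<open>ridge_two_facets\<close>: the polygon \<open>G i\<close>
  has two edges at \<open>nb p\<close>, and \<open>V\<close> is one of them.\<close>

definition "x i = (SOME e. {K \<in> LinkP 1. K \<subseteq> G i} = {V, e} \<and> e \<noteq> V)"

lemma LinkP: "s \<in> LinkP k \<longleftrightarrow> s face_of P \<and> nb p \<in> s \<and> aff_dim s = k"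
  by (auto simp: faces_over_def)

lemma LinkT: "s \<in> LinkT k \<longleftrightarrow> s face_of T \<and> nb p \<in> s \<and> aff_dim s = k"
  by (auto simp: faces_over_def)

lemma Phi_LP: "M \<subseteq> J \<Longrightarrow> p \<in> M \<Longrightarrow> \<Phi> M \<in> LinkP (int (card M))"
  using Phi(1) Phi_nb[of M p] Phi_dim[of M] pJ by (simp add: LinkP)

lemma V_LP: "V \<in> LinkP 1"
  using Phi_LP[of "{p}"] pJ by simp

lemma G_LP: "i \<in> {0, 1, 2} \<Longrightarrow> G i \<in> LinkP 2"
  using Phi_LP[OF dir(5) insertI1, of i] by (simp only: dir(6)) simp

lemma X_LP: "i \<in> {0, 1, 2} \<Longrightarrow> X i \<in> LinkP 3"
  using Phi_LP[OF dir(3) dir(4), of i] by (simp only: dir(7)) simp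

lemma LP_v:
  assumes "s \<in> LinkP k" "v \<in> s" obtains M where "M \<subseteq> J" "p \<in> M" "int (card M) = k" "s = \<Phi> M"
proof -
  obtain M where M: "M \<subseteq> J" "s = \<Phi> M" using Phi_surj assms LinkP by blast
  then show thesis using that Phi_nb[OF M(1) pJ(1)] Phi_dim[OF M(1)] assms LinkP by auto
qed

lemma V_iff: "s \<in> LinkP k \<Longrightarrow> V \<subseteq> s \<longleftrightarrow> v \<in> s"
proof
  assume s: "s \<in> LinkP k" "v \<in> s"
  obtain M where "M \<subseteq> J" "p \<in> M" "s = \<Phi> M" by (rule LP_v[OF s])
  then show "V \<subseteq> s" using Phi_subset[of "{p}" M] pJ by simp
qed (use Phi(2)[OF pJ(4)] in blast)

lemma LP1_v: "e \<in> LinkP 1 \<Longrightarrow> v \<in> e \<Longrightarrow> e = V"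
proof -
  assume e: "e \<in> LinkP 1" "v \<in> e"
  obtain M where M: "M \<subseteq> J" "p \<in> M" "int (card M) = 1" "e = \<Phi> M" by (rule LP_v[OF e])
  then have "card M = 1" by simp
  then have "M = {p}" using M(2) by (metis card_1_singletonE singletonD)
  then show ?thesis using M by simp
qed

lemma LP2_v: "s \<in> LinkP 2 \<Longrightarrow> v \<in> s \<Longrightarrow> \<exists>i\<in>{0, 1, 2}. s = G i"
proof -
  assume s: "s \<in> LinkP 2" "v \<in> s"
  obtain M where M: "M \<subseteq> J" "p \<in> M" "int (card M) = 2" "s = \<Phi> M" by (rule LP_v[OF s])
  then have "card M = 2" by simp
  then show ?thesis using two_dirs[OF M(1,2)] M(4) by blast
qed

lemma LP3_v: "s \<in> LinkP 3 \<Longrightarrow> v \<in> s \<Longrightarrow> \<exists>i\<in>{0, 1, 2}. s = X i"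
proof -
  assume s: "s \<in> LinkP 3" "v \<in> s"
  obtain M where M: "M \<subseteq> J" "p \<in> M" "int (card M) = 3" "s = \<Phi> M" by (rule LP_v[OF s])
  then have "card M = 3" by simp
  then show ?thesis using three_dirs[OF M(1,2)] M(4) by blast
qed

lemma x_ex: assumes i: "i \<in> {0, 1, 2}" shows "\<exists>e. {K \<in> LinkP 1. K \<subseteq> G i} = {V, e} \<and> e \<noteq> V"
proof -
  have G: "G i face_of P" "nb p \<in> G i" "aff_dim (G i) = 2" using G_LP[OF i] LinkP by auto
  have wf: "{nb p} face_of G i"
    using face_of_face[OF G(1)] w(1) vertex_face G(2) by blast
  have "aff_dim {nb p} = aff_dim (G i) - 2" using G(3) by simp
  then obtain A B where AB: "A \<noteq> B" "{K. K face_of G i \<and> {nb p} \<subseteq> K \<and> aff_dim K = aff_dim (G i) - 1} = {A, B}"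
    using ridge_two_facets[OF face_polytope[OF G(1)] wf] by blast
  have "{K \<in> LinkP 1. K \<subseteq> G i} = {K. K face_of G i \<and> {nb p} \<subseteq> K \<and> aff_dim K = aff_dim (G i) - 1}"
    using face_of_face[OF G(1)] G(3) LinkP by auto
  then have eq: "{K \<in> LinkP 1. K \<subseteq> G i} = {A, B}" using AB by simp
  have "V \<subseteq> G i" using V_iff[OF G_LP[OF i]] Phi(2)[OF dir(5)[OF i]] by blast
  then have "V \<in> {A, B}" using eq V_LP by blast
  then show ?thesis using eq AB(1) by (metis doubleton_eq_iff insertE singletonD)
qed

lemma x: assumes i: "i \<in> {0, 1, 2}" shows "{K \<in> LinkP 1. K \<subseteq> G i} = {V, x i}" "x i \<noteq> V"
  using someI_ex[OF x_ex[OF i]] unfolding x_def by auto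

lemma old_edge: assumes e: "e \<in> LinkP 1 - {V}" shows "e \<subseteq> Hcl" "\<kappa> e = e" "e = t 2 \<or> e \<inter> Hpos \<noteq> {}"
proof -
  have v: "v \<notin> e" using LP1_v e by blast
  have f: "e face_of P" "nb p \<in> e" "aff_dim e = 1" using e LinkP by auto
  show "e \<subseteq> Hcl" "\<kappa> e = e" using face_subset_Hcl[OF f(1) v] by auto
  obtain r where r: "r \<in> vertices P" "r \<noteq> nb p" "e = closed_segment (nb p) r"
    using edge_segment(1)[OF P f(1,3) w(1) f(2)] by blast
  show "e = t 2 \<or> e \<inter> Hpos \<noteq> {}"
  proof (cases "r = nb q")
    case True
    then have "e = t 2" using r(3) w by (simp add: \<sigma>_def pJ(5) segment_convex_hull)
    then show ?thesis ..
  next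
    case False
    have "r \<noteq> v" using v r(3) by auto
    then have "r \<notin> {v, nb 2, nb 3}" using False r(2) pq by auto
    then show ?thesis using pos_vertex[OF r(1)] r(3) by auto
  qed
qed

lemma t2_segment: "t 2 = closed_segment (nb 2) (nb 3)"
proof -
  have "{p, dir 2} = {2, 3}" using pq pJ(5) by auto
  then show ?thesis using sigma_23 by simp
qed

lemma t2_old: "t 2 \<in> LinkP 1 - {V} \<longleftrightarrow> closed_segment (nb 2) (nb 3) face_of P"
proof -
  have "v \<notin> t 2" using sigma_H[OF dir(5)[of 2]] v_neg by (auto simp: H_def)
  then have "t 2 \<noteq> V" using Phi(2)[OF pJ(4)] by blast
  moreover have "nb p \<in> t 2" using sigma_mem[OF dir(5)[of 2] pJ(1)] w(3) by simp
  moreover have "aff_dim (t 2) = 1" using sigma_dim[OF dir(5)[of 2]] dir(6)[of 2] by simp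
  ultimately show ?thesis using LinkP t2_segment by auto
qed

lemma PS'_eq: "PS' = (if t 2 \<in> LinkP 1 - {V} then LinkP 2 - {G 2} else LinkP 2)"
proof -
  have "{p, dir 2} = {2, 3}" using pq pJ(5) by auto
  then have G2: "G 2 = \<Phi> {2, 3}" by simp
  have "s \<inter> Hpos \<noteq> {} \<longleftrightarrow> s \<noteq> \<Phi> {2, 3} \<or> \<not> closed_segment (nb 2) (nb 3) face_of P" if "s \<in> LinkP 2" for s
    using that Phi_23_pos nopos_two_face[of s] LinkP by auto
  then show ?thesis unfolding t2_old G2 by auto
qed

lemma PX_pos: "z \<in> LinkP 3 \<Longrightarrow> z \<inter> Hpos \<noteq> {}"
  using nopos_dim(2)[of z] LinkP by force

text \<open>A face of \<open>T\<close> through \<open>nb p\<close> either reaches the positive side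
  and is the cut of a face of \<open>P\<close>, or lies in the section and is a face of the simplex,
  where \<open>k + 1\<close> corners span dimension \<open>k\<close>.\<close>

lemma LT_eq:
  assumes k: "k \<ge> 1"
  shows "LinkT k = \<kappa> ` {s \<in> LinkP k. s \<inter> Hpos \<noteq> {}} \<union> \<sigma> ` {M. M \<subseteq> J \<and> p \<in> M \<and> int (card M) = k + 1}"
proof (intro set_eqI iffI)
  fix K assume "K \<in> LinkT k"
  then have K: "K face_of T" "nb p \<in> K" "aff_dim K = k" using LinkT by auto
  show "K \<in> \<kappa> ` {s \<in> LinkP k. s \<inter> Hpos \<noteq> {}} \<union> \<sigma> ` {M. M \<subseteq> J \<and> p \<in> M \<and> int (card M) = k + 1}"
  proof (cases "K \<subseteq> H")
    case True
    then obtain M where M: "M \<subseteq> J" "K = \<sigma> M" using faceT_H[OF K(1)] by blast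
    then have "p \<in> M" "int (card M) = k + 1" using K sigma_mem[OF M(1) pJ(1)] w(3) sigma_dim[OF M(1)] by auto
    then show ?thesis using M by blast
  next
    case False
    then obtain s where s: "s face_of P" "s \<inter> Hpos \<noteq> {}" "K = \<kappa> s" using faceT_pos[OF K(1)] by blast
    then have "s \<in> LinkP k" using K kappa_dim[OF s(1,2)] LinkP by (auto simp: \<kappa>_def)
    then show ?thesis using s by blast
  qed
next
  fix K assume "K \<in> \<kappa> ` {s \<in> LinkP k. s \<inter> Hpos \<noteq> {}} \<union> \<sigma> ` {M. M \<subseteq> J \<and> p \<in> M \<and> int (card M) = k + 1}"
  then consider s where "s \<in> LinkP k" "s \<inter> Hpos \<noteq> {}" "K = \<kappa> s"
    | M where "M \<subseteq> J" "p \<in> M" "int (card M) = k + 1" "K = \<sigma> M" by blast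
  then show "K \<in> LinkT k"
  proof cases
    case 1
    then have "s face_of P" "nb p \<in> s" "aff_dim s = k" using LinkP by auto
    then show ?thesis using 1 kappa_face kappa_dim[of s] w(4) LinkT by (auto simp: \<kappa>_def)
  next
    case 2
    then show ?thesis using sigma_face_T sigma_mem[OF 2(1) pJ(1)] w(3) sigma_dim[OF 2(1)] LinkT by auto
  qed
qed

lemma TE: "LinkT 1 = (LinkP 1 - {V}) \<union> t ` {0, 1, 2}"
proof -
  have 1: "{s \<in> LinkP 1. s \<inter> Hpos \<noteq> {}} \<subseteq> LinkP 1 - {V}"
  proof -
    have "V \<inter> Hpos = {}"
    proof -
      have "V = closed_segment v (nb p)" by (rule Phi_edge[OF pJ(1)])
      also have "\<dots> \<subseteq> {x. a \<bullet> x \<le> b}"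
        by (rule closed_segment_subset) (use v_neg w(2) in \<open>auto simp: H_def convex_halfspace_le\<close>)
      finally show ?thesis by (auto simp: Hpos_def)
    qed
    then show ?thesis by blast
  qed
  have "M = {p, dir i} \<Longrightarrow> int (card M) = 2 \<longleftrightarrow> True" if "i \<in> {0, 1, 2}" for M i using dir(6)[OF that] by simp
  then have "{M. M \<subseteq> J \<and> p \<in> M \<and> int (card M) = 1 + 1} = (\<lambda>i. {p, dir i}) ` {0, 1, 2}"
    using two_dirs dir(5) by (auto simp del: insert_iff)
  then have 2: "LinkT 1 = \<kappa> ` {s \<in> LinkP 1. s \<inter> Hpos \<noteq> {}} \<union> t ` {0, 1, 2}"
    using LT_eq[of 1] by (simp add: image_image)
  have 3: "\<kappa> ` {s \<in> LinkP 1. s \<inter> Hpos \<noteq> {}} = {s \<in> LinkP 1. s \<inter> Hpos \<noteq> {}}"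
    using 1 old_edge(2) by (force simp: image_iff)
  have 4: "t 2 \<in> t ` {0, 1, 2}" by (rule imageI) simp
  have 5: "e \<in> {s \<in> LinkP 1. s \<inter> Hpos \<noteq> {}} \<or> e = t 2" if "e \<in> LinkP 1 - {V}" for e
    using old_edge(3)[OF that] that by blast
  have "A \<union> C = B \<union> C" if "A \<subseteq> B" "\<And>e. e \<in> B \<Longrightarrow> e \<in> A \<or> e = d" "d \<in> C" for A B C :: "'a set set" and d
    using that by blast
  from this[OF 1 5 4] show ?thesis unfolding 2 3 .
qed

lemma TS: "LinkT 2 = \<kappa> ` PS' \<union> D ` {0, 1, 2}"
proof -
  have "{M. M \<subseteq> J \<and> p \<in> M \<and> int (card M) = 2 + 1} = (\<lambda>i. J - {dir i}) ` {0, 1, 2}" (is "?L = ?R")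
  proof (intro set_eqI iffI)
    fix M assume "M \<in> ?L" then show "M \<in> ?R" using three_dirs[of M] by auto
  next
    fix M assume "M \<in> ?R"
    then obtain i where "i \<in> {0, 1, 2}" "M = J - {dir i}" by blast
    then show "M \<in> ?L" using dir(3,4,7)[of i] by simp
  qed
  then show ?thesis using LT_eq[of 2] by (simp add: image_image)
qed

lemma TX: "LinkT 3 = insert (\<sigma> J) (\<kappa> ` LinkP 3)"
proof -
  have "{M. M \<subseteq> J \<and> p \<in> M \<and> int (card M) = 3 + 1} = {J}"
  proof (intro set_eqI iffI)
    fix M assume M: "M \<in> {M. M \<subseteq> J \<and> p \<in> M \<and> int (card M) = 3 + 1}"
    then have "card M = card J" using pJ by simp
    then show "M \<in> {J}" using M pJ card_subset_eq by blast
  qed (use pJ in auto)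
  moreover have "{s \<in> LinkP 3. s \<inter> Hpos \<noteq> {}} = LinkP 3" using PX_pos by blast
  ultimately show ?thesis using LT_eq[of 3] by auto
qed

lemma old_kappa: "e \<in> LinkP 1 - {V} \<Longrightarrow> e \<subseteq> \<kappa> s \<longleftrightarrow> e \<subseteq> s"
  using old_edge(1) by (auto simp: \<kappa>_def)

text \<open>A face containing \<open>c 0\<close> or \<open>c 1\<close> contains the edge cut there.
  For \<open>i = 2\<close> the point \<open>c q\<close> is a vertex of \<open>P\<close>, and it is
  the absence of the edge \<open>t 2\<close> from \<open>P\<close> that forces \<open>v\<close> into
  the face, by \<open>edge_23\<close>.\<close>

lemma t_subset_face:
  assumes F: "F face_of P" "nb p \<in> F" and i: "i \<in> {0, 1, 2}" "t i \<notin> LinkP 1 - {V}"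
  shows "t i \<subseteq> \<kappa> F \<longleftrightarrow> v \<in> F \<and> nb (dir i) \<in> F"
proof
  assume "t i \<subseteq> \<kappa> F"
  then have ci: "c (dir i) \<in> F" using sigma_mem[OF dir(5)[OF i(1)] dir(1)[OF i(1)]] by (auto simp: \<kappa>_def)
  have vF: "v \<in> F"
  proof (cases "i = 2")
    case True
    show ?thesis
    proof (rule ccontr)
      assume no: "v \<notin> F"
      have "nb q \<in> F" using ci True pJ(5) w(8) by simp
      then have "nb 2 \<in> F" "nb 3 \<in> F" using F(2) pq by auto
      then show False using edge_23[OF F(1) no] t2_old i(2) True by blast
    qed
  next
    case False
    then show ?thesis using open_seg_c(1)[OF F(1) dir(1)[OF i(1)] ci] i(1) by (auto simp: dir_def)
  qed
  then show "v \<in> F \<and> nb (dir i) \<in> F" using open_seg_c(2)[OF F(1) dir(1)[OF i(1)] ci] by blast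
next
  assume "v \<in> F \<and> nb (dir i) \<in> F"
  then have "c (dir i) \<in> F" using c_in[OF face_convex[OF F(1)]] dir(1)[OF i(1)] by blast
  then have "c ` {p, dir i} \<subseteq> F" using F(2) w(3) by simp
  then have "t i \<subseteq> F" unfolding \<sigma>_def by (rule hull_minimal) (rule face_convex[OF F(1)])
  moreover have "t i \<subseteq> Hcl" using sigma_H[OF dir(5)[OF i(1)]] Hcl_split by blast
  ultimately show "t i \<subseteq> \<kappa> F" by (auto simp: \<kappa>_def)
qed

lemma D_subset_face:
  assumes F: "F \<in> LinkP 3" and i: "i \<in> {0, 1, 2}"
  shows "D i \<subseteq> \<kappa> F \<longleftrightarrow> F = X i"
proof
  assume D: "D i \<subseteq> \<kappa> F"
  then have c_mem: "c j \<in> F" if "j \<in> J" "j \<noteq> dir i" for j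
    using sigma_mem[OF dir(3)[OF i] that(1)] that by (auto simp: \<kappa>_def)
  have Ff: "F face_of P" using F LinkP by blast
  \<comment> \<open>Omitting one direction leaves at least one of \<open>c 0\<close> and
    \<open>c 1\<close>, whose presence forces \<open>v\<close> into \<open>F\<close>.\<close>
  obtain j where j: "j \<in> {0, 1}" "j \<noteq> dir i"
  proof (cases "dir i = 0")
    case True then show ?thesis using that[of 1] by auto
  next
    case False then show ?thesis using that[of 0] by auto
  qed
  have "j \<in> J" using j by (auto simp: J_def)
  then have "v \<in> F" using open_seg_c(1)[OF Ff _ c_mem] j by blast
  then obtain M where M: "M \<subseteq> J" "p \<in> M" "int (card M) = 3" "F = \<Phi> M" using LP_v[OF F] by blast
  have "J - {dir i} \<subseteq> M" using c_mem Phi_c[OF M(1)] M(4) by blast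
  moreover have "card (J - {dir i}) = card M" using dir(7)[OF i] M(3) by simp
  moreover have "finite M" using M(1) pJ finite_subset by blast
  ultimately have "M = J - {dir i}" using card_subset_eq by metis
  then show "F = X i" using M by simp
next
  assume "F = X i"
  then show "D i \<subseteq> \<kappa> F" using Phi(3)[OF dir(3)[OF i]] Hcl_split by (auto simp: \<kappa>_def)
qed

lemma Phi_face_23: "i \<in> {0,1,2} \<Longrightarrow> s \<in> LinkP 2 \<Longrightarrow> v \<in> s \<and> nb (dir i) \<in> s \<longleftrightarrow> s = G i"
proof -
  assume i: "i \<in> {0,1,2}" and s: "s \<in> LinkP 2"
  show ?thesis
  proof
    assume *: "v \<in> s \<and> nb (dir i) \<in> s"
    then obtain j where j: "j \<in> {0,1,2}" "s = G j" using LP2_v s by blast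
    then have "dir i \<in> {p, dir j}" using * Phi_nb[OF dir(5)[OF j(1)] dir(1)[OF i]] by simp
    then have "i = j" using dir(2)[OF i] dir_inj[OF i j(1)] by auto
    then show "s = G i" using j by simp
  qed (use Phi(2)[OF dir(5)[OF i]] Phi_nb[OF dir(5)[OF i] dir(1)[OF i]] in auto)
qed

lemma cut_link: "cut_link (LinkP 1) (LinkP 2) PS' (LinkP 3) (LinkT 1) (LinkT 2) (LinkT 3) \<kappa> V (\<sigma> J) t G D X x"
proof -
  have face: "s face_of P" "nb p \<in> s" "aff_dim s = k" if "s \<in> LinkP k" for s k using that LinkP by auto
  show ?thesis
  proof (unfold_locales, goal_cases)
    case 1 show ?case by (rule V_LP)
  next
    case 2 show ?case by (rule TE)
  next
    case 3 show ?case by (rule TS)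
  next
    case 4 show ?case by (rule TX)
  next
    case (5 i j)
    then have "{p, dir i} = {p, dir j}"
      using sigma_subset[OF dir(5) dir(5), of i j] sigma_subset[OF dir(5) dir(5), of j i] by auto
    then show ?case using dir(2)[of i] dir(2)[of j] dir_inj 5 by (auto simp: doubleton_eq_iff)
  next
    case 6
    show ?case
    proof
      assume "t 0 \<in> LinkP 1 - {V}"
      then have "t 0 face_of P" using face by blast
      moreover have "c 0 \<in> t 0" using sigma_mem[OF dir(5)[of 0] dir(1)[of 0]] by (simp add: dir_def)
      ultimately have "v \<in> t 0" using open_seg_c(1)[of "t 0" 0] by (simp add: J_def)
      then show False using sigma_H[OF dir(5)[of 0]] v_neg by (auto simp: H_def)
    qed
  next
    case 7
    show ?case
    proof
      assume "t 1 \<in> LinkP 1 - {V}"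
      then have "t 1 face_of P" using face by blast
      moreover have "c 1 \<in> t 1" using sigma_mem[OF dir(5)[of 1] dir(1)[of 1]] by (simp add: dir_def)
      ultimately have "v \<in> t 1" using open_seg_c(1)[of "t 1" 1] by (simp add: J_def)
      then show False using sigma_H[OF dir(5)[of 1]] v_neg by (auto simp: H_def)
    qed
  next
    case 8
    have "t 2 \<subseteq> G 2" using Phi(3)[OF dir(5)[of 2]] by blast
    then have "t 2 \<in> {V, x 2}" using x(1)[of 2] 8 by blast
    then show ?case using 8 by blast
  next
    case 9 show ?case by (rule PS'_eq)
  next
    case (10 e s) then show ?case using old_kappa by blast
  next
    case (11 e z) then show ?case using old_kappa by blast
  next
    case (12 s z)
    then have "s face_of P" "s \<inter> Hpos \<noteq> {}" "z face_of P" using face by blast+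
    then show ?case by (rule kappa_subset)
  next
    case 13
    show ?case
    proof (rule inj_onI)
      fix s s' assume *: "s \<in> PS'" "s' \<in> PS'" "\<kappa> s = \<kappa> s'"
      then have "s face_of P" "s \<inter> Hpos \<noteq> {}" "s' face_of P" "s' \<inter> Hpos \<noteq> {}" using face by blast+
      then show "s = s'" using kappa_eq[of s s'] * by blast
    qed
  next
    case (14 i s)
    then have s: "s \<in> LinkP 2" by blast
    show ?case using t_subset_face[OF face(1,2)[OF s] 14(1,2)] Phi_face_23[OF 14(1) s] by simp
  next
    case (15 i z)
    have "v \<in> z \<and> nb (dir i) \<in> z \<longleftrightarrow> (\<exists>j\<in>{0, 1, 2}. j \<noteq> i \<and> z = X j)"
    proof
      assume *: "v \<in> z \<and> nb (dir i) \<in> z"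
      then obtain j where j: "j \<in> {0, 1, 2}" "z = X j" using LP3_v 15(3) by blast
      then have "dir i \<in> J - {dir j}" using * Phi_nb[OF dir(3)[OF j(1)] dir(1)[OF 15(1)]] by simp
      then have "j \<noteq> i" by blast
      then show "\<exists>j\<in>{0, 1, 2}. j \<noteq> i \<and> z = X j" using j by blast
    next
      assume "\<exists>j\<in>{0, 1, 2}. j \<noteq> i \<and> z = X j"
      then obtain j where j: "j \<in> {0, 1, 2}" "j \<noteq> i" "z = X j" by blast
      then have "dir i \<in> J - {dir j}" using dir(1)[OF 15(1)] dir_inj[OF 15(1) j(1)] by simp
      then show "v \<in> z \<and> nb (dir i) \<in> z"
        using Phi_nb[OF dir(3)[OF j(1)] dir(1)[OF 15(1)]] Phi(2)[OF dir(3)[OF j(1)]] j(3) by simp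
    qed
    then show ?case using t_subset_face[OF face(1,2)[OF 15(3)] 15(1,2)] by simp
  next
    case (16 e i)
    then have "e \<inter> Hpos \<noteq> {}" using old_edge(3) by blast
    moreover have "D i \<subseteq> H" using sigma_H[OF dir(3)[OF 16(3)]] by blast
    ultimately show ?case by (auto simp: Hpos_def H_def)
  next
    case (17 i j)
    have "t j \<subseteq> D i \<longleftrightarrow> {p, dir j} \<subseteq> J - {dir i}" by (rule sigma_subset[OF dir(5)[OF 17(2)] dir(3)[OF 17(1)]])
    also have "\<dots> \<longleftrightarrow> dir j \<noteq> dir i" using dir(1)[OF 17(2)] dir(4)[OF 17(1)] by auto
    finally show ?case using dir_inj[OF 17] by auto
  next
    case (18 i z) then show ?case using D_subset_face by blast
  next
    case (19 s)
    then have "\<not> \<kappa> s \<subseteq> H" using kappa_not_H by blast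
    then show ?case using sigma_H[of J] by blast
  next
    case (20 i) then show ?case using sigma_subset[OF dir(3)[OF 20] order.refl] by simp
  next
    case (21 i) then show ?case by (rule G_LP)
  next
    case (22 i) then show ?case by (rule X_LP)
  next
    case (23 s)
    have "v \<in> s \<longleftrightarrow> s \<in> G ` {0, 1, 2}" using LP2_v[OF 23] Phi(2)[OF dir(5)] by blast
    then show ?case using V_iff[OF 23] by simp
  next
    case (24 z)
    have "v \<in> z \<longleftrightarrow> z \<in> X ` {0, 1, 2}" using LP3_v[OF 24] Phi(2)[OF dir(3)] by blast
    then show ?case using V_iff[OF 24] by simp
  next
    case (25 i j)
    have "G j \<subseteq> X i \<longleftrightarrow> {p, dir j} \<subseteq> J - {dir i}" by (rule Phi_subset[OF dir(5)[OF 25(2)] dir(3)[OF 25(1)]])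
    also have "\<dots> \<longleftrightarrow> dir j \<noteq> dir i" using dir(1)[OF 25(2)] dir(4)[OF 25(1)] by auto
    finally show ?case using dir_inj[OF 25] by auto
  next
    case (26 i) then show ?case using x[OF 26] by blast
  next
    case (27 e i)
    have "e \<subseteq> G i \<longleftrightarrow> e \<in> {V, x i}" using x(1)[OF 27(1)] 27(2) by blast
    then show ?case using 27(2) by blast
  next
    \<comment> \<open>Two different edges at \<open>nb p\<close> span the 2-face \<open>s\<close>,
      so \<open>s \<inter> z\<close> has dimension 2 and is all of \<open>s\<close>.\<close>
    case (28 e d s z)
    have sz: "s \<inter> z face_of P" using face_of_Int[OF face(1)[OF 28(4)] face(1)[OF 28(5)]] .
    have "aff_dim e < aff_dim (s \<inter> z)"
      using two_faces_aff_dim[OF P face(1)[OF 28(1)] face(1)[OF 28(2)] sz] face(3)[OF 28(1)] face(3)[OF 28(2)] 28 by auto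
    moreover have "aff_dim (s \<inter> z) \<le> aff_dim s" by (rule aff_dim_subset) simp
    ultimately have "s \<inter> z = s"
      using face_eqI_aff_dim[OF P sz face(1)[OF 28(4)]] face(3)[OF 28(1)] face(3)[OF 28(4)] by auto
    then show ?case by blast
  next
    \<comment> \<open>In the 3-face \<open>X i\<close> the edge \<open>t 2\<close> lies in exactly
      two 2-faces. One is \<open>G 2\<close>, which has been removed from \<open>PS'\<close>, so at
      most one is left.\<close>
    case (29 s s' i)
    have Xi: "X i face_of P" "aff_dim (X i) = 3" using face[OF X_LP[OF 29(2)]] by auto
    have 2: "(2::nat) \<in> {0, 1, 2}" by simp
    have t2: "t 2 face_of P" "aff_dim (t 2) = 1" "nb p \<in> t 2" using face 29(1) by blast+
    have GX: "G 2 \<subseteq> X i"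
    proof -
      have "{p, dir 2} \<subseteq> J - {dir i}" using dir(1)[OF 2] dir(4)[OF 29(2)] dir_inj[OF 2 29(2)] 29(3) by auto
      then show ?thesis using Phi_subset[OF dir(5)[OF 2] dir(3)[OF 29(2)]] by blast
    qed
    have tG: "t 2 \<subseteq> G 2" using Phi(3)[OF dir(5)[OF 2]] by blast
    have ridge: "t 2 face_of X i" using face_of_face[OF Xi(1)] t2(1) tG GX by blast
    have rdim: "aff_dim (t 2) = aff_dim (X i) - 2" using t2(2) Xi(2) by simp
    obtain A B where AB: "{K. K face_of X i \<and> t 2 \<subseteq> K \<and> aff_dim K = aff_dim (X i) - 1} = {A, B}"
      using ridge_two_facets[OF face_polytope[OF Xi(1)] ridge rdim] by (elim exE conjE)
    have mem: "r \<in> {A, B}" if "r \<in> LinkP 2" "t 2 \<subseteq> r" "r \<subseteq> X i" for r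
      using that face[OF that(1)] face_of_face[OF Xi(1), of r] Xi(2) AB[symmetric] by simp
    have no: "r \<noteq> G 2" if "r \<in> PS'" for r using that PS'_eq 29(1) by auto
    have "G 2 \<in> {A, B}" by (rule mem[OF G_LP[OF 2] tG GX])
    moreover have "s \<in> {A, B}" "s' \<in> {A, B}" using mem 29 by blast+
    ultimately show ?case using no[OF 29(4)] no[OF 29(5)] by blast
  qed
qed

end

section \<open>Transfer of vertex shellings from \<open>T\<close> to \<open>P\<close>\<close>

lemma prefix_all_map:
  "prefix_all R (f ` A) (map f l) \<longleftrightarrow> prefix_all (\<lambda>A x. R (f ` A) (f x)) A l"
  by (induction l arbitrary: A) (simp_all flip: image_insert)

text \<open>\<open>link_shelling\<close> refers to its faces only through inclusions, so it passes
  back along any map that preserves and reflects them.\<close>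

lemma link_shelling_image:
  assumes emb: "\<And>F G. F \<in> E \<union> S \<union> X \<Longrightarrow> G \<in> E \<union> S \<union> X \<Longrightarrow> f F \<subseteq> f G \<longleftrightarrow> F \<subseteq> G"
    and l: "link_shelling (f ` E) (f ` S) (f ` X) (map f l)" "set l \<subseteq> E"
  shows "link_shelling E S X l"
proof -
  have inj: "inj_on f (E \<union> S \<union> X)"
  proof (rule inj_onI)
    fix F G assume "F \<in> E \<union> S \<union> X" "G \<in> E \<union> S \<union> X" "f F = f G"
    then show "F = G" using emb[of F G] emb[of G F] by auto
  qed
  have d: "distinct (map f l)" "set (map f l) = f ` E"
    "\<And>e. e \<in> E \<Longrightarrow> conn (sadj (f ` X)) {s \<in> f ` S. f e \<subseteq> s}"
    "prefix_all (link_step (f ` S) (f ` X)) {} (map f l)"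
    using l(1) by (auto simp: link_shelling_def)
  have E: "set l = E"
  proof -
    have "f ` set l = f ` E" using d(2) by simp
    then show ?thesis using inj_on_image_eq_iff[OF inj, of "set l" E] l(2) by blast
  qed
  have conn: "conn (sadj X) M" if c: "conn (sadj (f ` X)) (f ` M)" and M: "M \<subseteq> S" for M
  proof -
    let ?g = "inv_into (E \<union> S \<union> X) f"
    have g: "?g (f s) = s" if "s \<in> M" for s
      by (rule inv_into_f_f[OF inj]) (use that M in blast)
    have "conn (sadj X) (?g ` f ` M)"
    proof (rule conn_image[OF c])
      fix s s' assume s: "s \<in> f ` M" "s' \<in> f ` M" "(s, s') \<in> sadj (f ` X)"
      then obtain r r' x where r: "r \<in> M" "s = f r" "r' \<in> M" "s' = f r'" "x \<in> X" "f r \<subseteq> f x" "f r' \<subseteq> f x"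
        unfolding sadj_def by blast
      have "r \<subseteq> x" "r' \<subseteq> x" using emb[of r x] emb[of r' x] r M by auto
      then have "(r, r') \<in> sadj X" using r by (auto simp: sadj_def)
      then show "?g s = ?g s' \<or> (?g s, ?g s') \<in> sadj X" using r g by simp
    qed
    moreover have "?g ` f ` M = M" using g by (force simp: image_image)
    ultimately show ?thesis by simp
  qed
  have "conn (sadj X) {s \<in> S. e \<subseteq> s}" if e: "e \<in> E" for e
  proof (rule conn)
    have "{s \<in> f ` S. f e \<subseteq> s} = f ` {s \<in> S. e \<subseteq> s}" using emb e by blast
    then show "conn (sadj (f ` X)) (f ` {s \<in> S. e \<subseteq> s})" using d(3)[OF e] by simp
  qed blast
  moreover have "prefix_all (link_step S X) {} l"
  proof -
    have step: "link_step S X A e" if st: "link_step (f ` S) (f ` X) (f ` A) (f e)" and A: "A \<subseteq> E" "e \<in> E" for A e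
    proof (cases "A = {}")
      case False
      have new: "new_ridges (f ` S) (f ` A) (f e) = f ` new_ridges S A e"
      proof (intro set_eqI iffI)
        fix s assume "s \<in> new_ridges (f ` S) (f ` A) (f e)"
        then obtain r c where r: "r \<in> S" "s = f r" "f e \<subseteq> f r" "c \<in> A" "f c \<subseteq> f r"
          by (auto simp: new_ridges_def)
        then have "e \<subseteq> r" "c \<subseteq> r" using emb[of e r] emb[of c r] A by auto
        then show "s \<in> f ` new_ridges S A e" using r by (auto simp: new_ridges_def)
      next
        fix s assume "s \<in> f ` new_ridges S A e"
        then obtain r c where r: "r \<in> S" "s = f r" "e \<subseteq> r" "c \<in> A" "c \<subseteq> r"
          by (auto simp: new_ridges_def)
        then have "f e \<subseteq> f r" "f c \<subseteq> f r" using emb[of e r] emb[of c r] A by auto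
        then show "s \<in> new_ridges (f ` S) (f ` A) (f e)" using r by (auto simp: new_ridges_def)
      qed
      have c: "conn (sadj (f ` X)) (f ` new_ridges S A e)"
        and p: "\<forall>x\<in>f ` X. \<forall>c\<in>f ` A. f e \<subseteq> x \<and> c \<subseteq> x \<longrightarrow> (\<exists>s\<in>f ` new_ridges S A e. s \<subseteq> x)"
        using st False unfolding link_step_def new by simp_all
      have "\<exists>s\<in>new_ridges S A e. s \<subseteq> x" if x: "x \<in> X" "c \<in> A" "e \<subseteq> x \<and> c \<subseteq> x" for x c
      proof -
        have "f e \<subseteq> f x \<and> f c \<subseteq> f x" using emb[of e x] emb[of c x] A x by auto
        from p[rule_format, OF imageI[OF x(1)] imageI[OF x(2)] this]
        obtain r where r: "r \<in> new_ridges S A e" "f r \<subseteq> f x" by blast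
        moreover have "r \<in> S" using r(1) by (simp add: new_ridges_def)
        ultimately show ?thesis using emb[of r x] x(1) by auto
      qed
      moreover have "conn (sadj X) (new_ridges S A e)" by (rule conn[OF c]) (auto simp: new_ridges_def)
      ultimately show ?thesis by (simp add: link_step_def)
    qed (simp add: link_step_def)
    have "prefix_all (\<lambda>A e. link_step (f ` S) (f ` X) (f ` A) (f e)) {} l"
      using d(4) prefix_all_map[of _ f "{}" l] by simp
    then show ?thesis unfolding prefix_all_nth using step l(2)
      by (metis (no_types, lifting) Un_empty_left nth_mem set_take_subset subset_trans subsetD)
  qed
  moreover have "distinct l" using d(1) by (simp add: distinct_map)
  ultimately show ?thesis using E by (simp add: link_shelling_def)
qed

context truncation_link
begin

text \<open>At most one of the three \<open>t i\<close> is in the prefix, so \<open>V\<close> has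
  not been inserted and the lifted prefix is just the old part of \<open>l1\<close>.\<close>

lemma vertex_shelling_lift:
  assumes sh: "vertex_shelling T (nb p) (l1 @ l2)" and l1: "l1 = [] \<or> set l1 \<inter> (LinkP 1 - {V}) \<noteq> {}"
    and new: "t 0 \<notin> set l1" "t 1 \<notin> set l1"
  shows "\<exists>l1' l2'. vertex_shelling P (nb p) (l1' @ l2') \<and> set l1' = set l1 \<inter> (LinkP 1 - {V})"
proof -
  interpret cl: cut_link "LinkP 1" "LinkP 2" PS' "LinkP 3" "LinkT 1" "LinkT 2" "LinkT 3" \<kappa> V "\<sigma> J" t G D X x
    "LinkP 1 - {V}" "{0, 1, 2}"
    using cut_link by simp_all
  have "\<not> cl.two (set l1)" unfolding cl.two_def using new by auto
  then have "cl.lift (set l1) = set l1 \<inter> (LinkP 1 - {V})" by (simp add: cl.lift_def)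
  then show ?thesis using cl.lift_link_shelling[of l1 l2] sh l1 unfolding vertex_shelling_def by simp
qed

end

context truncation
begin

text \<open>Every face through \<open>w\<close> reaches the positive side, so cutting is an
  isomorphism of the faces at \<open>w\<close>.\<close>

lemma vertex_shelling_ordinary:
  assumes w: "w \<in> vertices P" "w \<notin> {v, nb 2, nb 3}" and sh: "vertex_shelling T w (l1 @ l2)"
    and l1: "set l1 = \<kappa> ` A" "A \<subseteq> faces_over P 1 {w}"
  shows "\<exists>l1' l2'. vertex_shelling P w (l1' @ l2') \<and> set l1' = A"
proof -
  have pos: "G \<inter> Hpos \<noteq> {}" if "w \<in> G" for G using pos_vertex[OF w(1) that w(2)] .
  have wH: "w \<in> Hcl" "w \<notin> H" using pos[of "{w}"] by (auto simp: Hpos_def Hcl_def H_def)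
  let ?L = "\<lambda>k. faces_over P k {w}"
  have L: "G face_of P" "w \<in> G" "aff_dim G = k" if "G \<in> ?L k" for G k using that by (auto simp: faces_over_def)
  have LT: "faces_over T k {w} = \<kappa> ` ?L k" for k
  proof (intro set_eqI iffI)
    fix K assume "K \<in> faces_over T k {w}"
    then have K: "K face_of T" "w \<in> K" "aff_dim K = k" by (auto simp: faces_over_def)
    obtain G where G: "G face_of P" "G \<inter> Hpos \<noteq> {}" "K = \<kappa> G" using faceT_pos[OF K(1)] K(2) wH by blast
    then have "G \<in> ?L k" using K kappa_dim[OF G(1,2)] by (auto simp: faces_over_def \<kappa>_def)
    then show "K \<in> \<kappa> ` ?L k" using G by blast
  next
    fix K assume "K \<in> \<kappa> ` ?L k"
    then obtain G where G: "G \<in> ?L k" "K = \<kappa> G" by blast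
    show "K \<in> faces_over T k {w}"
      using kappa_face[OF L(1)[OF G(1)]] kappa_dim[OF L(1)[OF G(1)] pos[OF L(2)[OF G(1)]]] L(2,3)[OF G(1)] wH(1) G(2)
      by (auto simp: faces_over_def \<kappa>_def)
  qed
  have emb: "\<kappa> F \<subseteq> \<kappa> G \<longleftrightarrow> F \<subseteq> G" if "F \<in> ?L 1 \<union> ?L 2 \<union> ?L 3" "G \<in> ?L 1 \<union> ?L 2 \<union> ?L 3" for F G
    using that L kappa_subset[of F G] pos by blast
  have set: "set (l1 @ l2) = \<kappa> ` ?L 1" using sh by (simp add: vertex_shelling_def link_shelling_def LT)
  let ?g = "inv_into (?L 1) \<kappa>"
  have inj: "inj_on \<kappa> (?L 1)"
    using L pos kappa_eq by (meson inj_onI)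
  have g: "\<kappa> (?g e) = e" "?g e \<in> ?L 1" if "e \<in> set (l1 @ l2)" for e
    using that unfolding set by (auto simp: f_inv_into_f inv_into_into)
  have "map \<kappa> (map ?g (l1 @ l2)) = l1 @ l2" unfolding map_map by (rule map_idI) (use g in simp)
  then have "link_shelling (\<kappa> ` ?L 1) (\<kappa> ` ?L 2) (\<kappa> ` ?L 3) (map \<kappa> (map ?g (l1 @ l2)))"
    using sh unfolding vertex_shelling_def LT by simp
  then have "link_shelling (?L 1) (?L 2) (?L 3) (map ?g (l1 @ l2))"
    by (rule link_shelling_image[rotated 1]) (use emb g in auto)
  moreover have "set (map ?g l1) = A" using l1 inj by (simp add: inv_into_image_cancel)
  ultimately show ?thesis unfolding vertex_shelling_def map_append by blast
qed

text \<open>\<open>v\<close> is simple, so its facet of the polar is a tetrahedron, where every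
  order of the facets is a shelling.\<close>

lemma vertex_shelling_v: "\<exists>l. vertex_shelling P v (l @ [])"
proof -
  let ?L = "\<lambda>k. faces_over P k {v}"
  have L: "G face_of P" "v \<in> G" "aff_dim G = k" if "G \<in> ?L k" for G k using that by (auto simp: faces_over_def)
  have Phi_L: "\<Phi> M \<in> ?L (int (card M))" if "M \<subseteq> J" for M
    using Phi[OF that] Phi_dim[OF that] by (simp add: faces_over_def)
  have L_Phi: "\<exists>M\<subseteq>J. G = \<Phi> M \<and> int (card M) = k" if "G \<in> ?L k" for G k
    using Phi_surj[OF L(1,2)[OF that]] L(3)[OF that] Phi_dim by metis
  have edge: "\<exists>i\<in>J. e = \<Phi> {i}" if e: "e \<in> ?L 1" for e
  proof -
    obtain M where M: "M \<subseteq> J" "e = \<Phi> M" "int (card M) = 1" using L_Phi[OF e] by blast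
    then have "card M = 1" by simp
    then obtain i where "M = {i}" using card_1_singletonE by blast
    then show ?thesis using M by blast
  qed
  have third: "\<exists>M\<subseteq>J. card M = 3 \<and> {i, j, k} \<subseteq> M" if "i \<in> J" "j \<in> J" "k \<in> J" for i j k
  proof -
    have "card {i, j, k} \<le> 3" by (simp add: card_insert_if)
    then show ?thesis
      using exists_subset_between[of "{i, j, k}" 3 J] that by (auto simp: J_def)
  qed
  have two_face: "\<exists>j\<in>J. s = \<Phi> {i, j}" if s: "s \<in> ?L 2" "\<Phi> {i} \<subseteq> s" and i: "i \<in> J" for s i
  proof -
    obtain M where M: "M \<subseteq> J" "s = \<Phi> M" "int (card M) = 2" using L_Phi[OF s(1)] by blast
    then have "i \<in> M" using s(2) Phi_subset[of "{i}" M] i by simp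
    moreover have "card M = 2" using M by simp
    ultimately obtain j where "M = {i, j}" by (metis card_2_iff insert_commute insertE singletonD)
    then show ?thesis using M by blast
  qed
  have adj: "(s, s') \<in> sadj (?L 3)" if s: "s \<in> ?L 2" "\<Phi> {i} \<subseteq> s" "s' \<in> ?L 2" "\<Phi> {i} \<subseteq> s'" and i: "i \<in> J" for s s' i
  proof -
    obtain j k where jk: "j \<in> J" "k \<in> J" "s = \<Phi> {i, j}" "s' = \<Phi> {i, k}"
      using two_face[OF s(1,2) i] two_face[OF s(3,4) i] by blast
    obtain M where M: "M \<subseteq> J" "card M = 3" "{i, j, k} \<subseteq> M" using third[OF i jk(1,2)] by blast
    have "s \<subseteq> \<Phi> M" "s' \<subseteq> \<Phi> M" using jk i M Phi_subset[of "{i, j}" M] Phi_subset[of "{i, k}" M] by auto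
    moreover have "\<Phi> M \<in> ?L 3" using Phi_L[OF M(1)] M(2) by simp
    ultimately show ?thesis unfolding sadj_def by blast
  qed
  have join: "\<Phi> {i, j} \<in> ?L 2" "\<Phi> {i} \<subseteq> \<Phi> {i, j}" "\<Phi> {j} \<subseteq> \<Phi> {i, j}" if "i \<in> J" "j \<in> J" "i \<noteq> j" for i j
    using that Phi_L[of "{i, j}"] Phi_subset[of "{i}" "{i, j}"] Phi_subset[of "{j}" "{i, j}"] by auto
  have step: "link_step (?L 2) (?L 3) A e" if e: "e \<in> ?L 1" "A \<subseteq> ?L 1" "e \<notin> A" for A e
  proof (cases "A = {}")
    case False
    obtain i where i: "i \<in> J" "e = \<Phi> {i}" using edge[OF e(1)] by blast
    have A: "\<exists>j\<in>J. j \<noteq> i \<and> d = \<Phi> {j}" if d: "d \<in> A" for d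
    proof -
      obtain j where j: "j \<in> J" "d = \<Phi> {j}" using edge[of d] d e(2) by blast
      then have "j \<noteq> i" using d e(3) i(2) by metis
      then show ?thesis using j by blast
    qed
    have mem: "\<Phi> {i, j} \<in> new_ridges (?L 2) A e" if "j \<in> J" "j \<noteq> i" "\<Phi> {j} \<in> A" for j
      using join[OF i(1) that(1)] that i(2) unfolding new_ridges_def by auto
    have "conn (sadj (?L 3)) (new_ridges (?L 2) A e)"
    proof (rule conn_clique)
      show "new_ridges (?L 2) A e \<noteq> {}" using False A mem by blast
    next
      fix s s' assume "s \<in> new_ridges (?L 2) A e" "s' \<in> new_ridges (?L 2) A e"
      then show "(s, s') \<in> sadj (?L 3)" using adj[of s i s'] i by (auto simp: new_ridges_def)
    qed
    moreover have "\<exists>s\<in>new_ridges (?L 2) A e. s \<subseteq> z" if z: "z \<in> ?L 3" "d \<in> A" "e \<subseteq> z" "d \<subseteq> z" for z d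
    proof -
      obtain j where j: "j \<in> J" "j \<noteq> i" "d = \<Phi> {j}" using A[OF z(2)] by blast
      obtain M where M: "M \<subseteq> J" "z = \<Phi> M" using L_Phi[OF z(1)] by blast
      have "{i, j} \<subseteq> M" using z(3,4) i j M Phi_subset[of "{i}" M] Phi_subset[of "{j}" M] by simp
      then have "\<Phi> {i, j} \<subseteq> z" using M Phi_subset[of "{i, j}" M] by auto
      then show ?thesis using mem[OF j(1,2)] j(3) z(2) by blast
    qed
    ultimately show ?thesis unfolding link_step_def by blast
  qed (simp add: link_step_def)
  have all: "conn (sadj (?L 3)) {s \<in> ?L 2. e \<subseteq> s}" if e: "e \<in> ?L 1" for e
  proof -
    obtain i where i: "i \<in> J" "e = \<Phi> {i}" using edge[OF e] by blast
    define j where "j = (if i = 0 then 1 else (0::nat))"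
    have "j \<in> J" "i \<noteq> j" by (auto simp: J_def j_def)
    then show ?thesis using join[OF i(1)] adj[OF _ _ _ _ i(1)] i(2) by (intro conn_clique) auto
  qed
  obtain l where l: "distinct l" "set l = ?L 1"
    using finite_distinct_list[OF finite_faces_over[OF P]] by blast
  have "prefix_all (link_step (?L 2) (?L 3)) {} l" unfolding prefix_all_nth
  proof (intro allI impI)
    fix j assume j: "j < length l"
    have "l ! j \<notin> set (take j l)" using l(1) j by (auto simp: in_set_conv_nth nth_eq_iff_index_eq)
    then show "link_step (?L 2) (?L 3) ({} \<union> set (take j l)) (l ! j)"
      using step[of "l ! j" "set (take j l)"] nth_mem[OF j] set_take_subset[of j l] l(2) by simp
  qed
  then have "vertex_shelling P v l" using l all by (simp add: vertex_shelling_def link_shelling_def)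
  then show ?thesis by (intro exI[of _ l]) simp
qed

end

section \<open>The truncated digraph\<close>

text \<open>A cycle cannot pass through the sink \<open>x\<close>, and all added arcs end
  there.\<close>

lemma acyclic_add_sink:
  assumes "acyclic R" "x \<notin> Domain (R \<union> S)" "\<And>y z. (y, z) \<in> S \<Longrightarrow> z = x"
  shows "acyclic (R \<union> S)"
  unfolding acyclic_def
proof (intro allI notI)
  fix p assume p: "(p, p) \<in> (R \<union> S)\<^sup>+"
  have *: "q \<noteq> x \<longrightarrow> (p, q) \<in> R\<^sup>+" if "(p, q) \<in> (R \<union> S)\<^sup>+" for q
    using that
  proof (induction rule: trancl_induct)
    case (base y)
    then show ?case using assms(3) by auto
  next
    case (step y z)
    have "y \<noteq> x" using step(2) assms(2) by blast
    show ?case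
    proof
      assume "z \<noteq> x"
      then have "(y, z) \<in> R" using step(2) assms(3) by blast
      then show "(p, z) \<in> R\<^sup>+" using step.IH \<open>y \<noteq> x\<close> by (meson trancl_into_trancl)
    qed
  qed
  have "p \<in> Domain (R \<union> S)" using p by (meson Domain.DomainI tranclD)
  then have "p \<noteq> x" using assms(2) by blast
  then show False using *[OF p] assms(1) unfolding acyclic_def by blast
qed

text \<open>Following out-arcs must stop by acyclicity and can stop only at
  \<open>t\<close>.\<close>

lemma reach_sink:
  assumes fin: "finite A" and ac: "acyclic A"
    and uniq: "\<And>w. w \<in> W \<Longrightarrow> w \<noteq> t \<Longrightarrow> \<exists>y\<in>W. (w, y) \<in> A" and w: "w \<in> W"
  shows "(w, t) \<in> A\<^sup>*"
proof -
  have "wf (A\<inverse>)" using fin ac by (rule finite_acyclic_wf_converse)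
  then show ?thesis using w
  proof (induction w rule: wf_induct_rule)
    case (less w)
    show ?case
    proof (cases "w = t")
      case False
      then obtain y where y: "y \<in> W" "(w, y) \<in> A" using uniq less.prems by blast
      then have "(y, t) \<in> A\<^sup>*" using less.IH by blast
      then show ?thesis using y(2) by (rule converse_rtrancl_into_rtrancl[rotated])
    qed simp
  qed
qed

lemma reach_source:
  assumes fin: "finite A" and ac: "acyclic A"
    and uniq: "\<And>w. w \<in> W \<Longrightarrow> w \<noteq> s \<Longrightarrow> \<exists>y\<in>W. (y, w) \<in> A" and w: "w \<in> W"
  shows "(s, w) \<in> A\<^sup>*"
proof -
  have "(w, s) \<in> (A\<inverse>)\<^sup>*"
    by (rule reach_sink[where W = W]) (use assms in auto)
  then show ?thesis by (simp add: rtrancl_converse)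
qed

lemma face_arcs_iff: "(x, y) \<in> face_arcs E F \<longleftrightarrow> (x, y) \<in> E \<and> x \<in> vertices F \<and> y \<in> vertices F"
  by (auto simp: face_arcs_def)

locale truncation_digraph = truncation +
  fixes E :: "('a \<times> 'a) set"
  assumes G: "polytopal_digraph P E" and acyclic: "acyclic E" and hk: "holt_klee P E"
    and sink: "sink_in E P v" and no_path: "(nb 3, nb 2) \<notin> E\<^sup>*"
begin

definition "E' = tr_arcs E T (nb 0) (nb 1) (nb 2) (nb 3) (c 0) (c 1)"

definition "new_arcs = {(nb 2, nb 3), (nb 0, c 0), (nb 2, c 0), (nb 3, c 0),
    (nb 1, c 1), (nb 2, c 1), (nb 3, c 1), (c 0, c 1)}"

lemma uso: "USO P E"
  using hk by (simp add: holt_klee_def)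

lemma arc: assumes "(x, y) \<in> E"
  shows "x \<in> vertices P" "y \<in> vertices P" "x \<noteq> y" "closed_segment x y face_of P" "aff_dim (closed_segment x y) = 1"
  using digraph_arc[OF G assms] by auto

lemma orient: "closed_segment x y face_of P \<Longrightarrow> aff_dim (closed_segment x y) = 1 \<Longrightarrow> (x, y) \<in> E \<longleftrightarrow> (y, x) \<notin> E"
  using G unfolding polytopal_digraph_def edge_of_def by blast

lemma v_out: "(v, y) \<notin> E"
proof
  assume "(v, y) \<in> E"
  then have "(v, y) \<in> face_arcs E P" using arc by (simp add: face_arcs_iff)
  then show False using sink by (simp add: sink_in_def)
qed

lemma nb_v_arc: "i \<in> J \<Longrightarrow> (nb i, v) \<in> E"
  using orient[of v "nb i"] nb_edge[of i] v_out by blast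

lemma v_in: "(y, v) \<in> E \<Longrightarrow> \<exists>i\<in>J. y = nb i"
proof -
  assume "(y, v) \<in> E"
  then have "closed_segment v y edge_of P"
    using arc(4,5)[of y v] by (simp add: edge_of_def closed_segment_commute)
  then show ?thesis using nb by (auto simp: neighbours_def J_def)
qed

lemma c_new: assumes "i \<in> {0, 1}" shows "c i \<notin> vertices P" "c i \<noteq> v"
proof -
  have "c i \<in> H" using c_H assms by (auto simp: H_def)
  then show cv: "c i \<noteq> v" using v_neg by (auto simp: H_def)
  show "c i \<notin> vertices P"
  proof
    assume "c i \<in> vertices P"
    then have "{c i} face_of P" using vertex_face by blast
    then have "v \<in> {c i}" using open_seg_c(1)[of "{c i}" i] assms by (auto simp: J_def)
    then show False using cv by simp
  qed
qed

lemma c_inj: "i \<in> J \<Longrightarrow> j \<in> J \<Longrightarrow> c i = c j \<longleftrightarrow> i = j"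
  using c_independent(2) by (auto dest: inj_onD)

lemma nb_eq: "i \<in> J \<Longrightarrow> j \<in> J \<Longrightarrow> nb i = nb j \<longleftrightarrow> i = j"
  using nb_inj by (auto dest: inj_onD simp: J_def)

lemma v_notin_T: "v \<notin> T"
  using v_neg by (auto simp: T_def \<kappa>_def Hcl_def)

lemma segment_T:
  "i \<in> {0, 1} \<Longrightarrow> \<kappa> (\<Phi> {i}) = closed_segment (c i) (nb i) \<and> \<Phi> {i} \<inter> Hpos \<noteq> {}"
proof -
  assume i: "i \<in> {0, 1}"
  then have iJ: "i \<in> J" "{i} \<subseteq> J" by (auto simp: J_def)
  have ci: "c i \<in> \<Phi> {i}" "nb i \<in> \<Phi> {i}" using Phi_c[OF iJ(2,1)] Phi_nb[OF iJ(2,1)] by auto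
  then have pos: "\<Phi> {i} \<inter> Hpos \<noteq> {}" using nb_pos[OF i] by (auto simp: Hpos_def)
  have K: "\<kappa> (\<Phi> {i}) face_of T" "aff_dim (\<kappa> (\<Phi> {i})) = 1"
    using kappa_face[OF Phi(1)[OF iJ(2)]] kappa_dim[OF Phi(1)[OF iJ(2)] pos] Phi_dim[OF iJ(2)] by auto
  have "c i \<in> H" using c_H iJ by (auto simp: H_def J_def)
  then have "c i \<in> \<kappa> (\<Phi> {i})" "nb i \<in> \<kappa> (\<Phi> {i})"
    using ci nb_pos[OF i] by (auto simp: \<kappa>_def Hcl_split Hpos_def)
  moreover have "c i \<in> vertices T" "nb i \<in> vertices T" "nb i \<noteq> c i"
    using vertices_T i nb_edge(3,4)[OF iJ(1)] c_new(1)[OF i] by auto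
  ultimately have "\<kappa> (\<Phi> {i}) = closed_segment (c i) (nb i)" using edge_segment(2)[OF T_polytope K] by blast
  then show ?thesis using pos by blast
qed

text \<open>The kinds of edges overlap: if \<open>nb 2\<close> and \<open>nb 3\<close> are joined by
  an edge of \<open>P\<close>, this is an old edge and an edge of the section at once.\<close>

lemma edge_T_iff:
  "closed_segment x y edge_of T \<longleftrightarrow>
     closed_segment x y edge_of P \<and> x \<noteq> v \<and> y \<noteq> v \<or>
     (\<exists>i\<in>{0, 1}. {x, y} = {c i, nb i}) \<or> (\<exists>i\<in>J. \<exists>j\<in>J. i \<noteq> j \<and> {x, y} = {c i, c j})"
    (is "?L \<longleftrightarrow> ?A \<or> ?B \<or> ?C")
proof
  assume L: ?L
  then have K: "closed_segment x y face_of T" "aff_dim (closed_segment x y) = 1" by (auto simp: edge_of_def)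
  show "?A \<or> ?B \<or> ?C"
  proof (cases "closed_segment x y \<subseteq> H")
    case True
    then obtain M where M: "M \<subseteq> J" "closed_segment x y = \<sigma> M" using faceT_H[OF K(1)] by blast
    then have "card M = 2" using sigma_dim[OF M(1)] K(2) by simp
    then obtain i j where ij: "M = {i, j}" "i \<noteq> j" by (meson card_2_iff)
    then have "closed_segment x y = closed_segment (c i) (c j)"
      using M by (simp add: \<sigma>_def segment_convex_hull)
    then show ?thesis using ij M(1) by auto
  next
    case False
    then obtain e where e: "e face_of P" "e \<inter> Hpos \<noteq> {}" "closed_segment x y = \<kappa> e" using faceT_pos[OF K(1)] by blast
    have d: "aff_dim e = 1" using kappa_dim[OF e(1,2)] e(3) K(2) by simp
    show ?thesis
    proof (cases "v \<in> e")
      case True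
      obtain M where M: "M \<subseteq> J" "e = \<Phi> M" using Phi_surj[OF e(1) True] by blast
      then have "card M = 1" using Phi_dim[OF M(1)] d by simp
      then obtain i where i: "M = {i}" using card_1_singletonE by blast
      have iJ: "i \<in> J" using M i by simp
      have "i \<in> {0, 1}"
      proof (rule ccontr)
        assume "i \<notin> {0, 1}"
        then have i23: "i \<in> {2, 3}" using iJ by (auto simp: J_def)
        have "a \<bullet> nb i = b" using c_H[of i] c_eq[OF i23] i23 by auto
        then have "closed_segment v (nb i) \<subseteq> {x. a \<bullet> x \<le> b}"
          using v_neg by (intro closed_segment_subset) (auto simp: convex_halfspace_le)
        then show False using e(2) M i Phi_edge[OF iJ] by (auto simp: Hpos_def)
      qed
      then show ?thesis using segment_T[of i] e(3) M i by auto
    next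
      case False
      then have "closed_segment x y = e" using face_subset_Hcl(2)[OF e(1)] e(3) by simp
      moreover then have "x \<noteq> v" "y \<noteq> v" using False by auto
      ultimately show ?thesis using e(1) d by (simp add: edge_of_def)
    qed
  qed
next
  assume "?A \<or> ?B \<or> ?C"
  then show ?L
  proof (elim disjE bexE conjE)
    assume e: "closed_segment x y edge_of P" "x \<noteq> v" "y \<noteq> v"
    then have f: "closed_segment x y face_of P" "aff_dim (closed_segment x y) = 1" by (auto simp: edge_of_def)
    have "v \<notin> closed_segment x y"
      using extreme_point_of_face[OF f(1), of v] v e(2,3) extreme_point_of_segment[of v x y] by (auto simp: vertices_def)
    then show ?thesis using face_subset_Hcl(2)[OF f(1)] kappa_face[OF f(1)] f(2) by (simp add: edge_of_def)
  next
    fix i :: nat assume i: "i \<in> {0, 1}" "{x, y} = {c i, nb i}"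
    then have "{i} \<subseteq> J" by (auto simp: J_def)
    note s = segment_T[OF i(1)] Phi[OF this] Phi_dim[OF this]
    have eq: "closed_segment x y = \<kappa> (\<Phi> {i})" using i(2) s(1) by (simp add: segment_convex_hull)
    show ?thesis unfolding edge_of_def eq
      using s(1)[THEN conjunct2] s(5) kappa_face[OF s(2)] kappa_dim[OF s(2)] by simp
  next
    fix i j assume ij: "i \<in> J" "j \<in> J" "i \<noteq> j" "{x, y} = {c i, c j}"
    have "closed_segment x y = \<sigma> {i, j}" using ij(4) by (simp add: \<sigma>_def segment_convex_hull)
    then show ?thesis using sigma_face_T[of "{i, j}"] sigma_dim[of "{i, j}"] ij by (simp add: edge_of_def)
  qed
qed

lemma E'_iff: "(x, y) \<in> E' \<longleftrightarrow> (x, y) \<in> E \<and> x \<noteq> v \<and> y \<noteq> v \<or> (x, y) \<in> new_arcs"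
proof -
  have "closed_segment x y edge_of T \<longleftrightarrow> x \<noteq> v \<and> y \<noteq> v" if xy: "(x, y) \<in> E"
  proof
    assume "closed_segment x y edge_of T"
    then have "closed_segment x y \<subseteq> T" by (rule edge_of_imp_subset)
    then show "x \<noteq> v \<and> y \<noteq> v" using v_notin_T by auto
  next
    assume "x \<noteq> v \<and> y \<noteq> v"
    moreover have "closed_segment x y edge_of P" using arc[OF xy] by (simp add: edge_of_def)
    ultimately show "closed_segment x y edge_of T" using edge_T_iff by blast
  qed
  moreover have "(x, y) \<in> E' \<longleftrightarrow> (x, y) \<in> E \<and> closed_segment x y edge_of T \<or> (x, y) \<in> new_arcs"
    unfolding E'_def tr_arcs_def new_arcs_def Un_iff by simp
  ultimately show ?thesis by blast
qed

lemma nb_P: "nb 0 \<in> vertices P" "nb 1 \<in> vertices P" "nb 2 \<in> vertices P" "nb 3 \<in> vertices P"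
  using nb_edge(3) by (auto simp: J_def)

lemma nb_distinct: "distinct [v, nb 0, nb 1, nb 2, nb 3]"
  using nb_edge(4)[of 0] nb_edge(4)[of 1] nb_edge(4)[of 2] nb_edge(4)[of 3]
    nb_eq[of 0 1] nb_eq[of 0 2] nb_eq[of 0 3] nb_eq[of 1 2] nb_eq[of 1 3] nb_eq[of 2 3] by (auto simp: J_def)

lemma c01: "c 0 \<notin> vertices P" "c 1 \<notin> vertices P" "c 0 \<noteq> c 1" "c 2 = nb 2" "c 3 = nb 3"
  using c_new(1)[of 0] c_new(1)[of 1] c_inj[of 0 1] c_eq[of 2] c_eq[of 3] by (auto simp: J_def)

lemma c_ne: "x \<in> vertices P \<Longrightarrow> x \<noteq> c 0" "x \<in> vertices P \<Longrightarrow> x \<noteq> c 1"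
  using c01 by auto

lemma E'_old: assumes "x \<in> vertices P" "y \<in> vertices P"
  shows "(x, y) \<in> E' \<longleftrightarrow> (x, y) \<in> E \<and> x \<noteq> v \<and> y \<noteq> v \<or> x = nb 2 \<and> y = nb 3"
  using E'_iff[of x y] c_ne[OF assms(1)] c_ne[OF assms(2)] by (auto simp: new_arcs_def)

lemma E'_c0: "(x, c 0) \<in> E' \<longleftrightarrow> x \<in> {nb 0, nb 2, nb 3}" "(c 0, x) \<in> E' \<longleftrightarrow> x = c 1"
  using E'_iff[of x "c 0"] E'_iff[of "c 0" x] c01 arc[of x "c 0"] arc[of "c 0" x]
    c_ne[OF nb_P(1)] c_ne[OF nb_P(2)] c_ne[OF nb_P(3)] c_ne[OF nb_P(4)] by (auto simp: new_arcs_def)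

lemma E'_c1: "(x, c 1) \<in> E' \<longleftrightarrow> x \<in> {nb 1, nb 2, nb 3, c 0}" "(c 1, x) \<notin> E'"
  using E'_iff[of x "c 1"] E'_iff[of "c 1" x] c01 arc[of x "c 1"] arc[of "c 1" x]
    c_ne[OF nb_P(1)] c_ne[OF nb_P(2)] c_ne[OF nb_P(3)] c_ne[OF nb_P(4)] by (auto simp: new_arcs_def)

lemma nb32: "(nb 3, nb 2) \<notin> E"
  using no_path by blast

lemma edge_23_arc: "closed_segment (nb 2) (nb 3) face_of P \<longleftrightarrow> (nb 2, nb 3) \<in> E"
proof
  assume f: "closed_segment (nb 2) (nb 3) face_of P"
  have "aff_dim (closed_segment (nb 2) (nb 3)) = 1"
    using sigma_dim[of "{2, 3}"] sigma_23 by (simp add: J_def)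
  then show "(nb 2, nb 3) \<in> E" using orient[OF f] nb32 by blast
qed (use arc in blast)

text \<open>The position in the sequence \<open>nb 2\<close>, \<open>nb 3\<close>,
  \<open>c 0\<close>, \<open>c 1\<close>, in which every arc between corners of the section points
  forward.\<close>

definition "ord i = (if i = 2 then 0 else if i = 3 then 1 else i + 2 :: nat)"

lemma E'_c: assumes "i \<in> J" "j \<in> J" shows "(c i, c j) \<in> E' \<longleftrightarrow> ord i < ord j"
proof -
  have irr: "(x, x) \<notin> E" for x using arc(3) by blast
  have ne: "c 0 \<noteq> nb k \<and> c 1 \<noteq> nb k" if "k \<in> J" for k using nb_edge(3)[OF that] c01 by auto
  have ne': "nb 2 \<noteq> c 0" "nb 3 \<noteq> c 0" "nb 2 \<noteq> c 1" "nb 3 \<noteq> c 1" "c 0 \<noteq> nb 0" "c 1 \<noteq> nb 1" "c 1 \<noteq> nb 0"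
    using ne[of 0] ne[of 1] ne[of 2] ne[of 3] by (auto simp: J_def)
  have 22: "(nb 2, nb 2) \<notin> E'" "(nb 3, nb 3) \<notin> E'" "(nb 3, nb 2) \<notin> E'" "(nb 2, nb 3) \<in> E'"
    using E'_old nb_P irr nb32 nb_distinct by auto
  have "i = 0 \<or> i = 1 \<or> i = 2 \<or> i = 3" "j = 0 \<or> j = 1 \<or> j = 2 \<or> j = 3" using assms by (auto simp: J_def)
  then show ?thesis
    using 22 ne' c01(3) c01(3)[symmetric]
    by (elim disjE; hypsubst; simp add: ord_def E'_c0 E'_c1[unfolded One_nat_def] E'_c1 c01(4,5))
qed

lemma polytopal_T: "polytopal_digraph T E'"
  unfolding polytopal_digraph_def
proof (intro conjI allI impI)
  show "polytope T" by (rule T_polytope)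
next
  fix x y assume xy: "(x, y) \<in> E'"
  then consider "(x, y) \<in> E" "x \<noteq> v" "y \<noteq> v" | "(x, y) \<in> new_arcs" using E'_iff by blast
  then show "closed_segment x y edge_of T"
  proof cases
    case 1
    then have "closed_segment x y edge_of P" using arc[OF 1(1)] by (simp add: edge_of_def)
    then show ?thesis using edge_T_iff 1(2,3) by blast
  next
    case 2
    have "(\<exists>i\<in>{0, 1}. {x, y} = {c i, nb i}) \<or> (\<exists>i\<in>J. \<exists>j\<in>J. i \<noteq> j \<and> {x, y} = {c i, c j})"
      using 2 unfolding new_arcs_def J_def c01(4,5)[symmetric]
      by (elim insertE) (auto simp: doubleton_eq_iff)
    then show ?thesis using edge_T_iff by blast
  qed
next
  fix x y assume "closed_segment x y edge_of T"
  then show "(x, y) \<in> E' \<longleftrightarrow> (y, x) \<notin> E'"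
    unfolding edge_T_iff
  proof (elim disjE bexE conjE)
    assume 1: "closed_segment x y edge_of P" "x \<noteq> v" "y \<noteq> v"
    then have f: "closed_segment x y face_of P" "aff_dim (closed_segment x y) = 1" by (auto simp: edge_of_def)
    have xy: "x \<in> vertices P" "y \<in> vertices P"
      using extreme_point_of_face[OF f(1), of x] extreme_point_of_face[OF f(1), of y]
        extreme_point_of_segment[of x x y] extreme_point_of_segment[of y x y] by (auto simp: vertices_def)
    \<comment> \<open>An existing edge between \<open>nb 2\<close> and \<open>nb 3\<close> already
      has the orientation of the new arc, since \<open>no_path\<close> rules out the opposite
      one.\<close>
    have "x = nb 2 \<and> y = nb 3 \<Longrightarrow> (x, y) \<in> E" "y = nb 2 \<and> x = nb 3 \<Longrightarrow> (y, x) \<in> E"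
      using orient[OF f] nb32 by auto
    then show ?thesis using E'_old[OF xy] E'_old[OF xy(2,1)] orient[OF f] 1(2,3) by blast
  next
    fix i :: nat assume 2: "i \<in> {0, 1}" "{x, y} = {c i, nb i}"
    then have "(x = c i \<and> y = nb i) \<or> (x = nb i \<and> y = c i)" by (auto simp: doubleton_eq_iff)
    then show ?thesis using 2(1) E'_c0 E'_c1 c01(1-3) nb_P by (elim disjE insertE) auto
  next
    fix i j assume 3: "i \<in> J" "j \<in> J" "i \<noteq> j" "{x, y} = {c i, c j}"
    have "ord i \<noteq> ord j" using 3(1-3) by (auto simp: ord_def J_def)
    moreover have "(x = c i \<and> y = c j) \<or> (x = c j \<and> y = c i)" using 3(4) by (auto simp: doubleton_eq_iff)
    ultimately show ?thesis using E'_c[OF 3(1,2)] E'_c[OF 3(2,1)] by auto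
  qed
qed

text \<open>The arc from \<open>nb 2\<close> to \<open>nb 3\<close> closes no cycle by
  \<open>no_path\<close>. Then \<open>c 0\<close> and \<open>c 1\<close> are added as sinks, in this
  order because of the arc between them.\<close>

lemma acyclic_T: "acyclic E'"
proof -
  let ?R = "insert (nb 2, nb 3) E" and ?S0 = "{(nb 0, c 0), (nb 2, c 0), (nb 3, c 0)}"
    and ?S1 = "{(nb 1, c 1), (nb 2, c 1), (nb 3, c 1), (c 0, c 1)}"
  have "acyclic ?R" using acyclic no_path by (simp add: acyclic_insert)
  then have "acyclic (?R \<union> ?S0)"
    by (rule acyclic_add_sink[where x = "c 0"]) (use arc(1) c01 nb_P in auto)
  then have "acyclic (?R \<union> ?S0 \<union> ?S1)"
    by (rule acyclic_add_sink[where x = "c 1"]) (use arc(1) c01 nb_P in auto)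
  moreover have "E' \<subseteq> ?R \<union> ?S0 \<union> ?S1" using E'_iff by (auto simp: new_arcs_def)
  ultimately show ?thesis using acyclic_subset by blast
qed

lemma finite_face_arcs: "F face_of P \<Longrightarrow> finite (face_arcs E F)"
proof (rule finite_subset)
  show "face_arcs E F \<subseteq> vertices F \<times> vertices F" by (auto simp: face_arcs_def)
  assume "F face_of P"
  then show "finite (vertices F \<times> vertices F)" using finite_vertices[OF face_polytope] by blast
qed

lemma acyclic_face_arcs: "acyclic (face_arcs E F)"
  using acyclic by (rule acyclic_subset) (auto simp: face_arcs_def)

lemma face_arcs_mono: "(face_arcs E F)\<^sup>* \<subseteq> E\<^sup>*"
  by (rule rtrancl_mono) (auto simp: face_arcs_def)

lemma source_unique: assumes F: "F face_of P" "source_in E F s" "source_in E F s'" shows "s = s'"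
proof -
  have "F \<noteq> {}" using F(2) by (auto simp: source_in_def vertices_def)
  then show ?thesis using uso F unfolding USO_def by blast
qed

lemma sink_unique: assumes F: "F face_of P" "sink_in E F s" "sink_in E F s'" shows "s = s'"
proof -
  have "F \<noteq> {}" using F(2) by (auto simp: sink_in_def vertices_def)
  then show ?thesis using uso F unfolding USO_def by blast
qed

lemma source_reaches:
  assumes F: "F face_of P" "source_in E F s" "y \<in> vertices F"
  shows "(s, y) \<in> (face_arcs E F)\<^sup>*"
proof (rule reach_source[OF finite_face_arcs[OF F(1)] acyclic_face_arcs _ F(3)])
  fix w assume w: "w \<in> vertices F" "w \<noteq> s"
  then have "\<not> source_in E F w" using source_unique[OF F(1,2)] by blast
  then obtain y where "(y, w) \<in> face_arcs E F" using w by (auto simp: source_in_def)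
  then show "\<exists>y\<in>vertices F. (y, w) \<in> face_arcs E F" by (auto simp: face_arcs_iff)
qed

lemma reaches_sink:
  assumes F: "F face_of P" "sink_in E F t" "y \<in> vertices F"
  shows "(y, t) \<in> (face_arcs E F)\<^sup>*"
proof (rule reach_sink[OF finite_face_arcs[OF F(1)] acyclic_face_arcs _ F(3)])
  fix w assume w: "w \<in> vertices F" "w \<noteq> t"
  then have "\<not> sink_in E F w" using sink_unique[OF F(1,2)] by blast
  then obtain y where "(w, y) \<in> face_arcs E F" using w by (auto simp: sink_in_def)
  then show "\<exists>y\<in>vertices F. (w, y) \<in> face_arcs E F" by (auto simp: face_arcs_iff)
qed

section \<open>Lifting the shelling property\<close>

lemma in_edges_T:
  assumes w: "w \<in> vertices P" "w \<noteq> v"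
  shows "in_edges E' w = in_edges E w \<union> (if w = nb 3 then {closed_segment (nb 2) (nb 3)} else {})"
proof -
  have "(x, w) \<in> E' \<longleftrightarrow> (x, w) \<in> E \<or> x = nb 2 \<and> w = nb 3" for x
  proof -
    have "(x, w) \<in> E \<Longrightarrow> x \<noteq> v" using v_out by blast
    moreover have "(x, w) \<in> new_arcs \<longleftrightarrow> x = nb 2 \<and> w = nb 3"
      using c_ne[OF w(1)] by (auto simp: new_arcs_def)
    ultimately show ?thesis using E'_iff[of x w] w(2) by blast
  qed
  then have "{x. (x, w) \<in> E'} = {x. (x, w) \<in> E} \<union> (if w = nb 3 then {nb 2} else {})" by auto
  then show ?thesis unfolding in_edges_def by auto
qed

lemma in_edges_link:
  assumes "e \<in> in_edges E w"
  shows "e \<in> faces_over P 1 {w}" "v \<notin> e \<or> w = v"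
proof -
  obtain x where x: "e = closed_segment x w" "(x, w) \<in> E" using assms by (auto simp: in_edges_def)
  note f = arc[OF x(2)]
  show "e \<in> faces_over P 1 {w}" using f x by (simp add: faces_over_def)
  show "v \<notin> e \<or> w = v"
  proof (rule ccontr)
    assume "\<not> (v \<notin> e \<or> w = v)"
    then have "x = v" using extreme_point_of_face[OF f(4), of v] v x(1) extreme_point_of_segment[of v x w]
      by (auto simp: vertices_def)
    then show False using x(2) v_out by blast
  qed
qed

lemma in_edges_v: "in_edges E v = faces_over P 1 {v}"
proof
  show "in_edges E v \<subseteq> faces_over P 1 {v}" using in_edges_link(1) by blast
  show "faces_over P 1 {v} \<subseteq> in_edges E v"
  proof
    fix e assume "e \<in> faces_over P 1 {v}"
    then have e: "e face_of P" "aff_dim e = 1" "v \<in> e" by (auto simp: faces_over_def)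
    obtain u where u: "u \<in> vertices P" "e = closed_segment v u" using edge_segment(1)[OF P e(1,2) v e(3)] by blast
    then have "u \<in> neighbours P v" using e by (simp add: neighbours_def edge_of_def)
    then obtain i where i: "i \<in> J" "u = nb i" using nb by (auto simp: J_def)
    then have "(u, v) \<in> E" using nb_v_arc by blast
    then show "e \<in> in_edges E v" unfolding in_edges_def u(2) closed_segment_commute[of v] by blast
  qed
qed

text \<open>A source reaches every vertex, but \<open>nb 3\<close> does not reach
  \<open>nb 2\<close>. The prefix at \<open>nb 3\<close> therefore contains an edge of
  \<open>P\<close> even if the arc from \<open>nb 2\<close> is new, so the lifting has a place to
  start.\<close>

lemma nb3_not_source: "in_edges E (nb 3) \<noteq> {}"
proof
  assume "in_edges E (nb 3) = {}"
  then have "(y, nb 3) \<notin> E" for y by (auto simp: in_edges_def)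
  then have "source_in E P (nb 3)" using nb_P(4) by (auto simp: source_in_def face_arcs_def)
  then have "(nb 3, nb 2) \<in> (face_arcs E P)\<^sup>*" using source_reaches[OF P_face] nb_P(3) by blast
  then show False using no_path face_arcs_mono by blast
qed

text \<open>The arcs to \<open>c 0\<close> and \<open>c 1\<close> leave \<open>nb p\<close>, so the
  prefix can contain no new edge except the one between \<open>nb 2\<close> and \<open>nb 3\<close>.
  That one is dropped by the intersection with the old edges, unless it is an edge of
  \<open>P\<close>, and then it is an in-edge already there.\<close>

lemma vertex_shelling_nb:
  fixes p q :: nat
  assumes pq: "p = 2 \<and> q = 3 \<or> p = 3 \<and> q = 2"
    and sh: "vertex_shelling T (nb p) (l1 @ l2)" "set l1 = in_edges E' (nb p)"
  shows "\<exists>l1' l2'. vertex_shelling P (nb p) (l1' @ l2') \<and> set l1' = in_edges E (nb p)"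
proof -
  interpret tl: truncation_link P v a b nb c p q by unfold_locales (rule pq)
  have w: "nb p \<in> vertices P" "nb p \<noteq> v" using tl.w by auto
  have ins: "in_edges E (nb p) \<subseteq> faces_over P 1 {nb p} - {\<Phi> {p}}"
    using in_edges_link[of _ "nb p"] w(2) Phi(2)[OF tl.pJ(4)] by blast
  have eq: "set l1 \<inter> (faces_over P 1 {nb p} - {\<Phi> {p}}) = in_edges E (nb p)"
  proof (cases "nb p = nb 3")
    case True
    have "closed_segment (nb 2) (nb 3) \<in> in_edges E (nb p)"
      if "closed_segment (nb 2) (nb 3) \<in> faces_over P 1 {nb p}"
    proof -
      have "(nb 2, nb 3) \<in> E" using that edge_23_arc by (simp add: faces_over_def)
      then show ?thesis unfolding True in_edges_def by blast
    qed
    then show ?thesis unfolding sh(2) in_edges_T[OF w] using ins True by auto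
  next
    case False
    then show ?thesis unfolding sh(2) in_edges_T[OF w] using ins by auto
  qed
  have "l1 = [] \<or> in_edges E (nb p) \<noteq> {}"
  proof (cases "p = 3")
    case True
    then show ?thesis using nb3_not_source by simp
  next
    case False
    then have "nb p \<noteq> nb 3" using pq nb_distinct by auto
    then have "set l1 = in_edges E (nb p)" using sh(2) in_edges_T[OF w] by simp
    then show ?thesis by auto
  qed
  moreover have "\<sigma> {p, tl.dir i} \<notin> set l1" if i: "i \<in> {0, 1}" for i
  proof
    assume "\<sigma> {p, tl.dir i} \<in> set l1"
    then obtain x where x: "\<sigma> {p, tl.dir i} = closed_segment x (nb p)" "(x, nb p) \<in> E'"
      unfolding sh(2) in_edges_def by blast
    have "tl.dir i = i" using i by (auto simp: tl.dir_def)
    then have "closed_segment x (nb p) = closed_segment (nb p) (c i)"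
      using x(1) tl.w(3) by (simp add: \<sigma>_def segment_convex_hull)
    then have "{x, nb p} = {nb p, c i}" by simp
    moreover have "c i \<noteq> nb p" using c_new(1)[OF i] w(1) by metis
    ultimately have "x = c i" by (auto simp: doubleton_eq_iff)
    then show False using x(2) i E'_c0(2)[of "nb p"] E'_c1(2)[of "nb p"] c_ne(2)[OF w(1)] by auto
  qed
  ultimately show ?thesis
    using tl.vertex_shelling_lift[OF sh(1)] unfolding eq by simp
qed

lemma shelling_property_lift:
  assumes "shelling_property T E'"
  shows "shelling_property P E"
proof (rule shelling_propertyI[OF P P4 G acyclic uso])
  fix w assume w: "w \<in> vertices P"
  show "\<exists>l1 l2. vertex_shelling P w (l1 @ l2) \<and> set l1 = in_edges E w"
  proof (cases "w = v")
    case True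
    obtain l where l: "vertex_shelling P v (l @ [])" using vertex_shelling_v by blast
    then have "set l = in_edges E v" by (simp add: vertex_shelling_def link_shelling_def in_edges_v)
    then show ?thesis using l True by blast
  next
    case False
    have "w \<in> vertices T" using w False vertices_T by blast
    then obtain l1 l2 where l: "vertex_shelling T w (l1 @ l2)" "set l1 = in_edges E' w"
      using shelling_property_imp[OF T_polytope T_dim polytopal_T assms] by blast
    consider "w = nb 2" | "w = nb 3" | "w \<notin> {v, nb 2, nb 3}" using False by blast
    then show ?thesis
    proof cases
      case 1
      then show ?thesis using vertex_shelling_nb[of 2 3 l1 l2] l by simp
    next
      case 2
      then show ?thesis using vertex_shelling_nb[of 3 2 l1 l2] l by simp
    next
      case 3
      have "\<kappa> e = e" if "e \<in> in_edges E w" for e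
      proof -
        have "e face_of P" using in_edges_link(1)[OF that] by (simp add: faces_over_def)
        then show ?thesis using face_subset_Hcl(2) in_edges_link(2)[OF that] False by blast
      qed
      then have "\<kappa> ` in_edges E w = in_edges E w" by (force simp: image_iff)
      moreover have "in_edges E' w = in_edges E w" using in_edges_T[OF w False] 3 by simp
      ultimately have "set l1 = \<kappa> ` in_edges E w" using l(2) by simp
      then show ?thesis using vertex_shelling_ordinary[OF w 3 l(1)] in_edges_link(1) by blast
    qed
  qed
qed

end

section \<open>The Holt-Klee property of the truncated digraph\<close>

lemma paths_transfer:
  assumes ps: "finite ps" "int (card ps) = k" "\<And>p. p \<in> ps \<Longrightarrow> directed_path A s t p"
      "pairwise (\<lambda>p q. set p \<inter> set q = {s, t}) ps"
    and f: "\<And>p. p \<in> ps \<Longrightarrow> directed_path A' s' t' (f p)" "inj_on f ps"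
      "\<And>p q. p \<in> ps \<Longrightarrow> q \<in> ps \<Longrightarrow> p \<noteq> q \<Longrightarrow> set p \<inter> set q = {s, t} \<Longrightarrow> set (f p) \<inter> set (f q) \<subseteq> {s', t'}"
  shows "\<exists>ps. finite ps \<and> int (card ps) = k \<and> (\<forall>p\<in>ps. directed_path A' s' t' p) \<and>
    pairwise (\<lambda>p q. set p \<inter> set q = {s', t'}) ps"
proof (intro exI conjI ballI)
  show "finite (f ` ps)" "int (card (f ` ps)) = k" using ps f(2) by (simp_all add: card_image)
  show "directed_path A' s' t' p" if "p \<in> f ` ps" for p using that f(1) by blast
  have st: "{s', t'} \<subseteq> set (f p)" if "p \<in> ps" for p
    using f(1)[OF that] unfolding directed_path_def by (metis bot.extremum hd_in_set insert_subset last_in_set)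
  show "pairwise (\<lambda>p q. set p \<inter> set q = {s', t'}) (f ` ps)"
    unfolding pairwise_def
  proof (intro ballI impI)
    fix x y assume "x \<in> f ` ps" "y \<in> f ` ps" "x \<noteq> y"
    then obtain p q where pq: "p \<in> ps" "q \<in> ps" "x = f p" "y = f q" "p \<noteq> q" by blast
    then have "set p \<inter> set q = {s, t}" using ps(4) by (auto simp: pairwise_def)
    then show "set x \<inter> set y = {s', t'}" using f(3)[OF pq(1,2,5)] st pq by blast
  qed
qed

lemma source_in_iff: "source_in E F s \<longleftrightarrow> s \<in> vertices F \<and> (\<forall>w\<in>vertices F. (w, s) \<notin> E)"
  by (auto simp: source_in_def face_arcs_iff)

lemma sink_in_iff: "sink_in E F s \<longleftrightarrow> s \<in> vertices F \<and> (\<forall>w\<in>vertices F. (s, w) \<notin> E)"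
  by (auto simp: sink_in_def face_arcs_iff)

text \<open>Bundles the USO and Holt-Klee conditions of a single face, so that each kind of face of
  \<open>T\<close> can be treated in one go; the equivalences express uniqueness of source and
  sink.\<close>

definition face_ok :: "('a::euclidean_space \<times> 'a) set \<Rightarrow> 'a set \<Rightarrow> bool" where
  "face_ok E F \<longleftrightarrow> (\<exists>s t. (\<forall>w. source_in E F w \<longleftrightarrow> w = s) \<and> (\<forall>w. sink_in E F w \<longleftrightarrow> w = t) \<and>
     (\<exists>ps. finite ps \<and> int (card ps) = aff_dim F \<and>
              (\<forall>p\<in>ps. directed_path (face_arcs E F) s t p) \<and>
              pairwise (\<lambda>p q. set p \<inter> set q = {s, t}) ps))"

lemma face_okI:
  assumes "\<And>w. source_in E F w \<longleftrightarrow> w = s" "\<And>w. sink_in E F w \<longleftrightarrow> w = t"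
    and "\<exists>ps. finite ps \<and> int (card ps) = aff_dim F \<and> (\<forall>p\<in>ps. directed_path (face_arcs E F) s t p) \<and>
              pairwise (\<lambda>p q. set p \<inter> set q = {s, t}) ps"
  shows "face_ok E F"
  unfolding face_ok_def using assms by (rule_tac exI[of _ s], rule_tac exI[of _ t], intro conjI allI) simp_all

lemma holt_klee_iff: "holt_klee P E \<longleftrightarrow> (\<forall>F. F face_of P \<and> F \<noteq> {} \<longrightarrow> face_ok E F)"
proof
  assume hk: "holt_klee P E"
  show "\<forall>F. F face_of P \<and> F \<noteq> {} \<longrightarrow> face_ok E F"
  proof (intro allI impI)
    fix F assume F: "F face_of P \<and> F \<noteq> {}"
    then obtain s t where st: "source_in E F s" "\<And>w. source_in E F w \<Longrightarrow> w = s"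
      "sink_in E F t" "\<And>w. sink_in E F w \<Longrightarrow> w = t"
      using hk unfolding holt_klee_def USO_def by metis
    have "\<exists>ps. finite ps \<and> int (card ps) = aff_dim F \<and> (\<forall>p\<in>ps. directed_path (face_arcs E F) s t p) \<and>
              pairwise (\<lambda>p q. set p \<inter> set q = {s, t}) ps"
      using hk[unfolded holt_klee_def, THEN conjunct2, rule_format, of F s t] F st(1,3) by simp
    then show "face_ok E F" by (rule face_okI[rotated 2]) (use st in blast)+
  qed
next
  assume ok: "\<forall>F. F face_of P \<and> F \<noteq> {} \<longrightarrow> face_ok E F"
  show "holt_klee P E" unfolding holt_klee_def USO_def
  proof (intro conjI allI impI)
    fix F assume "F face_of P \<and> F \<noteq> {}"
    then have "face_ok E F" using ok by blast
    then show "\<exists>!s. source_in E F s" "\<exists>!t. sink_in E F t" unfolding face_ok_def by auto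
  next
    fix F s t assume *: "F face_of P \<and> source_in E F s \<and> sink_in E F t"
    then have "F \<noteq> {}" by (auto simp: source_in_def vertices_def)
    then have "face_ok E F" using ok * by blast
    then show "\<exists>ps. finite ps \<and> int (card ps) = aff_dim F \<and> (\<forall>p\<in>ps. directed_path (face_arcs E F) s t p) \<and>
              pairwise (\<lambda>p q. set p \<inter> set q = {s, t}) ps"
      using * unfolding face_ok_def by metis
  qed
qed

context truncation_digraph
begin

lemma face_ok_P: "F face_of P \<Longrightarrow> F \<noteq> {} \<Longrightarrow> face_ok E F"
  using hk holt_klee_iff by blast

lemma vertices_sigma: assumes "M \<subseteq> J" shows "vertices (\<sigma> M) = c ` M"
proof -
  have "\<not> affine_dependent (c ` M)" using c_independent(1) assms affine_independent_subset image_mono by metis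
  then show ?thesis
    unfolding vertices_def \<sigma>_def using extreme_point_of_convex_hull_affine_independent by blast
qed

lemma ord_inj: "i \<in> J \<Longrightarrow> j \<in> J \<Longrightarrow> ord i = ord j \<Longrightarrow> i = j"
  by (auto simp: ord_def J_def)

text \<open>On the section the digraph is a transitive tournament.\<close>

lemma face_ok_sigma: assumes M: "M \<subseteq> J" "M \<noteq> {}" shows "face_ok E' (\<sigma> M)"
proof -
  have fin: "finite M" using M(1) finite_subset by (auto simp: J_def)
  have V: "vertices (\<sigma> M) = c ` M" by (rule vertices_sigma[OF M(1)])
  obtain i where i: "i \<in> M" "\<And>j. j \<in> M \<Longrightarrow> ord i \<le> ord j"
    using ex_has_least_nat[of "\<lambda>i. i \<in> M" _ ord] M(2) by blast
  obtain k where k: "k \<in> M" "\<And>j. j \<in> M \<Longrightarrow> ord j \<le> ord k"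
  proof -
    have "ord ` M \<noteq> {}" "finite (ord ` M)" using M(2) fin by auto
    then have "Max (ord ` M) \<in> ord ` M" by (rule Max_in[rotated])
    then obtain k where "k \<in> M" "ord k = Max (ord ` M)" by auto
    then show thesis using that[of k] fin by simp
  qed
  have arc': "(c j, c l) \<in> E' \<longleftrightarrow> ord j < ord l" if "j \<in> M" "l \<in> M" for j l
    using E'_c that M(1) by blast
  have lt_i: "ord i < ord j" if "j \<in> M" "j \<noteq> i" for j
    using i(2)[OF that(1)] ord_inj[of i j] i(1) that M(1) by (metis le_neq_implies_less subsetD)
  have lt_k: "ord j < ord k" if "j \<in> M" "j \<noteq> k" for j
    using k(2)[OF that(1)] ord_inj[of j k] k(1) that M(1) by (metis le_neq_implies_less subsetD)
  have src: "source_in E' (\<sigma> M) w \<longleftrightarrow> w = c i" for w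
  proof
    assume "source_in E' (\<sigma> M) w"
    then obtain j where j: "j \<in> M" "w = c j" "(c i, c j) \<notin> E'" unfolding source_in_iff V using i(1) by blast
    then have "\<not> ord i < ord j" using arc'[OF i(1) j(1)] by blast
    then show "w = c i" using lt_i[OF j(1)] j(2) by blast
  next
    assume "w = c i"
    moreover have "(c j, c i) \<notin> E'" if "j \<in> M" for j using arc'[OF that i(1)] i(2)[OF that] by simp
    ultimately show "source_in E' (\<sigma> M) w" unfolding source_in_iff V using i(1) by blast
  qed
  have snk: "sink_in E' (\<sigma> M) w \<longleftrightarrow> w = c k" for w
  proof
    assume "sink_in E' (\<sigma> M) w"
    then obtain j where j: "j \<in> M" "w = c j" "(c j, c k) \<notin> E'" unfolding sink_in_iff V using k(1) by blast
    then have "\<not> ord j < ord k" using arc'[OF j(1) k(1)] by blast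
    then show "w = c k" using lt_k[OF j(1)] j(2) by blast
  next
    assume "w = c k"
    moreover have "(c k, c j) \<notin> E'" if "j \<in> M" for j using arc'[OF k(1) that] k(2)[OF that] by simp
    ultimately show "sink_in E' (\<sigma> M) w" unfolding sink_in_iff V using k(1) by blast
  qed
  have c_inj': "c j = c l \<longleftrightarrow> j = l" if "j \<in> M" "l \<in> M" for j l using c_inj that M(1) by blast
  \<comment> \<open>The paths are the direct arc, encoded by \<open>j = k\<close>, and one detour
    through each remaining vertex. They number \<open>card M - 1\<close>, the dimension of the
    simplex.\<close>
  define f where "f j = (if j = k then [c i, c k] else [c i, c j, c k])" for j
  have "\<exists>ps. finite ps \<and> int (card ps) = aff_dim (\<sigma> M) \<and>
              (\<forall>p\<in>ps. directed_path (face_arcs E' (\<sigma> M)) (c i) (c k) p) \<and>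
              pairwise (\<lambda>p q. set p \<inter> set q = {c i, c k}) ps"
  proof (intro exI[of _ "f ` (M - {i})"] conjI ballI)
    show "finite (f ` (M - {i}))" using fin by simp
    have "inj_on f (M - {i})"
      by (rule inj_onI) (auto simp: f_def c_inj' k(1) split: if_splits)
    then have "card (f ` (M - {i})) = card M - 1" using i(1) fin by (simp add: card_image)
    moreover have "card M \<ge> 1" using fin M(2) by (simp add: Suc_le_eq card_gt_0_iff)
    ultimately show "int (card (f ` (M - {i}))) = aff_dim (\<sigma> M)" using sigma_dim[OF M(1)] by simp
  next
    fix p assume "p \<in> f ` (M - {i})"
    then obtain j where j: "j \<in> M" "j \<noteq> i" "p = f j" by blast
    have ik: "i \<noteq> k" using lt_i[OF j(1,2)] k(2)[OF j(1)] by auto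
    have "(c i, c k) \<in> face_arcs E' (\<sigma> M)" "(c i, c j) \<in> face_arcs E' (\<sigma> M)"
      using arc'[OF i(1) k(1)] arc'[OF i(1) j(1)] lt_i[OF k(1)] lt_i[OF j(1,2)] ik i(1) j(1) k(1)
      by (auto simp: face_arcs_iff V)
    moreover have "j \<noteq> k \<Longrightarrow> (c j, c k) \<in> face_arcs E' (\<sigma> M)"
      using arc'[OF j(1) k(1)] lt_k[OF j(1)] j(1) k(1) by (auto simp: face_arcs_iff V)
    ultimately show "directed_path (face_arcs E' (\<sigma> M)) (c i) (c k) p"
      using ik j i(1) k(1) by (auto simp: directed_path_def f_def c_inj')
  next
    show "pairwise (\<lambda>p q. set p \<inter> set q = {c i, c k}) (f ` (M - {i}))"
      unfolding pairwise_def by (auto simp: f_def c_inj' split: if_splits)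
  qed
  then show ?thesis by (rule face_okI[OF src snk])
qed

text \<open>If a face avoiding \<open>v\<close> contains \<open>nb 2\<close> and
  \<open>nb 3\<close>, the segment between them is an edge of \<open>P\<close> by
  \<open>edge_23\<close>, so no arc of the face is new.\<close>

lemma face_ok_old: assumes F: "F face_of P" "F \<noteq> {}" "v \<notin> F" shows "face_ok E' F"
proof -
  have VF: "vertices F = vertices P \<inter> F" by (rule vertices_face[OF F(1)])
  have eq: "face_arcs E' F = face_arcs E F"
  proof -
    have "(x, y) \<in> face_arcs E' F \<longleftrightarrow> (x, y) \<in> face_arcs E F" for x y
    proof (cases "x \<in> vertices F \<and> y \<in> vertices F")
      case True
      then have xy: "x \<in> vertices P" "y \<in> vertices P" "x \<noteq> v" "y \<noteq> v" using VF F(3) by auto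
      have "x = nb 2 \<and> y = nb 3 \<Longrightarrow> (x, y) \<in> E"
        using edge_23[OF F(1,3)] edge_23_arc True VF by auto
      then show ?thesis using E'_old[OF xy(1,2)] xy(3,4) by (auto simp: face_arcs_iff)
    qed (auto simp: face_arcs_iff)
    then show ?thesis by auto
  qed
  have "face_ok E F" using face_ok_P F by blast
  then show ?thesis unfolding face_ok_def source_in_def sink_in_def eq .
qed

end

lemma successively_set:
  assumes "successively (\<lambda>x y. (x, y) \<in> A) p" "p \<noteq> []" "hd p \<in> W" "\<And>x y. (x, y) \<in> A \<Longrightarrow> y \<in> W"
  shows "set p \<subseteq> W"
  using assms(1-3)
proof (induction p)
  case (Cons x p)
  then show ?case using assms(4) by (cases p) auto
qed simp

lemma successively_reaches_last:
  assumes "successively (\<lambda>x y. (x, y) \<in> A) p" "x \<in> set p"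
  shows "(x, last p) \<in> A\<^sup>*"
  using assms
proof (induction p arbitrary: x)
  case (Cons y p)
  show ?case
  proof (cases "p = []")
    case False
    then have s: "(y, hd p) \<in> A" "successively (\<lambda>x y. (x, y) \<in> A) p"
      using Cons.prems(1) by (auto simp: successively_Cons)
    have "(y, last p) \<in> A\<^sup>*"
      using converse_rtrancl_into_rtrancl[OF s(1) Cons.IH[OF s(2) hd_in_set[OF False]]] .
    then show ?thesis using Cons.IH[OF s(2)] Cons.prems(2) False by auto
  qed (use Cons.prems in simp)
qed simp

context truncation_digraph
begin

lemma nopos_ray: assumes "i \<in> {2, 3}" shows "\<Phi> {i} \<inter> Hpos = {}"
proof -
  have "i \<in> J" using assms by (auto simp: J_def)
  have "a \<bullet> nb i = b" using c_H[of i] c_eq[OF assms] assms by auto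
  then have "closed_segment v (nb i) \<subseteq> {x. a \<bullet> x \<le> b}"
    using v_neg by (intro closed_segment_subset) (auto simp: convex_halfspace_le)
  then show ?thesis using Phi_edge[OF \<open>i \<in> J\<close>] by (auto simp: Hpos_def)
qed

lemma nopos_empty: "\<Phi> {} \<inter> Hpos = {}"
proof -
  have "aff_dim (\<Phi> {}) = 0" using Phi_dim[of "{}"] by simp
  then obtain z where "\<Phi> {} = {z}" using aff_dim_eq_0 by blast
  then have "\<Phi> {} = {v}" using Phi(2)[of "{}"] by auto
  then show ?thesis using v_neg by (auto simp: Hpos_def)
qed

lemma pos_dirs: assumes M: "M \<subseteq> J" "\<Phi> M \<inter> Hpos \<noteq> {}" shows "0 \<in> M \<or> 1 \<in> M \<or> M = {2, 3}"
proof (rule ccontr)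
  assume no: "\<not> ?thesis"
  then have "M \<subseteq> {2, 3}" using M(1) by (auto simp: J_def)
  then have "M = {} \<or> M = {2} \<or> M = {3} \<or> M = {2, 3}" by blast
  then show False using no M(2) nopos_empty nopos_ray[of 2] nopos_ray[of 3] by auto
qed

lemma vertices_cut:
  assumes M: "M \<subseteq> J"
  shows "vertices (\<kappa> (\<Phi> M)) = vertices P \<inter> \<Phi> M - {v} \<union> c ` (M \<inter> {0, 1})"
proof -
  have "vertices (\<kappa> (\<Phi> M)) = vertices T \<inter> \<kappa> (\<Phi> M)" by (rule vertices_face[OF kappa_face[OF Phi(1)[OF M]]])
  moreover have "w \<in> Hcl" if "w \<in> vertices P" "w \<noteq> v" for w
    using vertex_nonneg[OF that] by (simp add: Hcl_def)
  moreover have "c i \<in> \<kappa> (\<Phi> M) \<longleftrightarrow> i \<in> M" if "i \<in> {0, 1}" for i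
    using Phi_c[OF M, of i] c_H[of i] that by (auto simp: \<kappa>_def Hcl_def J_def)
  ultimately show ?thesis unfolding vertices_T by (auto simp: \<kappa>_def)
qed

text \<open>The source stays, and the sink \<open>v\<close> is replaced by the last corner of the
  section, in the order \<open>ord\<close>, among those indexed by \<open>M\<close>. In each path to
  \<open>v\<close> the final vertex is exchanged for a tail among these corners, chosen such that
  the new paths still share only their ends.\<close>

lemma face_ok_cut:
  assumes M: "M \<subseteq> J" and pos: "\<Phi> M \<inter> Hpos \<noteq> {}"
  shows "face_ok E' (\<kappa> (\<Phi> M))"
proof -
  let ?G = "\<Phi> M" and ?K = "\<kappa> (\<Phi> M)"
  note F = Phi(1)[OF M]
  have VG: "vertices ?G = vertices P \<inter> ?G" by (rule vertices_face[OF F])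
  have VK: "vertices ?K = vertices ?G - {v} \<union> c ` (M \<inter> {0, 1})" using vertices_cut[OF M] VG by simp
  have cases: "0 \<in> M \<or> 1 \<in> M \<or> M = {2, 3}" by (rule pos_dirs[OF M pos])
  have nbM: "nb i \<in> vertices ?G \<longleftrightarrow> i \<in> M" if "i \<in> J" for i
    using VG nb_edge(3)[OF that] Phi_nb[OF M that] by blast
  have nbK: "nb i \<in> vertices ?K" if "i \<in> M" for i
    using nbM[of i] that M VK nb_edge(4)[of i] by blast
  have cK: "c i \<in> vertices ?K \<longleftrightarrow> i \<in> M" if "i \<in> {0, 1}" for i
  proof -
    have "c i \<in> vertices ?K \<longleftrightarrow> (\<exists>j\<in>M. j \<in> {0, 1} \<and> c i = c j)" using VK VG c_new(1)[OF that] by auto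
    then show ?thesis using c_inj[of i] M that by (auto simp: J_def)
  qed
  have vG: "v \<in> vertices ?G" using VG v Phi(2)[OF M] by blast
  have vsink: "sink_in E ?G v" unfolding sink_in_iff using vG v_out by blast
  obtain s t0 where st: "\<And>w. source_in E ?G w \<longleftrightarrow> w = s" "\<And>w. sink_in E ?G w \<longleftrightarrow> w = t0"
    and ex: "\<exists>ps. finite ps \<and> int (card ps) = aff_dim ?G \<and>
         (\<forall>p\<in>ps. directed_path (face_arcs E ?G) s t0 p) \<and> pairwise (\<lambda>p q. set p \<inter> set q = {s, t0}) ps"
    using face_ok_P[OF F] Phi(2)[OF M] unfolding face_ok_def by blast
  have t0: "t0 = v" using st(2) vsink by simp
  have s: "source_in E ?G s" using st(1) by simp
  have sG: "s \<in> vertices ?G" using s by (simp add: source_in_iff)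
  obtain m where m: "m \<in> M" "m \<in> J" using cases M by (metis insertI1 subsetD)
  have sv: "s \<noteq> v" using s m nbM[OF m(2)] nb_v_arc[OF m(2)] by (auto simp: source_in_iff)
  have out: "\<exists>y\<in>vertices ?G. (w, y) \<in> E" if "w \<in> vertices ?G" "w \<noteq> v" for w
    using st(2)[of w] t0 that by (auto simp: sink_in_iff)
  have into: "\<exists>y\<in>vertices ?G. (y, w) \<in> E" if "w \<in> vertices ?G" "w \<noteq> s" for w
    using st(1)[of w] that by (auto simp: source_in_iff)
  have oldE: "(x, y) \<in> E'" if "(x, y) \<in> E" "y \<noteq> v" for x y
    using that v_out E'_iff by blast
  have no32: "(nb 3, nb 2) \<notin> (face_arcs E ?G)\<^sup>*" using no_path face_arcs_mono by blast
  \<comment> \<open>This lets the source survive the new arc from \<open>nb 2\<close> into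
    \<open>nb 3\<close>.\<close>
  have s3: "s \<noteq> nb 3" if "2 \<in> M"
  proof
    assume "s = nb 3"
    then have "(nb 3, nb 2) \<in> (face_arcs E ?G)\<^sup>*"
      using source_reaches[OF F s, of "nb 2"] nbM[of 2] that by (auto simp: J_def)
    then show False using no32 by blast
  qed
  have src: "source_in E' ?K w \<longleftrightarrow> w = s" for w
  proof
    assume w: "source_in E' ?K w"
    show "w = s"
    proof (rule ccontr)
      assume ws: "w \<noteq> s"
      have "w \<in> vertices ?K" using w by (simp add: source_in_iff)
      then consider "w \<in> vertices ?G" "w \<noteq> v" | i where "i \<in> M" "i \<in> {0, 1}" "w = c i" using VK by blast
      then show False
      proof cases
        case 1
        then obtain y where y: "y \<in> vertices ?G" "(y, w) \<in> E" using into ws by blast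
        then have "y \<noteq> v" using v_out by blast
        then have "y \<in> vertices ?K" "(y, w) \<in> E'" using VK y 1 oldE by auto
        then show False using w by (auto simp: source_in_iff)
      next
        case 2
        then have "(nb i, w) \<in> E'" using E'_c0(1) E'_c1(1) by auto
        then show False using w nbK[OF 2(1)] by (auto simp: source_in_iff)
      qed
    qed
  next
    assume ws: "w = s"
    have "s \<in> vertices P" using sG VG by blast
    moreover have "(y, s) \<notin> E'" if y: "y \<in> vertices ?K" for y
    proof
      assume ys: "(y, s) \<in> E'"
      have "(y, s) \<in> new_arcs \<longleftrightarrow> y = nb 2 \<and> s = nb 3"
        using c_ne[OF \<open>s \<in> vertices P\<close>] by (auto simp: new_arcs_def)
      then consider "(y, s) \<in> E" "y \<noteq> v" | "y = nb 2" "s = nb 3" using E'_iff ys by blast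
      then show False
      proof cases
        case 1
        then have "y \<in> vertices ?G" using y VK arc(1)[OF 1(1)] c_new(1) by auto
        then show False using s 1 by (auto simp: source_in_iff)
      next
        case 2
        then have "nb 2 \<in> vertices ?G" using y VK c_ne[OF nb_P(3)] by auto
        then have "2 \<in> M" using nbM[of 2] by (simp add: J_def)
        then show False using s3 2 by blast
      qed
    qed
    ultimately show "source_in E' ?K w" using ws sG sv VK by (auto simp: source_in_iff)
  qed
  define t where "t = (if 1 \<in> M then c 1 else if 0 \<in> M then c 0 else nb 3)"
  have e23: "(nb 2, nb 3) \<in> E'" using E'_iff by (simp add: new_arcs_def)
  have t_nb: "(nb i, t) \<in> E' \<or> i \<in> {0, 1} \<and> (nb i, c i) \<in> E' \<or> nb i = t" if i: "i \<in> M" for i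
  proof -
    consider "i = 0" | "i = 1" | "i = 2 \<or> i = 3" using i M by (auto simp: J_def)
    then show ?thesis
    proof cases
      case 3
      then show ?thesis using E'_c0(1)[of "nb i"] E'_c1(1)[of "nb i"] e23 unfolding t_def by auto
    qed (use E'_c0(1) E'_c1(1) in auto)
  qed
  have tK: "t \<in> vertices ?K" using cases cK[of 0] cK[of 1] nbK[of 3] by (auto simp: t_def)
  have snk: "sink_in E' ?K w \<longleftrightarrow> w = t" for w
  proof
    assume w: "sink_in E' ?K w"
    show "w = t"
    proof (rule ccontr)
      assume wt: "w \<noteq> t"
      have "w \<in> vertices ?K" using w by (simp add: sink_in_iff)
      then consider "w \<in> vertices ?G" "w \<noteq> v" | i where "i \<in> M" "i \<in> {0, 1}" "w = c i" using VK by blast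
      then show False
      proof cases
        case 1
        then obtain y where y: "y \<in> vertices ?G" "(w, y) \<in> E" using out by blast
        show False
        proof (cases "y = v")
          case True
          then obtain i where i: "i \<in> J" "w = nb i" using v_in y by blast
          then have "i \<in> M" using nbM 1 by blast
          then have "(w, t) \<in> E' \<or> i \<in> {0, 1} \<and> (w, c i) \<in> E'" using t_nb[of i] i wt by blast
          then show False using w tK cK[of i] \<open>i \<in> M\<close> by (auto simp: sink_in_iff)
        next
          case False
          then have "y \<in> vertices ?K" "(w, y) \<in> E'" using VK y oldE by auto
          then show False using w by (auto simp: sink_in_iff)
        qed
      next
        case 2
        have "1 \<in> M"
        proof (rule ccontr)
          assume no: "1 \<notin> M"
          then have "i = 0" using 2(1,2) by auto
          then have "t = c i" unfolding t_def if_not_P[OF no] using 2(1) by simp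
          then show False using wt 2(3) by simp
        qed
        then have "t = c 1" by (simp add: t_def)
        then have "i = 0" using wt 2(2,3) by auto
        then have "(w, c 1) \<in> E'" "c 1 \<in> vertices ?K" using E'_c0(2) 2(3) cK[of 1] \<open>1 \<in> M\<close> by auto
        then show False using w by (auto simp: sink_in_iff)
      qed
    qed
  next
    assume w: "w = t"
    have "(t, y) \<notin> E'" if y: "y \<in> vertices ?K" for y
    proof
      assume ty: "(t, y) \<in> E'"
      consider "1 \<in> M" | "1 \<notin> M" "0 \<in> M" | "M = {2, 3}" using cases by blast
      then show False
      proof cases
        case 1
        then show False using ty E'_c1(2) by (simp add: t_def)
      next
        case 2
        then have "y = c 1" using ty E'_c0(2) by (simp add: t_def)
        then show False using y cK[of 1] 2 by simp
      next
        case 3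
        then have t3: "t = nb 3" by (simp add: t_def)
        have yG: "y \<in> vertices ?G" "y \<noteq> v" using y VK 3 by auto
        then have yP: "y \<in> vertices P" using VG by blast
        \<comment> \<open>An arc of \<open>P\<close> from \<open>nb 3\<close> to a vertex
          \<open>y\<close> of the face other than \<open>v\<close> could be continued towards
          \<open>v\<close>, hence to \<open>nb 2\<close> or back to \<open>nb 3\<close>, against
          \<open>no_path\<close> or acyclicity.\<close>
        have yE: "(nb 3, y) \<in> E" using E'_old[OF nb_P(4) yP] ty t3 nb_distinct by auto
        have arc3: "(nb 3, y) \<in> face_arcs E ?G" using yE yG nbM[of 3] 3 by (simp add: face_arcs_iff J_def)
        have "(y, v) \<in> (face_arcs E ?G)\<^sup>*" by (rule reaches_sink[OF F vsink yG(1)])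
        then obtain z where z: "(y, z) \<in> (face_arcs E ?G)\<^sup>*" "(z, v) \<in> face_arcs E ?G"
          using yG(2) by (metis rtranclE)
        then obtain i where i: "i \<in> J" "z = nb i" using v_in[of z] by (auto simp: face_arcs_iff)
        then have "i \<in> M" using z(2) nbM by (auto simp: face_arcs_iff)
        then consider "z = nb 2" | "z = nb 3" using i 3 by auto
        then show False
        proof cases
          case 1
          then show False using no32 arc3 z(1) by (metis converse_rtrancl_into_rtrancl)
        next
          case 2
          then have "(nb 3, nb 3) \<in> (face_arcs E ?G)\<^sup>+" using arc3 z(1) by (meson rtrancl_into_trancl2)
          then show False using acyclic_face_arcs unfolding acyclic_def by blast
        qed
      qed
    qed
    then show "sink_in E' ?K w" using w tK by (auto simp: sink_in_iff)
  qed
  obtain ps where ps: "finite ps" "int (card ps) = aff_dim ?G"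
    "\<And>p. p \<in> ps \<Longrightarrow> directed_path (face_arcs E ?G) s v p" "pairwise (\<lambda>p q. set p \<inter> set q = {s, v}) ps"
    using ex t0 by blast
  \<comment> \<open>\<open>nb 0\<close> has no arc to \<open>c 1\<close>, so its tail runs through
    \<open>c 0\<close>. Otherwise a single arc reaches the sink, except for a path that ends at
    \<open>nb 3\<close> when this is the sink itself.\<close>
  define ext where "ext l = (if 1 \<in> M then (if l = nb 0 then [c 0, c 1] else [c 1])
     else if 0 \<in> M then [c 0] else if l = nb 3 then [] else [nb 3])" for l
  define f where "f p = butlast p @ ext (last (butlast p))" for p
  have path: "p = butlast p @ [v]" "butlast p \<noteq> []" "hd (butlast p) = s" "distinct (butlast p)" "v \<notin> set (butlast p)"
      "successively (\<lambda>x y. (x, y) \<in> face_arcs E ?G) (butlast p)" "\<exists>i\<in>M. last (butlast p) = nb i"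
      "set (butlast p) \<subseteq> vertices ?G" if "p \<in> ps" for p
  proof -
    have d: "p \<noteq> []" "hd p = s" "last p = v" "distinct p" "successively (\<lambda>x y. (x, y) \<in> face_arcs E ?G) p"
      using ps(3)[OF that] by (auto simp: directed_path_def)
    show p: "p = butlast p @ [v]" using d(1,3) by (metis append_butlast_last_id)
    show ne: "butlast p \<noteq> []" using p d(2) sv by (metis append_Nil list.sel(1))
    show h: "hd (butlast p) = s" using p ne d(2) by (metis hd_append2)
    show "distinct (butlast p)" using d(4) by (simp add: distinct_butlast)
    show "v \<notin> set (butlast p)" using p d(4) by (metis distinct_append disjoint_iff list.set_intros(1))
    have sc: "successively (\<lambda>x y. (x, y) \<in> face_arcs E ?G) (butlast p)"
      "(last (butlast p), v) \<in> face_arcs E ?G"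
      using d(5) ne successively_append_iff[of _ "butlast p" "[v]"] p[symmetric] by auto
    show "successively (\<lambda>x y. (x, y) \<in> face_arcs E ?G) (butlast p)" by (fact sc)
    show "\<exists>i\<in>M. last (butlast p) = nb i"
      using sc(2) v_in[of "last (butlast p)"] nbM by (auto simp: face_arcs_iff)
    show "set (butlast p) \<subseteq> vertices ?G"
      by (rule successively_set[OF sc(1) ne]) (use h sG in \<open>auto simp: face_arcs_iff\<close>)
  qed
  have old_set: "c 0 \<notin> set (butlast p)" "c 1 \<notin> set (butlast p)" "set (butlast p) \<subseteq> vertices ?K" if "p \<in> ps" for p
    using path(8)[OF that] path(5)[OF that] VG VK c01 by auto
  \<comment> \<open>A path that ends at \<open>nb 2\<close> cannot have visited \<open>nb 3\<close>,
    so appending \<open>nb 3\<close> keeps its vertices distinct.\<close>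
  have no3: "nb 3 \<notin> set (butlast p)" if "p \<in> ps" "last (butlast p) = nb 2" for p
    using successively_reaches_last[OF path(6)[OF that(1)], of "nb 3"] that(2) no32 by auto
  have eq_p: "p = q" if "p \<in> ps" "q \<in> ps" "butlast p = butlast q" for p q
    using path(1)[OF that(1)] path(1)[OF that(2)] that(3) by metis
  have single: "butlast p = [s]" if "p \<in> ps" "last (butlast p) = s" for p
    using path(2-4)[OF that(1)] that(2)
    by (metis append_butlast_last_id distinct.simps(2) hd_append2 last_ConsR last_in_set list.exhaust_sel
        list.sel(1) butlast.simps)
  have "\<exists>ps. finite ps \<and> int (card ps) = aff_dim ?G \<and> (\<forall>p\<in>ps. directed_path (face_arcs E' ?K) s t p) \<and>
    pairwise (\<lambda>p q. set p \<inter> set q = {s, t}) ps"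
  proof (rule paths_transfer[OF ps, of _ _ _ f])
    fix p assume p: "p \<in> ps"
    let ?p = "butlast p"
    obtain i where i: "i \<in> M" "last ?p = nb i" using path(7)[OF p] by blast
    have iK: "nb i \<in> vertices ?K" by (rule nbK[OF i(1)])
    have "successively (\<lambda>x y. (x, y) \<in> face_arcs E' ?K) ?p"
    proof (rule successively_mono[of "\<lambda>x y. (x, y) \<in> face_arcs E ?G"])
      show "successively (\<lambda>x y. (x, y) \<in> face_arcs E ?G) ?p" by (rule path(6)[OF p])
      fix x y assume "x \<in> set ?p" "y \<in> set ?p" "(x, y) \<in> face_arcs E ?G"
      then show "(x, y) \<in> face_arcs E' ?K"
        using old_set(3)[OF p] path(5)[OF p] oldE[of x y] by (auto simp: face_arcs_iff)
    qed
    moreover have "ext (nb i) \<noteq> [] \<Longrightarrow> (nb i, hd (ext (nb i))) \<in> face_arcs E' ?K"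
    proof -
      have "i = 0 \<or> i = 1 \<or> i = 2 \<or> i = 3" using i(1) M by (auto simp: J_def)
      then show "ext (nb i) \<noteq> [] \<Longrightarrow> (nb i, hd (ext (nb i))) \<in> face_arcs E' ?K"
        using iK tK cK[of 0] cK[of 1] i(1) cases nb_distinct E'_c0(1) E'_c1(1) E'_c[of 2 3] c01(4,5) nbK[of 3]
        by (elim disjE) (auto simp: ext_def face_arcs_iff ord_def J_def)
    qed
    moreover have "successively (\<lambda>x y. (x, y) \<in> face_arcs E' ?K) (ext (nb i))"
    proof -
      have "(c 0, c 1) \<in> face_arcs E' ?K" if "i = 0" "1 \<in> M"
        using that i(1) cK[of 0] cK[of 1] E'_c0(2) by (simp add: face_arcs_iff)
      moreover have "i = 0" if "nb i = nb 0" using nb_eq[of i 0] that i(1) M by (auto simp: J_def)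
      ultimately show ?thesis by (auto simp: ext_def)
    qed
    ultimately have "successively (\<lambda>x y. (x, y) \<in> face_arcs E' ?K) (f p)"
      unfolding f_def i(2) successively_append_iff by (auto simp: i(2))
    moreover have "distinct (f p)"
    proof -
      have "nb 3 \<notin> set ?p" if "1 \<notin> M" "0 \<notin> M" "nb i \<noteq> nb 3"
      proof -
        have "i = 2" using that cases i(1) by auto
        then show ?thesis using no3[OF p] i(2) by blast
      qed
      then show ?thesis unfolding f_def i(2) using path(4)[OF p] old_set[OF p] c01(3)
        by (auto simp: ext_def)
    qed
    moreover have "hd (f p) = s" "f p \<noteq> []" using path(2,3)[OF p] by (auto simp: f_def)
    moreover have "last (f p) = t" using i(2) path(2)[OF p] by (auto simp: f_def ext_def t_def)
    ultimately show "directed_path (face_arcs E' ?K) s t (f p)" by (simp add: directed_path_def)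
  next
    fix p q assume pq: "p \<in> ps" "q \<in> ps" "p \<noteq> q" "set p \<inter> set q = {s, v}"
    have disj: "set (butlast p) \<inter> set (butlast q) \<subseteq> {s}"
    proof
      fix x assume x: "x \<in> set (butlast p) \<inter> set (butlast q)"
      then have "x \<in> set p \<inter> set q" by (auto dest: in_set_butlastD)
      then have "x \<in> {s, v}" unfolding pq(4) .
      then show "x \<in> {s}" using x path(5)[OF pq(1)] by blast
    qed
    \<comment> \<open>\<open>c 0\<close> may be an inner vertex of one path only. If two truncated
      paths both ended at \<open>nb 0\<close>, disjointness would make \<open>nb 0\<close> the
      source and both paths that single vertex, hence equal.\<close>
    have c0: "\<not> (last (butlast p) = nb 0 \<and> last (butlast q) = nb 0)"
    proof
      assume *: "last (butlast p) = nb 0 \<and> last (butlast q) = nb 0"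
      then have "nb 0 \<in> set (butlast p) \<inter> set (butlast q)"
        using path(2)[OF pq(1)] path(2)[OF pq(2)] last_in_set by (metis IntI)
      then have "nb 0 = s" using disj by blast
      then have "butlast p = butlast q" using single[OF pq(1)] single[OF pq(2)] * by simp
      then show False using eq_p pq by blast
    qed
    have sub: "set (f r) \<subseteq> set (butlast r) \<union> {t} \<union> (if 1 \<in> M \<and> last (butlast r) = nb 0 then {c 0} else {})" for r
      by (auto simp: f_def ext_def t_def)
    show "set (f p) \<inter> set (f q) \<subseteq> {s, t}"
      using sub[of p] sub[of q] disj c0 old_set(1)[OF pq(1)] old_set(1)[OF pq(2)] by (auto split: if_splits)
  next
    show "inj_on f ps"
    proof (rule inj_onI)
      fix p q assume pq: "p \<in> ps" "q \<in> ps" "f p = f q"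
      show "p = q"
      proof (cases "0 \<in> M \<or> 1 \<in> M")
        case True
        \<comment> \<open>The appended vertices are new, so cutting them off recovers the
          path.\<close>
        have "takeWhile (\<lambda>x. x \<notin> {c 0, c 1}) (f r) = butlast r" if "r \<in> ps" for r
        proof -
          have "takeWhile (\<lambda>x. x \<notin> {c 0, c 1}) (f r) = butlast r @ takeWhile (\<lambda>x. x \<notin> {c 0, c 1}) (ext (last (butlast r)))"
            unfolding f_def by (rule takeWhile_append2) (use old_set[OF that] in auto)
          then show ?thesis using True by (auto simp: ext_def)
        qed
        then show ?thesis using eq_p pq by metis
      next
        case False
        then have M23: "M = {2, 3}" using cases by blast
        \<comment> \<open>A collision makes one truncated path the other one prolonged by
          \<open>nb 3\<close>. Disjointness shrinks them to \<open>[nb 2]\<close> and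
          \<open>[nb 2, nb 3]\<close>, so the segment is an edge of \<open>P\<close>, and then
          \<open>\<Phi> {2, 3}\<close> has no point on the positive side.\<close>
        have contra: False if "p \<in> ps" "q \<in> ps" "f p = f q" "last (butlast p) = nb 2" "last (butlast q) = nb 3" for p q
        proof -
          have eq: "butlast q = butlast p @ [nb 3]"
            using that(3-5) False nb_distinct by (simp add: f_def ext_def)
          have "set (butlast p) \<subseteq> {s}"
          proof
            fix x assume x: "x \<in> set (butlast p)"
            then have "x \<in> set (butlast q)" using eq by simp
            moreover have "p \<noteq> q" using that(4,5) nb_distinct by auto
            ultimately have int: "set p \<inter> set q = {s, v}"
              using ps(4) that(1,2) by (simp add: pairwise_def)
            have "x \<in> set p \<inter> set q"
              using x \<open>x \<in> set (butlast q)\<close> by (auto dest: in_set_butlastD)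
            then have "x \<in> {s, v}" unfolding int .
            then show "x \<in> {s}" using x path(5)[OF that(1)] by blast
          qed
          then have "last (butlast p) = s" using path(2)[OF that(1)] last_in_set by blast
          then have "butlast q = [nb 2, nb 3]" using single[OF that(1)] that(4) eq by simp
          then have "(nb 2, nb 3) \<in> E" using path(6)[OF that(2)] by (simp add: face_arcs_iff)
          then have "\<Phi> {2, 3} \<inter> Hpos = {}" using edge_23_arc Phi_23_pos by blast
          then show False using pos M23 by simp
        qed
        have lasts: "last (butlast r) = nb 2 \<or> last (butlast r) = nb 3" if "r \<in> ps" for r
          using path(7)[OF that] M23 by auto
        have "last (butlast p) = last (butlast q)"
          using lasts[OF pq(1)] lasts[OF pq(2)] contra[of p q] contra[of q p] pq by metis
        then have "butlast p = butlast q" using pq(3) by (simp add: f_def)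
        then show ?thesis using eq_p pq by blast
      qed
    qed
  qed
  then show ?thesis using kappa_dim[OF F pos] by (intro face_okI[OF src snk]) simp
qed

theorem holt_klee_T: "holt_klee T E'"
  unfolding holt_klee_iff
proof (intro allI impI)
  fix K assume K: "K face_of T \<and> K \<noteq> {}"
  show "face_ok E' K"
  proof (cases "K \<subseteq> H")
    case True
    then obtain M where M: "M \<subseteq> J" "K = \<sigma> M" using faceT_H K by blast
    then have "M \<noteq> {}" using K by (auto simp: \<sigma>_def)
    then show ?thesis using face_ok_sigma M by blast
  next
    case False
    then obtain F where F: "F face_of P" "F \<inter> Hpos \<noteq> {}" "K = \<kappa> F" using faceT_pos K by blast
    show ?thesis
    proof (cases "v \<in> F")
      case True
      then obtain M where "M \<subseteq> J" "F = \<Phi> M" using Phi_surj F(1) by blast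
      then show ?thesis using face_ok_cut F by blast
    next
      case False
      then show ?thesis using face_ok_old[OF F(1) _ False] face_subset_Hcl(2)[OF F(1) False] F K by auto
    qed
  qed
qed

theorem X_type_T:
  assumes "\<not> shelling_property P E"
  shows "X_type T E'"
  unfolding X_type_def
  using polytopal_T acyclic_T holt_klee_T assms shelling_property_lift holt_klee_def by blast

end

theorem theorem4:
  fixes P :: "(real ^ 4) set" and E :: "((real ^ 4) \<times> (real ^ 4)) set"
    and v v1 v2 v3 v4 u1 u2 a :: "real ^ 4" and b :: real
    and H Hplus :: "(real ^ 4) set"
  assumes "polytope P" and "aff_dim P = 4"
    and "X_type P E"
    and "sink_in E P v" and "simple_vertex P v"
    and "neighbours P v = {v1, v2, v3, v4}" and "distinct [v1, v2, v3, v4]"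
    and "(v4, v3) \<notin> E\<^sup>*"
    and "u1 \<in> rel_interior (closed_segment v v1)"
    and "u2 \<in> rel_interior (closed_segment v v2)"
    and "a \<noteq> 0" and "H = {x. a \<bullet> x = b}" and "{u1, u2, v3, v4} \<subseteq> H"
    and "Hplus = {x. a \<bullet> x > b}" and "vertices P - {v, v3, v4} \<subseteq> Hplus"
  shows "X_type (P \<inter> (H \<union> Hplus)) (tr_arcs E (P \<inter> (H \<union> Hplus)) v1 v2 v3 v4 u1 u2)"
proof -
  \<comment> \<open>The labels are shifted by one: 0 and 1 index the neighbours whose edges are cut
    in the interior, 2 and 3 those on \<open>H\<close>.\<close>
  define nb where "nb i = (if i = 0 then v1 else if i = 1 then v2 else if i = 2 then v3 else v4)" for i :: nat
  define c where "c i = (if i = 0 then u1 else if i = 1 then u2 else if i = 2 then v3 else v4)" for i :: nat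
  have ne: "v \<noteq> w" if "w \<in> neighbours P v" for w
    using that by (auto simp: neighbours_def edge_of_def)
  \<comment> \<open>The relative interior of a segment is the open segment once its end points
    differ, which holds because the segment is an edge.\<close>
  have u: "u1 \<in> open_segment v v1" "u2 \<in> open_segment v v2"
    using assms(9,10) ne[of v1] ne[of v2] assms(6) by (auto simp: rel_interior_closed_segment)
  have X: "polytopal_digraph P E" "acyclic E" "holt_klee P E" "\<not> shelling_property P E"
    using assms(3) by (auto simp: X_type_def)
  interpret tr: truncation_digraph P v a b nb c E
  proof unfold_locales
    show "v \<in> vertices P" using assms(4) by (simp add: sink_in_def)
    show "neighbours P v = nb ` {0, 1, 2, 3}" using assms(6) by (auto simp: nb_def)
    show "inj_on nb {0, 1, 2, 3}" using assms(7) by (auto simp: inj_on_def nb_def)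
    show "(nb 3, nb 2) \<notin> E\<^sup>*" using assms(8) by (simp add: nb_def)
    show "c i \<in> open_segment v (nb i)" if "i \<in> {0, 1}" for i using that u by (auto simp: c_def nb_def)
    show "c i = nb i" if "i \<in> {2, 3}" for i using that by (auto simp: c_def nb_def)
    show "a \<bullet> c i = b" if "i \<in> {0, 1, 2, 3}" for i
      using that assms(12,13) by (auto simp: c_def)
    show "b < a \<bullet> w" if "w \<in> vertices P" "w \<notin> {v, nb 2, nb 3}" for w
      using that assms(14,15) by (auto simp: nb_def)
  qed (use assms(1,2,4) X in auto)
  have "tr.T = P \<inter> (H \<union> Hplus)"
    unfolding tr.T_def tr.\<kappa>_def tr.Hcl_split using assms(12,14) by (simp add: tr.H_def tr.Hpos_def)
  moreover have "tr.E' = tr_arcs E tr.T v1 v2 v3 v4 u1 u2"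
    unfolding tr.E'_def by (simp add: nb_def c_def)
  ultimately show ?thesis using tr.X_type_T[OF X(4)] by simp
qed

end
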